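(* Assume the Exponential Time Hypothesis and the Projection Games Conjecture. Then: (1) There exist constants $F_1,F_2>0$ such that the Set Cover problem does not admit an FPT optimum approximation algorithm with ratio $\rho(OPT)=OPT^{F_1}$ running in time $2^{OPT^{F_2}}\cdot\mathrm{poly}(N,M)$, where $N$ is the size of the universe and $M$ is the number of sets. (2) There exist constants $F_3,F_4>0$ such that the Set Cover problem does not admit an FPT approximation algorithm with ratio $\rho(k)=k^{F_3}$ running in time $2^{k^{F_4}}\cdot\mathrm{poly}(N,M)$, where $N$ is the size of the universe and $M$ is the number of sets.
   Context: Set Cover: given a universe $U$ of size $N$ and a collection $\mathcal{S}$ of $M$ subsets of $U$ whose union is $U$, find a minimum-cardinality subcollection whose union is $U$; $OPT$ is the minimum size. For a minimization problem, an FPT approximation algorithm with ratio $\rho$ is an algorithm that, given an instance $x$ and integer $k$ with $OPT(x)\le k$, outputs a feasible solution of cost at most $k\cdot\rho(k)$ (arbitrary output otherwise); an FPT optimum approximation algorithm with ratio $\rho$ is an algorithm that, given an instance $x$, outputs a feasible solution of cost at most $OPT(x)\cdot\rho(OPT(x))$. Exponential Time Hypothesis (ETH): 3-SAT cannot be solved in $2^{o(n)}$ time, where $n$ is the number of variables. A projection game consists of a bipartite graph $G=(V_1,V_2,E)$, a finite alphabet $\Sigma$, and for each edge $e$ a function $\pi_e:\Sigma\to\Sigma$; an assignment $\phi:V_1\cup V_2\to\Sigma$ satisfies edge $e=\{a,b\}$ ($a\in V_1$, $b\in V_2$) if $\pi_e(\phi(a))=\phi(b)$; the size of the game is $|V_1|+|V_2|+|E|$.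 Projection Games Conjecture (PGC): there exists $c>0$ such that for every $\epsilon>0$ there is a polynomial-time reduction from SAT to projection games mapping an instance $I$ to an instance $I_1$ such that: if $I$ is satisfiable and $|I|^c\ge 1/\epsilon$ then all edges of $I_1$ can be satisfied; if $I$ is unsatisfiable and $|I|^c\ge 1/\epsilon$ then at most an $\epsilon$-fraction of the edges of $I_1$ can be satisfied; $|I_1|=|I|^{1+o(1)}\cdot\mathrm{poly}(1/\epsilon)$; and the alphabet of $I_1$ has size $\mathrm{poly}(1/\epsilon)$. *)

theory Defs
  imports Complex_Main "HOL-Library.Landau_Symbols"
begin

section \<open>Model of computation\<close>

text \<open>
  Programs are written in a while language over binary trees, in the style of Jones' language WHILE.
  An assignment is charged the number of nodes of the tree it stores, a test is charged 1. Hence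
  the total size of the store never exceeds a constant (depending on the program) plus the input
  size plus the running time. A multitape Turing machine can therefore simulate a program, and
  a program can simulate a Turing machine (a tape being a pair of stacks), with at most
  polynomial overhead in time and input size.
\<close>

datatype tree = Null | Pair tree tree

fun nodes :: "tree \<Rightarrow> nat" where
  "nodes Null = 1"
| "nodes (Pair a b) = 1 + nodes a + nodes b"

datatype exp = Nul | Var nat | Cons exp exp | Hd exp | Tl exp | Eq exp exp

type_synonym store = "nat \<Rightarrow> tree"

fun left :: "tree \<Rightarrow> tree" where
  "left Null = Null"
| "left (Pair a b) = a"

fun right :: "tree \<Rightarrow> tree" where
  "right Null = Null"
| "right (Pair a b) = b"

definition enc_bool :: "bool \<Rightarrow> tree" where
  "enc_bool b = (if b then Pair Null Null else Null)"

fun exp_val :: "exp \<Rightarrow> store \<Rightarrow> tree" where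
  "exp_val Nul s = Null"
| "exp_val (Var v) s = s v"
| "exp_val (Cons e f) s = Pair (exp_val e s) (exp_val f s)"
| "exp_val (Hd e) s = left (exp_val e s)"
| "exp_val (Tl e) s = right (exp_val e s)"
| "exp_val (Eq e f) s = enc_bool (exp_val e s = exp_val f s)"

datatype com =
    Skip
  | Assign nat exp
  | Seq com com
  | Cond nat com com
  | While nat com

text \<open>\<open>exec c s t s'\<close>: started in store \<open>s\<close>, the program \<open>c\<close> halts after time \<open>t\<close> in store \<open>s'\<close>.
  The tree \<open>Null\<close> counts as false, every other tree as true.\<close>

inductive exec :: "com \<Rightarrow> store \<Rightarrow> nat \<Rightarrow> store \<Rightarrow> bool" where
  Skip: "exec Skip s 1 s"
| Assign: "exec (Assign v e) s (nodes (exp_val e s)) (s(v := exp_val e s))"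
| Seq: "exec c s t s' \<Longrightarrow> exec d s' t' s'' \<Longrightarrow> exec (Seq c d) s (t + t') s''"
| CondT: "s v \<noteq> Null \<Longrightarrow> exec c s t s' \<Longrightarrow> exec (Cond v c d) s (1 + t) s'"
| CondF: "s v = Null \<Longrightarrow> exec d s t s' \<Longrightarrow> exec (Cond v c d) s (1 + t) s'"
| WhileF: "s v = Null \<Longrightarrow> exec (While v c) s 1 s"
| WhileT: "s v \<noteq> Null \<Longrightarrow> exec c s t s' \<Longrightarrow> exec (While v c) s' t' s'' \<Longrightarrow>
    exec (While v c) s (1 + t + t') s''"

inductive_cases exec_SkipE: "exec Skip s t s'"
inductive_cases exec_AssignE: "exec (Assign v e) s t s'"
inductive_cases exec_SeqE: "exec (Seq c d) s t s'"
inductive_cases exec_CondE: "exec (Cond v c d) s t s'"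
inductive_cases exec_WhileE: "exec (While v c) s t s'"

lemma exec_deterministic:
  "exec c s t s' \<Longrightarrow> exec c s u s'' \<Longrightarrow> t = u \<and> s' = s''"
proof (induction arbitrary: u s'' rule: exec.induct)
  case Skip
  from Skip.prems show ?case by (rule exec_SkipE) simp
next
  case Assign
  from Assign.prems show ?case by (rule exec_AssignE) simp
next
  case Seq
  from Seq.prems show ?case by (rule exec_SeqE) (metis Seq.IH)
next
  case CondT
  from CondT.prems show ?case by (rule exec_CondE) (metis CondT.hyps CondT.IH plus_1_eq_Suc)+
next
  case CondF
  from CondF.prems show ?case by (rule exec_CondE) (metis CondF.hyps CondF.IH plus_1_eq_Suc)+
next
  case WhileF
  from WhileF.prems show ?case by (rule exec_WhileE) (metis WhileF.hyps One_nat_def)+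
next
  case WhileT
  from WhileT.prems show ?case by (rule exec_WhileE) (metis WhileT.hyps WhileT.IH plus_1_eq_Suc add_Suc)+
qed

text \<open>Input and output are passed in variable 0; all other variables are initially \<open>Null\<close>.\<close>

definition runs :: "com \<Rightarrow> tree \<Rightarrow> nat \<Rightarrow> tree \<Rightarrow> bool" where
  "runs p x t y \<longleftrightarrow> (\<exists>s. exec p ((\<lambda>_. Null)(0 := x)) t s \<and> s 0 = y)"

definition polytime_computable :: "('a \<Rightarrow> tree) \<Rightarrow> ('b \<Rightarrow> tree) \<Rightarrow> ('a \<Rightarrow> 'b) \<Rightarrow> bool" where
  "polytime_computable enc_in enc_out f \<longleftrightarrow>
    (\<exists>p C d. \<forall>x. \<exists>t. runs p (enc_in x) t (enc_out (f x)) \<and> t \<le> C * nodes (enc_in x) ^ d)"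

section \<open>Encodings\<close>

text \<open>Numbers are encoded in binary, least significant bit first.\<close>

fun enc_nat :: "nat \<Rightarrow> tree" where
  "enc_nat 0 = Null"
| "enc_nat (Suc n) = Pair (enc_bool (odd (Suc n))) (enc_nat (Suc n div 2))"

fun enc_unary :: "nat \<Rightarrow> tree" where
  "enc_unary 0 = Null"
| "enc_unary (Suc n) = Pair Null (enc_unary n)"

fun enc_list :: "('a \<Rightarrow> tree) \<Rightarrow> 'a list \<Rightarrow> tree" where
  "enc_list f [] = Null"
| "enc_list f (x # xs) = Pair (f x) (enc_list f xs)"

fun enc_prod :: "('a \<Rightarrow> tree) \<Rightarrow> ('b \<Rightarrow> tree) \<Rightarrow> 'a \<times> 'b \<Rightarrow> tree" where
  "enc_prod f g (x, y) = Pair (f x) (g y)"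

section \<open>Satisfiability and the Exponential Time Hypothesis\<close>

text \<open>A literal \<open>(b, v)\<close> is true under an assignment \<open>a\<close> iff \<open>a v = b\<close>.\<close>

type_synonym clause = "(bool \<times> nat) list"
type_synonym cnf = "clause list"

definition cnf_vars :: "cnf \<Rightarrow> nat set" where
  "cnf_vars I = (\<Union>C \<in> set I. snd ` set C)"

definition satisfiable :: "cnf \<Rightarrow> bool" where
  "satisfiable I \<longleftrightarrow> (\<exists>a :: nat \<Rightarrow> bool. \<forall>C \<in> set I. \<exists>(b, v) \<in> set C. a v = b)"

definition enc_cnf :: "cnf \<Rightarrow> tree" where
  "enc_cnf = enc_list (enc_list (enc_prod enc_bool enc_nat))"

definition cnf_size :: "cnf \<Rightarrow> nat" where
  "cnf_size I = nodes (enc_cnf I)"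

text \<open>Repeated literals, repeated clauses and gaps in the numbering of the variables are excluded, so that
  the length of an instance is polynomial in its number of variables; otherwise no algorithm
  whose running time is bounded in terms of the number of variables alone could read its input.\<close>

definition three_cnf :: "cnf \<Rightarrow> bool" where
  "three_cnf I \<longleftrightarrow>
    (\<forall>C \<in> set I. distinct C \<and> length C \<le> 3) \<and> distinct (map set I) \<and>
    cnf_vars I = {..<card (cnf_vars I)}"

definition ETH :: bool where
  "ETH \<longleftrightarrow> \<not> (\<exists>p (f :: nat \<Rightarrow> real). f \<in> o(\<lambda>n. real n) \<and>
    (\<forall>I. three_cnf I \<longrightarrow>
      (\<exists>t. runs p (enc_cnf I) t (enc_bool (satisfiable I)) \<and>
           real t \<le> 2 powr f (card (cnf_vars I)))))"

section \<open>Projection games and the Projection Games Conjecture\<close>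

text \<open>The two sides are \<open>{..<nleft G}\<close> and \<open>{..<nright G}\<close>, the alphabet is \<open>{..<nalph G}\<close>. In
  \<open>(a, b, xs) \<in> set (edges G)\<close>, the list \<open>xs\<close> is the table of values of the projection.\<close>

record game =
  nleft :: nat
  nright :: nat
  nalph :: nat
  edges :: "(nat \<times> nat \<times> nat list) list"

text \<open>The edge set is required to be nonempty, since otherwise the fraction of satisfied edges
  makes no sense.\<close>

definition projection_game :: "game \<Rightarrow> bool" where
  "projection_game G \<longleftrightarrow>
    nalph G > 0 \<and> edges G \<noteq> [] \<and>
    distinct (map (\<lambda>(a, b, xs). (a, b)) (edges G)) \<and>
    (\<forall>(a, b, xs) \<in> set (edges G). a < nleft G \<and> b < nright G \<and>
       length xs = nalph G \<and> set xs \<subseteq> {..<nalph G})"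

definition game_size :: "game \<Rightarrow> nat" where
  "game_size G = nleft G + nright G + length (edges G)"

definition enc_game :: "game \<Rightarrow> tree" where
  "enc_game G = enc_prod enc_nat (enc_prod enc_nat (enc_prod enc_nat
     (enc_list (enc_prod enc_nat (enc_prod enc_nat (enc_list enc_nat))))))
     (nleft G, nright G, nalph G, edges G)"

definition game_assignment :: "game \<Rightarrow> (nat + nat \<Rightarrow> nat) \<Rightarrow> bool" where
  "game_assignment G \<phi> \<longleftrightarrow> \<phi> ` ({..<nleft G} <+> {..<nright G}) \<subseteq> {..<nalph G}"

definition satisfied_edges :: "game \<Rightarrow> (nat + nat \<Rightarrow> nat) \<Rightarrow> (nat \<times> nat \<times> nat list) set" where
  "satisfied_edges G \<phi> = {(a, b, xs) \<in> set (edges G). xs ! \<phi> (Inl a) = \<phi> (Inr b)}"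

text \<open>The soundness parameter \<open>\<epsilon>\<close> is a function of the size of the SAT instance, such that
  \<open>1 / \<epsilon>\<close> (rounded up) is computable in polynomial time; constants are a special case. The
  bounds \<open>n powr (1 + \<delta> n)\<close> with \<open>\<delta>\<close> tending to 0 and \<open>K * (1 + 1 / \<epsilon>) ^ d\<close>
  stand for \<open>n\<close> to the power \<open>1 + o(1)\<close> and for \<open>poly(1 / \<epsilon>)\<close>.\<close>

definition PGC :: bool where
  "PGC \<longleftrightarrow> (\<exists>(c :: real) (\<delta> :: nat \<Rightarrow> real) (K :: real) (d :: nat).
    c > 0 \<and> \<delta> \<longlonglongrightarrow> 0 \<and>
    (\<forall>\<epsilon> :: nat \<Rightarrow> real.
      (\<forall>n. \<epsilon> n > 0) \<and> polytime_computable enc_unary enc_nat (\<lambda>n. nat \<lceil>1 / \<epsilon> n\<rceil>) \<longrightarrow>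
      (\<exists>R :: cnf \<Rightarrow> game. polytime_computable enc_cnf enc_game R \<and>
        (\<forall>I. let n = cnf_size I; G = R I in
          projection_game G \<and>
          (satisfiable I \<and> real n powr c \<ge> 1 / \<epsilon> n \<longrightarrow>
            (\<exists>\<phi>. game_assignment G \<phi> \<and> satisfied_edges G \<phi> = set (edges G))) \<and>
          (\<not> satisfiable I \<and> real n powr c \<ge> 1 / \<epsilon> n \<longrightarrow>
            (\<forall>\<phi>. game_assignment G \<phi> \<longrightarrow>
              real (card (satisfied_edges G \<phi>)) \<le> \<epsilon> n * real (length (edges G)))) \<and>
          real (game_size G) \<le> real n powr (1 + \<delta> n) * (K * (1 + 1 / \<epsilon> n) ^ d) \<and>
          real (nalph G) \<le> K * (1 + 1 / \<epsilon> n) ^ d))))"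

section \<open>Minimization problems and FPT approximation\<close>

record ('i, 's) min_problem =
  instances :: "'i set"
  feasible :: "'i \<Rightarrow> 's \<Rightarrow> bool"
  cost :: "'i \<Rightarrow> 's \<Rightarrow> nat"
  enc_inst :: "'i \<Rightarrow> tree"
  enc_sol :: "'s \<Rightarrow> tree"

definition OPT :: "('i, 's) min_problem \<Rightarrow> 'i \<Rightarrow> nat" where
  "OPT P x = (LEAST c. \<exists>s. feasible P x s \<and> cost P x s = c)"

text \<open>In both definitions, \<open>T\<close> bounds the running time. An FPT approximation algorithm has to
  respect this bound on all inputs, including those with \<open>OPT P x > k\<close>.\<close>

definition fpt_approx_algorithm ::
  "('i, 's) min_problem \<Rightarrow> (nat \<Rightarrow> real) \<Rightarrow> ('i \<Rightarrow> nat \<Rightarrow> real) \<Rightarrow> com \<Rightarrow> bool" where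
  "fpt_approx_algorithm P \<rho> T p \<longleftrightarrow>
    (\<forall>x \<in> instances P. \<forall>k. \<exists>t y.
      runs p (Pair (enc_inst P x) (enc_nat k)) t y \<and> real t \<le> T x k \<and>
      (OPT P x \<le> k \<longrightarrow>
        (\<exists>s. y = enc_sol P s \<and> feasible P x s \<and> real (cost P x s) \<le> real k * \<rho> k)))"

definition fpt_optimum_approx_algorithm ::
  "('i, 's) min_problem \<Rightarrow> (nat \<Rightarrow> real) \<Rightarrow> ('i \<Rightarrow> real) \<Rightarrow> com \<Rightarrow> bool" where
  "fpt_optimum_approx_algorithm P \<rho> T p \<longleftrightarrow>
    (\<forall>x \<in> instances P. \<exists>t s.
      runs p (enc_inst P x) t (enc_sol P s) \<and> real t \<le> T x \<and>
      feasible P x s \<and> real (cost P x s) \<le> real (OPT P x) * \<rho> (OPT P x))"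

section \<open>Set Cover\<close>

text \<open>The universe is \<open>{..<N}\<close>. The subsets form an indexed family, each member being listed without
  repetition, so that the input length is polynomial in \<open>N\<close> and \<open>M\<close>. A subcollection is
  given by a list of indices.\<close>

record set_cover_instance =
  universe_size :: nat
  subsets :: "nat list list"

abbreviation num_sets :: "set_cover_instance \<Rightarrow> nat" where
  "num_sets x \<equiv> length (subsets x)"

definition set_cover :: "(set_cover_instance, nat list) min_problem" where
  "set_cover = \<lparr>
     instances = {x. (\<forall>S \<in> set (subsets x). distinct S) \<and>
                     (\<Union>S \<in> set (subsets x). set S) = {..<universe_size x}},
     feasible = (\<lambda>x s. set s \<subseteq> {..<num_sets x} \<and>
                       (\<Union>i \<in> set s. set (subsets x ! i)) = {..<universe_size x}),
     cost = (\<lambda>x s. card (set s)),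
     enc_inst = (\<lambda>x. enc_prod enc_nat (enc_list (enc_list enc_nat)) (universe_size x, subsets x)),
     enc_sol = enc_list enc_nat\<rparr>"

end

theory Submission
  imports Defs "HOL-Real_Asymp.Real_Asymp"
begin

text \<open>
  A projection game with edge set \<open>E\<close> and alphabet \<open>\<Sigma>\<close> becomes a Set Cover instance as follows. Every
  vertex is replaced by one copy per incident edge, so that counting copies weights a vertex by its
  degree. For every edge \<open>e = (a, b)\<close>, every copy of \<open>a\<close> and every copy of \<open>b\<close> the universe contains a
  copy of the power set of \<open>\<Sigma>\<close>; labelling the copy of \<open>a\<close> with \<open>\<sigma>\<close> covers the sets that miss
  \<open>\<pi>\<^sub>e \<sigma>\<close>, labelling the copy of \<open>b\<close> with \<open>\<tau>\<close> covers the sets that contain \<open>\<tau>\<close>. These labels cover the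
  whole power set only if some pair of them satisfies \<open>e\<close>. A satisfying assignment therefore gives a
  cover of size \<open>2 |E|\<close>. Conversely, in a cover of size \<open>2 |E| w\<close> give each vertex the list of labels of
  its cheapest copy: at least half of the edges have lists of total length at most \<open>4 w\<close>, and by
  pigeonhole one pair of positions in the lists satisfies at least \<open>|E| / (32 w\<^sup>2)\<close> edges.

  With \<open>1 / \<epsilon> = 64 w\<^sup>2\<close> and \<open>w\<close> a small power of the size of the formula, \<open>|\<Sigma>| = O(\<surd>v)\<close> for the number
  \<open>v\<close> of variables, so that the instance and the whole computation have size
  \<open>2\<close> to the power \<open>O(\<surd>v)\<close>, while \<open>w\<close> exceeds \<open>(2 |E|) powr F\<close> for a constant \<open>F > 0\<close>. The size of a
  cover thus decides satisfiability in time \<open>2\<close> to the power \<open>o(v)\<close>.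
\<close>

section \<open>Polynomially bounded running times\<close>

text \<open>The value of a game counts edges, while a cover pays for labels at vertices, and the
  games of the conjecture need not be regular; copies reconcile the two. The cheapest copies of the
  endpoints of an edge may belong to other edges, so every pair of copies has to be tied to its
  constraint. The full power set is used because the critical test set, the projections of all
  labels at one copy, must itself occur, however many labels there are. The price is a universe
  exponential in the alphabet. One exponent \<open>1 / q\<close> has to serve conflicting aims: for
  formulas of size \<open>n\<close>, the gap \<open>w\<close> must remain a fixed positive power of
  \<open>n\<close> in order to beat a power of the optimum, \<open>64 w^2\<close> must stay below
  \<open>n powr c\<close>, and the alphabet, polynomial in \<open>w\<close>, must stay below a
  multiple of \<open>n powr (1 / 8)\<close>. As \<open>n\<close> is at most quartic in the number
  \<open>v\<close> of variables, this is of order \<open>sqrt v\<close>, so even an exponential in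
  the alphabet size is below the times that ETH excludes. The running time of the assumed algorithm
  is tamed in the same way, by a small exponent on its parameter.\<close>

definition poly_bounded :: "'a set \<Rightarrow> ('a \<Rightarrow> nat) \<Rightarrow> ('a \<Rightarrow> nat) \<Rightarrow> bool" where
  "poly_bounded D B T \<longleftrightarrow> (\<exists>C d. \<forall>x\<in>D. T x \<le> C * Suc (B x) ^ d)"

lemma poly_boundedI: "(\<And>x. x \<in> D \<Longrightarrow> T x \<le> C * Suc (B x) ^ d) \<Longrightarrow> poly_bounded D B T"
  unfolding poly_bounded_def by blast

lemma poly_bounded_mono: "poly_bounded D B S \<Longrightarrow> (\<And>x. x \<in> D \<Longrightarrow> T x \<le> S x) \<Longrightarrow> poly_bounded D B T"
  unfolding poly_bounded_def by (meson order_trans)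

lemma poly_bounded_const: "poly_bounded D B (\<lambda>_. c)"
  by (rule poly_boundedI[where C = c and d = 0]) simp

lemma poly_bounded_self: "poly_bounded D B B"
  by (rule poly_boundedI[where C = 1 and d = 1]) simp

lemma poly_bounded_add:
  assumes "poly_bounded D B S" "poly_bounded D B T"
  shows "poly_bounded D B (\<lambda>x. S x + T x)"
proof -
  obtain C d where S: "\<forall>x\<in>D. S x \<le> C * Suc (B x) ^ d" using assms(1) unfolding poly_bounded_def by blast
  obtain C' d' where T: "\<forall>x\<in>D. T x \<le> C' * Suc (B x) ^ d'" using assms(2)
      unfolding poly_bounded_def by blast
  have "S x + T x \<le> (C + C') * Suc (B x) ^ max d d'" if "x \<in> D" for x
  proof -
    have "C * Suc (B x) ^ d \<le> C * Suc (B x) ^ max d d'"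
      by (intro mult_left_mono power_increasing) auto
    moreover have "C' * Suc (B x) ^ d' \<le> C' * Suc (B x) ^ max d d'"
      by (intro mult_left_mono power_increasing) auto
    ultimately have "S x + T x \<le> C * Suc (B x) ^ max d d' + C' * Suc (B x) ^ max d d'"
      using S T that by (meson add_mono order_trans)
    then show ?thesis by (simp add: distrib_right)
  qed
  then show ?thesis by (rule poly_boundedI)
qed

lemma poly_bounded_mult:
  assumes "poly_bounded D B S" "poly_bounded D B T"
  shows "poly_bounded D B (\<lambda>x. S x * T x)"
proof -
  obtain C d where S: "\<forall>x\<in>D. S x \<le> C * Suc (B x) ^ d" using assms(1) unfolding poly_bounded_def by blast
  obtain C' d' where T: "\<forall>x\<in>D. T x \<le> C' * Suc (B x) ^ d'" using assms(2)
      unfolding poly_bounded_def by blast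
  have "S x * T x \<le> (C * C') * Suc (B x) ^ (d + d')" if "x \<in> D" for x
  proof -
    have "S x * T x \<le> (C * Suc (B x) ^ d) * (C' * Suc (B x) ^ d')"
      using S T that by (intro mult_mono) auto
    then show ?thesis by (simp add: power_add ac_simps)
  qed
  then show ?thesis by (rule poly_boundedI)
qed

lemma poly_bounded_power: "poly_bounded D B S \<Longrightarrow> poly_bounded D B (\<lambda>x. S x ^ k)"
proof (induction k)
  case 0
  show ?case by (simp add: poly_bounded_const del: One_nat_def)
next
  case (Suc k)
  show ?case using poly_bounded_mult[OF Suc.prems Suc.IH[OF Suc.prems]] by simp
qed

lemma poly_bounded_trans:
  assumes "poly_bounded D S T" "poly_bounded D B S"
  shows "poly_bounded D B T"
proof -
  obtain C d where T: "\<forall>x\<in>D. T x \<le> C * Suc (S x) ^ d" using assms(1) unfolding poly_bounded_def by blast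
  have "poly_bounded D B (\<lambda>x. C * (S x + 1) ^ d)"
    by (intro poly_bounded_mult poly_bounded_power poly_bounded_add poly_bounded_const assms)
  then show ?thesis by (rule poly_bounded_mono) (use T in simp)
qed

lemma poly_bounded_subset: "poly_bounded D B T \<Longrightarrow> D' \<subseteq> D \<Longrightarrow> poly_bounded D' B T"
  unfolding poly_bounded_def by blast

lemma poly_bounded_image: "poly_bounded UNIV nodes T \<Longrightarrow> poly_bounded D (\<lambda>x. nodes (f x)) (\<lambda>x. T (f x))"
  unfolding poly_bounded_def by blast

lemmas poly_bounded_intros = poly_bounded_const poly_bounded_self poly_bounded_add
    poly_bounded_mult poly_bounded_power

section \<open>Composing programs\<close>

fun exp_vars :: "exp \<Rightarrow> nat set" where
  "exp_vars Nul = {}"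
| "exp_vars (Var v) = {v}"
| "exp_vars (Cons e f) = exp_vars e \<union> exp_vars f"
| "exp_vars (Hd e) = exp_vars e"
| "exp_vars (Tl e) = exp_vars e"
| "exp_vars (Eq e f) = exp_vars e \<union> exp_vars f"

fun com_vars :: "com \<Rightarrow> nat set" where
  "com_vars Skip = {}"
| "com_vars (Assign v e) = insert v (exp_vars e)"
| "com_vars (Seq c d) = com_vars c \<union> com_vars d"
| "com_vars (Cond v c d) = insert v (com_vars c \<union> com_vars d)"
| "com_vars (While v c) = insert v (com_vars c)"

lemma finite_exp_vars: "finite (exp_vars e)"
  by (induction e) auto

lemma finite_com_vars: "finite (com_vars c)"
  by (induction c) (auto simp: finite_exp_vars)

lemma exp_val_cong: "(\<And>v. v \<in> exp_vars e \<Longrightarrow> s v = r v) \<Longrightarrow> exp_val e s = exp_val e r"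
  by (induction e) auto

lemma exec_frame: "exec c s t s' \<Longrightarrow> v \<notin> com_vars c \<Longrightarrow> s' v = s v"
  by (induction rule: exec.induct) auto

text \<open>A program is specified from a store that is \<open>Null\<close> outside variable 0, but
  a caller runs it in a store holding further data. Agreement on the variables of the program
  already forces the same run in the same time.\<close>

lemma exec_cong:
  "exec c s t s' \<Longrightarrow> com_vars c \<subseteq> V \<Longrightarrow> (\<And>v. v \<in> V \<Longrightarrow> s v = r v) \<Longrightarrow>
    \<exists>r'. exec c r t r' \<and> (\<forall>v\<in>V. s' v = r' v)"
proof (induction arbitrary: r rule: exec.induct)
  case (Skip s)
  then show ?case using exec.Skip by blast
next
  case (Assign v e s)
  have eq: "exp_val e s = exp_val e r"
    using Assign by (intro exp_val_cong) auto
  show ?case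
    unfolding eq by (rule exI, rule conjI, rule exec.Assign) (use Assign in auto)
next
  case (Seq c s t s' d t' s'')
  obtain r' where r': "exec c r t r'" "\<forall>v\<in>V. s' v = r' v" using Seq.IH(1)[of r] Seq.prems by auto
  obtain r'' where r'': "exec d r' t' r''" "\<forall>v\<in>V. s'' v = r'' v"
      using Seq.IH(2)[of r'] Seq.prems r' by auto
  show ?case using exec.Seq r' r'' by blast
next
  case (CondT s v c t s' d)
  obtain r' where r': "exec c r t r'" "\<forall>v\<in>V. s' v = r' v" using CondT.IH[of r] CondT.prems by auto
  have "r v \<noteq> Null" using CondT.hyps(1) CondT.prems by auto
  then show ?case using exec.CondT r' by blast
next
  case (CondF s v d t s' c)
  obtain r' where r': "exec d r t r'" "\<forall>v\<in>V. s' v = r' v" using CondF.IH[of r] CondF.prems by auto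
  have "r v = Null" using CondF.hyps(1) CondF.prems by auto
  then show ?case using exec.CondF r' by blast
next
  case (WhileF s v c)
  then have "r v = Null" by auto
  then show ?case using exec.WhileF WhileF by blast
next
  case (WhileT s v c t s' t' s'')
  obtain r' where r': "exec c r t r'" "\<forall>v\<in>V. s' v = r' v" using WhileT.IH(1)[of r] WhileT.prems by auto
  obtain r'' where r'': "exec (While v c) r' t' r''" "\<forall>v\<in>V. s'' v = r'' v"
    using WhileT.IH(2)[of r'] WhileT.prems r' by auto
  have "r v \<noteq> Null" using WhileT.hyps(1) WhileT.prems by auto
  then show ?case using exec.WhileT r' r'' by blast
qed

text \<open>Every assignment is charged the size of what it stores, so no value outgrows the time
  spent. Time bounds are thus bounds on output size too, which lets polynomial bounds
  compose.\<close>

lemma exec_nodes_le: "exec c s t s' \<Longrightarrow> nodes (s' v) \<le> nodes (s v) + t"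
  by (induction rule: exec.induct) auto

lemma runs_nodes_le: "runs p x t y \<Longrightarrow> nodes y \<le> nodes x + t"
  unfolding runs_def by (metis exec_nodes_le fun_upd_same)

section \<open>Subroutine calls\<close>

primrec clear_below :: "nat \<Rightarrow> com" where
  "clear_below 0 = Skip"
| "clear_below (Suc n) = Seq (clear_below n) (Assign n Nul)"

lemma exec_clear_below: "exec (clear_below n) s (Suc n) (\<lambda>v. if v < n then Null else s v)"
proof (induction n)
  case 0
  show ?case using exec.Skip[of s] by simp
next
  case (Suc n)
  have "exec (clear_below (Suc n)) s (Suc n + nodes (exp_val Nul s))
      ((\<lambda>v. if v < n then Null else s v)(n := Null))"
    using exec.Seq[OF Suc exec.Assign[of n Nul]] by simp
  moreover have "(\<lambda>v. if v < n then Null else s v)(n := Null) = (\<lambda>v. if v < Suc n then Null else s v)"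
    by (auto simp: less_Suc_eq)
  ultimately show ?case by simp
qed

text \<open>Runs \<open>p\<close> as a subroutine on the value of \<open>e\<close>: \<open>p\<close> only touches variables below \<open>n\<close>, so the
    caller keeps
  its own data in variables from \<open>n\<close> on.\<close>

definition call :: "nat \<Rightarrow> com \<Rightarrow> exp \<Rightarrow> com" where
  "call n p e = Seq (clear_below n) (Seq (Assign 0 e) p)"

text \<open>The scratch variables are wiped before the argument is evaluated, so \<open>e\<close>
  may read only variables from \<open>n\<close> on; \<open>0 < n\<close> puts the input and output
  variable among the scratch variables.\<close>

lemma exec_call:
  assumes p: "runs p (exp_val e s) t y" and n: "com_vars p \<subseteq> {..<n}" "0 < n"
    and e: "exp_vars e \<inter> {..<n} = {}"
  shows "\<exists>s'. exec (call n p e) s (Suc n + (nodes (exp_val e s) + t)) s' \<and> s' 0 = y \<and> (\<forall>v\<ge>n. s' v = s v)"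
proof -
  define r where "r = (\<lambda>v. if v < n then Null else s v)"
  have er: "exp_val e r = exp_val e s"
    using e by (intro exp_val_cong) (auto simp: r_def disjoint_iff)
  obtain u where u: "exec p ((\<lambda>_. Null)(0 := exp_val e s)) t u" "u 0 = y"
    using p unfolding runs_def by blast
  obtain s' where s': "exec p (r(0 := exp_val e s)) t s'" "\<forall>v\<in>{..<n}. u v = s' v"
    using exec_cong[OF u(1) n(1), of "r(0 := exp_val e s)"] by (fastforce simp: r_def)
  have "exec (call n p e) s (Suc n + (nodes (exp_val e s) + t)) s'"
    unfolding call_def
    using exec.Seq[OF exec_clear_below[of n s, folded r_def]
        exec.Seq[OF exec.Assign[of 0 e r, unfolded er] s'(1)]] .
  moreover have "s' 0 = y" using s'(2) n(2) u(2) by auto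
  moreover have "s' v = s v" if "v \<ge> n" for v
    using exec_frame[OF s'(1), of v] subsetD[OF n(1), of v] n(2) that by (auto simp: r_def)
  ultimately show ?thesis by blast
qed

text \<open>Time is polynomial in a free measure \<open>B\<close>. With \<open>B = nodes\<close> and
  all trees as inputs this is ordinary polynomial time; later \<open>B\<close> is an exponential
  budget, so that building a power set counts as cheap. The maps \<open>e\<close> and
  \<open>f\<close> give input and output as trees, and \<open>D\<close> allows a promise on the
  inputs.\<close>

definition computable_within :: "'a set \<Rightarrow> ('a \<Rightarrow> tree) \<Rightarrow> ('a \<Rightarrow> tree) \<Rightarrow> ('a \<Rightarrow> nat) \<Rightarrow> bool" where
  "computable_within D e f B \<longleftrightarrow> (\<exists>p t. (\<forall>x\<in>D. runs p (e x) (t x) (f x)) \<and> poly_bounded D B t)"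

lemma computable_withinE:
  assumes "computable_within D e f B"
  obtains p t n where "\<And>x. x \<in> D \<Longrightarrow> runs p (e x) (t x) (f x)" "poly_bounded D B t"
    "\<And>k. n \<le> k \<Longrightarrow> com_vars p \<subseteq> {..<k}"
proof -
  obtain p t where p: "\<forall>x\<in>D. runs p (e x) (t x) (f x)" "poly_bounded D B t" using assms
      unfolding computable_within_def by blast
  obtain n where "com_vars p \<subseteq> {..<n}"
    using finite_com_vars[of p] unfolding finite_nat_set_iff_bounded by blast
  then have "com_vars p \<subseteq> {..<k}" if "n \<le> k" for k using that by auto
  with p show thesis using that by blast
qed

lemma computable_withinI:
  assumes "\<And>x. x \<in> D \<Longrightarrow> \<exists>t s. exec p ((\<lambda>_. Null)(0 := e x)) t s \<and> s 0 = f x \<and> t \<le> T x"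
      "poly_bounded D B T"
  shows "computable_within D e f B"
proof -
  have "\<forall>x\<in>D. \<exists>t. runs p (e x) t (f x) \<and> t \<le> T x" using assms(1) unfolding runs_def by blast
  then obtain t where t: "\<forall>x\<in>D. runs p (e x) (t x) (f x) \<and> t x \<le> T x" by metis
  then have "poly_bounded D B t" using poly_bounded_mono[OF assms(2)] by blast
  with t show ?thesis unfolding computable_within_def by blast
qed

lemma computable_within_cong: "computable_within D e f B \<Longrightarrow> (\<And>x. x \<in> D \<Longrightarrow> f x = g x) \<Longrightarrow>
    computable_within D e g B"
  unfolding computable_within_def by fastforce

lemma computable_within_nodes:
  assumes "computable_within D e f B" "poly_bounded D B (\<lambda>x. nodes (e x))"
  shows "poly_bounded D B (\<lambda>x. nodes (f x))"
proof -
  obtain p t where p: "\<forall>x\<in>D. runs p (e x) (t x) (f x)" "poly_bounded D B t" using assms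
      unfolding computable_within_def by blast
  show ?thesis
    by (rule poly_bounded_mono[OF poly_bounded_add[OF assms(2) p(2)]]) (use p(1) runs_nodes_le in blast)
qed

lemma computable_within_subset: "computable_within D e f B \<Longrightarrow> D' \<subseteq> D \<Longrightarrow> computable_within D' e f B"
  unfolding computable_within_def using poly_bounded_subset by (metis subsetD)

lemma computable_within_exp:
  assumes "poly_bounded D B (\<lambda>x. nodes (exp_val a ((\<lambda>_. Null)(0 := e x))))"
  shows "computable_within D e (\<lambda>x. exp_val a ((\<lambda>_. Null)(0 := e x))) B"
proof (rule computable_withinI[OF _ assms])
  fix x assume "x \<in> D"
  show "\<exists>t s. exec (Assign 0 a) ((\<lambda>_. Null)(0 := e x)) t s \<and>
      s 0 = exp_val a ((\<lambda>_. Null)(0 := e x)) \<and> t \<le> nodes (exp_val a ((\<lambda>_. Null)(0 := e x)))"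
    by (intro exI conjI, rule exec.Assign) auto
qed

lemma computable_within_id: "poly_bounded D B (\<lambda>x. nodes (e x)) \<Longrightarrow> computable_within D e e B"
  using computable_within_exp[of D B "Var 0" e] by simp

text \<open>The intermediate result \<open>f x\<close> is the input encoding for \<open>g\<close>,
  so the second program has to be correct only on trees of that form with \<open>x\<close> in
  \<open>D\<close>.\<close>

lemma computable_within_trans:
  assumes f: "computable_within D e f B" and g: "computable_within D f g B" and e:
      "poly_bounded D B (\<lambda>x. nodes (e x))"
  shows "computable_within D e g B"
proof -
  obtain p t n where p: "\<And>x. x \<in> D \<Longrightarrow> runs p (e x) (t x) (f x)" "poly_bounded D B t"
    "\<And>k. n \<le> k \<Longrightarrow> com_vars p \<subseteq> {..<k}" using computable_withinE[OF f] by metis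
  obtain q u m where q: "\<And>x. x \<in> D \<Longrightarrow> runs q (f x) (u x) (g x)" "poly_bounded D B u"
    "\<And>k. m \<le> k \<Longrightarrow> com_vars q \<subseteq> {..<k}" using computable_withinE[OF g] by metis
  define k where "k = Suc (n + m)"
  have k: "com_vars p \<subseteq> {..<k}" "com_vars q \<subseteq> {..<k}" "0 < k" using p(3) q(3) unfolding k_def by auto
  define c where "c = Seq p (Seq (Assign k (Var 0)) (call k q (Var k)))"
  show ?thesis
  proof (rule computable_withinI[where p = c])
    fix x assume x: "x \<in> D"
    obtain s where s: "exec p ((\<lambda>_. Null)(0 := e x)) (t x) s" "s 0 = f x"
      using p(1)[OF x] unfolding runs_def by blast
    define s1 where "s1 = s(k := f x)"
    have a: "exec (Assign k (Var 0)) s (nodes (f x)) s1"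
      using exec.Assign[of k "Var 0" s] s(2) by (simp add: s1_def)
    obtain s2 where s2: "exec (call k q (Var k)) s1 (Suc k + (nodes (f x) + u x)) s2" "s2 0 = g x"
      using exec_call[of q "Var k" s1 "u x" "g x" k] q(1)[OF x] k by (auto simp: s1_def)
    show "\<exists>ta s. exec c ((\<lambda>_. Null)(0 := e x)) ta s \<and> s 0 = g x \<and>
        ta \<le> t x + (nodes (f x) + (Suc k + (nodes (f x) + u x)))"
      using exec.Seq[OF s(1) exec.Seq[OF a s2(1)]] s2(2) unfolding c_def by blast
  next
    show "poly_bounded D B (\<lambda>x. t x + (nodes (f x) + (Suc k + (nodes (f x) + u x))))"
      by (intro poly_bounded_intros p q computable_within_nodes[OF f e])
  qed
qed

lemma computable_within_pair:
  assumes f: "computable_within D e f B" and g: "computable_within D e g B" and e: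
      "poly_bounded D B (\<lambda>x. nodes (e x))"
  shows "computable_within D e (\<lambda>x. Pair (f x) (g x)) B"
proof -
  obtain p t n where p: "\<And>x. x \<in> D \<Longrightarrow> runs p (e x) (t x) (f x)" "poly_bounded D B t"
    "\<And>k. n \<le> k \<Longrightarrow> com_vars p \<subseteq> {..<k}" using computable_withinE[OF f] by metis
  obtain q u m where q: "\<And>x. x \<in> D \<Longrightarrow> runs q (e x) (u x) (g x)" "poly_bounded D B u"
    "\<And>k. m \<le> k \<Longrightarrow> com_vars q \<subseteq> {..<k}" using computable_withinE[OF g] by metis
  define k where "k = Suc (n + m)"
  have k: "com_vars p \<subseteq> {..<k}" "com_vars q \<subseteq> {..<k}" "0 < k" using p(3) q(3) unfolding k_def by auto
  define c where "c = Seq (Assign k (Var 0)) (Seq (call k p (Var k)) (Seq (Assign (Suc k) (Var 0))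
    (Seq (call k q (Var k)) (Assign 0 (Cons (Var (Suc k)) (Var 0))))))"
  show ?thesis
  proof (rule computable_withinI[where p = c])
    fix x assume x: "x \<in> D"
    define s1 where "s1 = ((\<lambda>_. Null)(0 := e x))(k := e x)"
    have a1: "exec (Assign k (Var 0)) ((\<lambda>_. Null)(0 := e x)) (nodes (e x)) s1"
      using exec.Assign[of k "Var 0" "(\<lambda>_. Null)(0 := e x)"] by (simp add: s1_def)
    obtain s2 where s2: "exec (call k p (Var k)) s1 (Suc k + (nodes (e x) + t x)) s2" "s2 0 = f x"
        "\<forall>v\<ge>k. s2 v = s1 v"
      using exec_call[of p "Var k" s1 "t x" "f x" k] p(1)[OF x] k by (auto simp: s1_def)
    define s3 where "s3 = s2(Suc k := f x)"
    have a3: "exec (Assign (Suc k) (Var 0)) s2 (nodes (f x)) s3"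
      using exec.Assign[of "Suc k" "Var 0" s2] s2(2) by (simp add: s3_def)
    have s3k: "s3 k = e x" using s2(3) by (simp add: s3_def s1_def)
    obtain s4 where s4: "exec (call k q (Var k)) s3 (Suc k + (nodes (e x) + u x)) s4" "s4 0 = g x"
        "\<forall>v\<ge>k. s4 v = s3 v"
      using exec_call[of q "Var k" s3 "u x" "g x" k] q(1)[OF x] k s3k by auto
    have s4k: "s4 (Suc k) = f x" using s4(3) by (simp add: s3_def)
    have a5: "exec (Assign 0 (Cons (Var (Suc k)) (Var 0))) s4 (nodes (Pair (f x) (g x)))
        (s4(0 := Pair (f x) (g x)))"
      using exec.Assign[of 0 "Cons (Var (Suc k)) (Var 0)" s4] s4k s4(2) by simp
    show "\<exists>ta s. exec c ((\<lambda>_. Null)(0 := e x)) ta s \<and> s 0 = Pair (f x) (g x) \<and>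
        ta \<le> nodes (e x) + (Suc k + (nodes (e x) + t x) + (nodes (f x) +
          (Suc k + (nodes (e x) + u x) + (1 + nodes (f x) + nodes (g x)))))"
      unfolding c_def
      by (rule exI, rule exI, rule conjI, rule
          exec.Seq[OF a1 exec.Seq[OF s2(1) exec.Seq[OF a3 exec.Seq[OF s4(1) a5]]]]) auto
  next
    show "poly_bounded D B (\<lambda>x. nodes (e x) + (Suc k + (nodes (e x) + t x) + (nodes (f x) +
          (Suc k + (nodes (e x) + u x) + (1 + nodes (f x) + nodes (g x))))))"
      by (intro poly_bounded_intros p q e computable_within_nodes[OF f e]
          computable_within_nodes[OF g e])
  qed
qed

lemma computable_within_if:
  assumes b: "computable_within D e b B" and f: "computable_within {x\<in>D. b x \<noteq> Null} e f B" and g: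
      "computable_within {x\<in>D. b x = Null} e g B"
    and e: "poly_bounded D B (\<lambda>x. nodes (e x))"
  shows "computable_within D e (\<lambda>x. if b x \<noteq> Null then f x else g x) B"
proof -
  obtain p t n where p: "\<And>x. x \<in> D \<Longrightarrow> runs p (e x) (t x) (b x)" "poly_bounded D B t"
    "\<And>k. n \<le> k \<Longrightarrow> com_vars p \<subseteq> {..<k}" using computable_withinE[OF b] by metis
  obtain q u m where q: "\<And>x. x \<in> D \<Longrightarrow> b x \<noteq> Null \<Longrightarrow> runs q (e x) (u x) (f x)"
      "poly_bounded {x\<in>D. b x \<noteq> Null} B u"
    "\<And>k. m \<le> k \<Longrightarrow> com_vars q \<subseteq> {..<k}" by (rule computable_withinE[OF f]) auto
  obtain r w l where r: "\<And>x. x \<in> D \<Longrightarrow> b x = Null \<Longrightarrow> runs r (e x) (w x) (g x)"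
      "poly_bounded {x\<in>D. b x = Null} B w"
    "\<And>k. l \<le> k \<Longrightarrow> com_vars r \<subseteq> {..<k}" by (rule computable_withinE[OF g]) auto
  define k where "k = Suc (n + m + l)"
  have k: "com_vars p \<subseteq> {..<k}" "com_vars q \<subseteq> {..<k}" "com_vars r \<subseteq> {..<k}" "0 < k"
    using p(3) q(3) r(3) unfolding k_def by auto
  define c where "c = Seq (Assign k (Var 0)) (Seq (call k p (Var k))
      (Cond 0 (call k q (Var k)) (call k r (Var k))))"
  define z where "z x = (if b x \<noteq> Null then u x else w x)" for x
  obtain C d where 1: "\<forall>x\<in>{x\<in>D. b x \<noteq> Null}. u x \<le> C * Suc (B x) ^ d"
    using q(2) unfolding poly_bounded_def by blast
  obtain C' d' where 2: "\<forall>x\<in>{x\<in>D. b x = Null}. w x \<le> C' * Suc (B x) ^ d'"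
    using r(2) unfolding poly_bounded_def by blast
  \<comment> \<open>Each branch has a bound on its own part of \<open>D\<close>; the sum of the two
    bounds holds on all of \<open>D\<close>.\<close>
  have "poly_bounded D B (\<lambda>x. C * (B x + 1) ^ d + C' * (B x + 1) ^ d')"
    by (intro poly_bounded_intros)
  then have z: "poly_bounded D B z"
    by (rule poly_bounded_mono) (use 1 2 in \<open>auto simp: z_def intro: trans_le_add1 trans_le_add2\<close>)
  show ?thesis
  proof (rule computable_withinI[where p = c])
    fix x assume x: "x \<in> D"
    define s1 where "s1 = ((\<lambda>_. Null)(0 := e x))(k := e x)"
    have a1: "exec (Assign k (Var 0)) ((\<lambda>_. Null)(0 := e x)) (nodes (e x)) s1"
      using exec.Assign[of k "Var 0" "(\<lambda>_. Null)(0 := e x)"] by (simp add: s1_def)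
    obtain s2 where s2: "exec (call k p (Var k)) s1 (Suc k + (nodes (e x) + t x)) s2" "s2 0 = b x"
        "\<forall>v\<ge>k. s2 v = s1 v"
      using exec_call[of p "Var k" s1 "t x" "b x" k] p(1)[OF x] k by (auto simp: s1_def)
    have s2k: "s2 k = e x" using s2(3) by (simp add: s1_def)
    have "\<exists>s3. exec (Cond 0 (call k q (Var k)) (call k r (Var k))) s2
        (1 + (Suc k + (nodes (e x) + z x))) s3 \<and>
        s3 0 = (if b x \<noteq> Null then f x else g x)"
    proof (cases "b x = Null")
      case True
      then obtain s3 where s3: "exec (call k r (Var k)) s2 (Suc k + (nodes (e x) + w x)) s3" "s3 0 = g x"
        using exec_call[of r "Var k" s2 "w x" "g x" k] r(1)[OF x] k s2k by auto
      then show ?thesis using exec.CondF[of s2 0, OF _ s3(1)] s2(2) True by (auto simp: z_def)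
    next
      case False
      then obtain s3 where s3: "exec (call k q (Var k)) s2 (Suc k + (nodes (e x) + u x)) s3" "s3 0 = f x"
        using exec_call[of q "Var k" s2 "u x" "f x" k] q(1)[OF x] k s2k by auto
      then show ?thesis using exec.CondT[of s2 0, OF _ s3(1)] s2(2) False by (auto simp: z_def)
    qed
    then obtain s3 where s3: "exec (Cond 0 (call k q (Var k)) (call k r (Var k))) s2
        (1 + (Suc k + (nodes (e x) + z x))) s3"
        "s3 0 = (if b x \<noteq> Null then f x else g x)" by blast
    show "\<exists>ta s. exec c ((\<lambda>_. Null)(0 := e x)) ta s \<and> s 0 = (if b x \<noteq> Null then f x else g x) \<and>
        ta \<le> nodes (e x) + (Suc k + (nodes (e x) + t x) + (1 + (Suc k + (nodes (e x) + z x))))"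
      unfolding c_def
      by (rule exI, rule exI, rule conjI, rule exec.Seq[OF a1 exec.Seq[OF s2(1) s3(1)]])
          (use s3(2) in auto)
  next
    show "poly_bounded D B (\<lambda>x. nodes (e x) + (Suc k + (nodes (e x) + t x) +
        (1 + (Suc k + (nodes (e x) + z x)))))"
      by (intro poly_bounded_intros p z e)
  qed
qed

abbreviation ptime :: "(tree \<Rightarrow> tree) \<Rightarrow> bool" where
  "ptime f \<equiv> computable_within UNIV (\<lambda>x. x) f nodes"

lemma ptime_computable_within: "ptime f \<Longrightarrow> poly_bounded D B (\<lambda>x. nodes (g x)) \<Longrightarrow> computable_within D
    g (\<lambda>x. f (g x)) B"
proof -
  assume f: "ptime f" and g: "poly_bounded D B (\<lambda>x. nodes (g x))"
  obtain p t where p: "\<forall>x. runs p x (t x) (f x)" "poly_bounded UNIV nodes t" using f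
      unfolding computable_within_def by auto
  have "poly_bounded D B (\<lambda>x. t (g x))" using poly_bounded_trans[OF poly_bounded_image[OF p(2)] g] .
  with p(1) show ?thesis unfolding computable_within_def
      by (intro exI[of _ p] exI[of _ "\<lambda>x. t (g x)"]) simp
qed

lemma computable_within_ptime:
  assumes "computable_within D e g B" "ptime f" "poly_bounded D B (\<lambda>x. nodes (e x))"
  shows "computable_within D e (\<lambda>x. f (g x)) B"
  using computable_within_trans[OF assms(1) ptime_computable_within[OF assms(2)
      computable_within_nodes[OF assms(1,3)]] assms(3)] .

section \<open>Lists as right spines of trees, and loops over them\<close>

abbreviation mk :: "tree list \<Rightarrow> tree" where
  "mk \<equiv> enc_list (\<lambda>t. t)"

fun spine :: "tree \<Rightarrow> tree list" where
  "spine Null = []"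
| "spine (Pair a b) = a # spine b"

lemma spine_mk [simp]: "spine (mk L) = L"
  by (induction L) auto

lemma mk_spine [simp]: "mk (spine t) = t"
  by (induction t) auto

lemma left_mk: "left (mk L) = (if L = [] then Null else hd L)"
  by (cases L) auto

lemma right_mk [simp]: "right (mk L) = mk (tl L)"
  by (cases L) auto

lemma mk_eq_Null [simp]: "mk L = Null \<longleftrightarrow> L = []"
  by (cases L) auto

lemma nodes_mk: "nodes (mk L) = 1 + (\<Sum>a\<leftarrow>L. 1 + nodes a)"
  by (induction L) auto

lemma length_le_nodes_mk: "length L \<le> nodes (mk L)"
  by (induction L) auto

lemma nodes_mk_mem: "a \<in> set L \<Longrightarrow> nodes a \<le> nodes (mk L)"
  by (induction L) auto

text \<open>Iterating a polynomial-time body can make the state grow exponentially, for instance by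
  doubling it in each round. The bound \<open>S\<close> on all intermediate states rules this out.
  The context \<open>c x\<close> is handed to every round unchanged.\<close>

lemma computable_within_fold:
  assumes g: "ptime G"
    and L: "computable_within D e (\<lambda>x. mk (L x)) B" and c: "computable_within D e c B" and s:
        "computable_within D e s B"
    and e: "poly_bounded D B (\<lambda>x. nodes (e x))" and S: "poly_bounded D B S"
    and bound: "\<And>x i. x \<in> D \<Longrightarrow> i \<le> length (L x) \<Longrightarrow>
      nodes (foldl (\<lambda>s a. G (Pair a (Pair (c x) s))) (s x) (take i (L x))) \<le> S x"
  shows "computable_within D e (\<lambda>x. foldl (\<lambda>s a. G (Pair a (Pair (c x) s))) (s x) (L x)) B"
proof -
  define h where "h x = Pair (mk (L x)) (Pair (c x) (s x))" for x
  have h: "computable_within D e h B" unfolding h_def by (intro computable_within_pair L c s e)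
  have L': "poly_bounded D B (\<lambda>x. nodes (mk (L x)))" and c': "poly_bounded D B (\<lambda>x. nodes (c x))"
    and s': "poly_bounded D B (\<lambda>x. nodes (s x))" and h': "poly_bounded D B (\<lambda>x. nodes (h x))"
    using computable_within_nodes[OF _ e] L c s h by auto
  obtain p t n where p: "\<And>z. runs p z (t z) (G z)" "poly_bounded UNIV nodes t"
    "\<And>k. n \<le> k \<Longrightarrow> com_vars p \<subseteq> {..<k}" using computable_withinE[OF g] by (metis UNIV_I)
  obtain C d where t: "\<And>z. t z \<le> C * Suc (nodes z) ^ d" using p(2) unfolding poly_bounded_def by blast
  define k where "k = Suc n"
  have k: "com_vars p \<subseteq> {..<k}" "0 < k" using p(3) unfolding k_def by auto
  \<comment> \<open>Variable \<open>k\<close> holds the rest of the list, \<open>k + 1\<close> the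
    context and \<open>k + 2\<close> the state; the subroutine may overwrite everything below
    \<open>k\<close>.\<close>
  define v where "v = Cons (Hd (Var k)) (Cons (Var (k + 1)) (Var (k + 2)))"
  define w where "w = Seq (call k p v) (Seq (Assign (k + 2) (Var 0)) (Assign k (Tl (Var k))))"
  \<comment> \<open>\<open>W\<close> bounds the size of the triple handed to \<open>p\<close>, and
    \<open>Q\<close> the cost of one whole round including its test.\<close>
  define W where "W x = Suc (nodes (mk (L x)) + nodes (c x) + S x) + 1" for x
  define Q where "Q x = 1 + (Suc k + (W x + C * Suc (W x) ^ d) + (S x + nodes (mk (L x))))" for x
  have loop: "\<exists>t s'. exec (While k w) r t s' \<and>
      s' (k + 2) = foldl (\<lambda>s a. G (Pair a (Pair (c x) s))) s0 K \<and> t \<le> 1 + length K * Q x"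
    if "x \<in> D" "r k = mk K" "r (k + 1) = c x" "r (k + 2) = s0" "nodes (mk K) \<le> nodes (mk (L x))"
      "\<And>i. i \<le> length K \<Longrightarrow> nodes (foldl (\<lambda>s a. G (Pair a (Pair (c x) s))) s0 (take i K)) \<le> S x"
    for x r K s0
    using that
  proof (induction K arbitrary: r s0)
    case Nil
    then show ?case using exec.WhileF[of r k w] by (intro exI[of _ 1] exI[of _ r]) auto
  next
    case (Cons a K)
    define z where "z = Pair a (Pair (c x) s0)"
    have z: "exp_val v r = z" using Cons.prems by (simp add: v_def z_def)
    obtain r1 where r1: "exec (call k p v) r (Suc k + (nodes z + t z)) r1" "r1 0 = G z"
        "\<forall>u\<ge>k. r1 u = r u"
      using exec_call[of p v r "t z" "G z" k] p(1)[of z] k z by (auto simp: v_def)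
    define r2 where "r2 = r1(k + 2 := G z)"
    have a2: "exec (Assign (k + 2) (Var 0)) r1 (nodes (G z)) r2"
      using exec.Assign[of "k + 2" "Var 0" r1] r1(2) by (simp add: r2_def)
    have r2k: "r2 k = Pair a (mk K)" using r1(3) Cons.prems(2) by (simp add: r2_def)
    define r3 where "r3 = r2(k := mk K)"
    have a3: "exec (Assign k (Tl (Var k))) r2 (nodes (mk K)) r3"
      using exec.Assign[of k "Tl (Var k)" r2] r2k by (simp add: r3_def)
    have body: "exec w r (Suc k + (nodes z + t z) + (nodes (G z) + nodes (mk K))) r3"
      unfolding w_def by (rule exec.Seq[OF r1(1) exec.Seq[OF a2 a3]])
    have "\<exists>t s'. exec (While k w) r3 t s' \<and>
      s' (k + 2) = foldl (\<lambda>s a. G (Pair a (Pair (c x) s))) (G z) K \<and> t \<le> 1 + length K * Q x"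
    proof (rule Cons.IH[OF Cons.prems(1)])
      show "r3 k = mk K" "r3 (k + 2) = G z" by (simp_all add: r3_def r2_def)
      show "r3 (k + 1) = c x" using r1(3) Cons.prems(3) by (simp add: r3_def r2_def)
      show "nodes (mk K) \<le> nodes (mk (L x))" using Cons.prems(5) by simp
      show "nodes (foldl (\<lambda>s a. G (Pair a (Pair (c x) s))) (G z) (take i K)) \<le> S x" if
          "i \<le> length K" for i
        using Cons.prems(6)[of "Suc i"] that by (simp add: z_def)
    qed
    then obtain u s' where u: "exec (While k w) r3 u s'"
      "s' (k + 2) = foldl (\<lambda>s a. G (Pair a (Pair (c x) s))) (G z) K" "u \<le> 1 + length K * Q x" by blast
    have Gz: "nodes (G z) \<le> S x" using Cons.prems(6)[of 1] by (simp add: z_def)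
    have s0: "nodes s0 \<le> S x" using Cons.prems(6)[of 0] by simp
    have zW: "nodes z \<le> W x" using Cons.prems(5) s0 by (simp add: z_def W_def)
    have tz: "t z \<le> C * Suc (W x) ^ d"
      using t[of z] zW by (meson Suc_le_mono mult_le_mono2 order_trans power_mono zero_le)
    have "1 + (Suc k + (nodes z + t z) + (nodes (G z) + nodes (mk K))) \<le> Q x"
      unfolding Q_def using zW tz Gz Cons.prems(5) by simp
    then have "1 + (Suc k + (nodes z + t z) + (nodes (G z) + nodes (mk K))) + u \<le> 1 + length
        (a # K) * Q x"
      using u(3) by simp
    moreover have "r k \<noteq> Null" using Cons.prems(2) by simp
    ultimately show ?case using exec.WhileT[OF _ body u(1)] u(2) by (auto simp: z_def)
  qed
  define q where "q = Seq (Assign k (Hd (Var 0))) (Seq (Assign (k + 1) (Hd (Tl (Var 0))))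
    (Seq (Assign (k + 2) (Tl (Tl (Var 0)))) (Seq (While k w) (Assign 0 (Var (k + 2))))))"
  have "computable_within D h (\<lambda>x. foldl (\<lambda>s a. G (Pair a (Pair (c x) s))) (s x) (L x)) B"
  proof (rule computable_withinI[where p = q])
    fix x assume x: "x \<in> D"
    define r0 :: store where "r0 = (\<lambda>_. Null)(0 := h x)"
    define r1 where "r1 = r0(k := mk (L x))"
    define r2 where "r2 = r1(k + 1 := c x)"
    define r3 where "r3 = r2(k + 2 := s x)"
    have a1: "exec (Assign k (Hd (Var 0))) r0 (nodes (mk (L x))) r1"
      using exec.Assign[of k "Hd (Var 0)" r0] by (simp add: r0_def r1_def h_def)
    have a2: "exec (Assign (k + 1) (Hd (Tl (Var 0)))) r1 (nodes (c x)) r2"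
      using exec.Assign[of "k + 1" "Hd (Tl (Var 0))" r1] k(2) by (simp add: r0_def r1_def r2_def h_def)
    have a3: "exec (Assign (k + 2) (Tl (Tl (Var 0)))) r2 (nodes (s x)) r3"
      using exec.Assign[of "k + 2" "Tl (Tl (Var 0))" r2] k(2)
          by (simp add: r0_def r1_def r2_def r3_def h_def)
    obtain u r4 where u: "exec (While k w) r3 u r4"
      "r4 (k + 2) = foldl (\<lambda>s a. G (Pair a (Pair (c x) s))) (s x) (L x)" "u \<le> 1 + length (L x) * Q x"
      using loop[OF x, of r3 "L x" "s x"] bound[OF x] by (auto simp: r3_def r2_def r1_def)
    have a5: "exec (Assign 0 (Var (k + 2))) r4 (nodes (r4 (k + 2))) (r4(0 := r4 (k + 2)))"
      using exec.Assign[of 0 "Var (k + 2)" r4] by simp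
    have fin: "nodes (r4 (k + 2)) \<le> S x" using bound[OF x, of "length (L x)"] u(2) by simp
    have len: "length (L x) * Q x \<le> nodes (mk (L x)) * Q x"
      using length_le_nodes_mk mult_le_mono1 by blast
    show "\<exists>ta s'. exec q ((\<lambda>_. Null)(0 := h x)) ta s' \<and>
        s' 0 = foldl (\<lambda>s a. G (Pair a (Pair (c x) s))) (s x) (L x) \<and>
        ta \<le> nodes (mk (L x)) + (nodes (c x) + (nodes (s x) + ((1 + nodes (mk (L x)) * Q x) + S x)))"
      unfolding q_def r0_def[symmetric]
      by (rule exI, rule exI, rule conjI, rule
          exec.Seq[OF a1 exec.Seq[OF a2 exec.Seq[OF a3 exec.Seq[OF u(1) a5]]]])
        (rule conjI, use u(2) in simp, use u(3) fin len in linarith)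
  next
    show "poly_bounded D B (\<lambda>x. nodes (mk (L x)) +
        (nodes (c x) + (nodes (s x) + ((1 + nodes (mk (L x)) * Q x) + S x))))"
      unfolding Q_def W_def Suc_eq_plus1 by (intro poly_bounded_intros L' c' s' S)
  qed
  then show ?thesis by (rule computable_within_trans[OF h _ e])
qed

section \<open>Polynomial-time functions on trees and lists of trees\<close>

text \<open>Every tree is the list of the subtrees hanging off its right spine. The closure rules below are
  stated for three kinds of functions (into trees, lists, booleans); in the rules for binders the
  element and the context are the two components of the argument of the body.\<close>

definition lptime :: "(tree \<Rightarrow> tree list) \<Rightarrow> bool" where
  "lptime L \<longleftrightarrow> ptime (\<lambda>x. mk (L x))"

definition bptime :: "(tree \<Rightarrow> bool) \<Rightarrow> bool" where
  "bptime P \<longleftrightarrow> ptime (\<lambda>x. enc_bool (P x))"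

lemma ptime_nodes: "ptime f \<Longrightarrow> poly_bounded UNIV nodes (\<lambda>x. nodes (f x))"
  using computable_within_nodes poly_bounded_self by blast

lemma ptime_id: "ptime (\<lambda>x. x)"
  by (intro computable_within_id poly_bounded_self)

lemma ptime_comp: "ptime f \<Longrightarrow> ptime g \<Longrightarrow> ptime (\<lambda>x. f (g x))"
  using computable_within_ptime[OF _ _ poly_bounded_self] .

lemma ptime_left: "ptime f \<Longrightarrow> ptime (\<lambda>x. left (f x))"
proof (erule ptime_comp[rotated])
  have "nodes (left x) \<le> nodes x" for x by (cases x) auto
  then have "poly_bounded UNIV nodes (\<lambda>x. nodes (left x))"
      by (intro poly_bounded_mono[OF poly_bounded_self])
  then show "ptime left" using computable_within_exp[of UNIV nodes "Hd (Var 0)" "\<lambda>x. x"] by simp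
qed

lemma ptime_right: "ptime f \<Longrightarrow> ptime (\<lambda>x. right (f x))"
proof (erule ptime_comp[rotated])
  have "nodes (right x) \<le> nodes x" for x by (cases x) auto
  then have "poly_bounded UNIV nodes (\<lambda>x. nodes (right x))"
      by (intro poly_bounded_mono[OF poly_bounded_self])
  then show "ptime right" using computable_within_exp[of UNIV nodes "Tl (Var 0)" "\<lambda>x. x"] by simp
qed

lemma ptime_Pair: "ptime f \<Longrightarrow> ptime g \<Longrightarrow> ptime (\<lambda>x. Pair (f x) (g x))"
  by (intro computable_within_pair poly_bounded_self)

lemma ptime_const: "ptime (\<lambda>_. c)"
proof (induction c)
  case Null
  show ?case using computable_within_exp[of UNIV nodes Nul "\<lambda>x. x"]
      by (simp add: poly_bounded_const del: One_nat_def)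
next
  case (Pair a b)
  then show ?case by (rule ptime_Pair)
qed

lemma enc_bool_eq_Null [simp]: "enc_bool b = Null \<longleftrightarrow> \<not> b"
  by (simp add: enc_bool_def)

lemma enc_bool_False [simp]: "enc_bool False = Null"
  by simp

lemma nodes_enc_bool_le: "nodes (enc_bool b) \<le> 3"
  by (simp add: enc_bool_def)

lemma bptime_eq:
  assumes "ptime f" "ptime g"
  shows "bptime (\<lambda>x. f x = g x)"
proof -
  have "poly_bounded UNIV nodes (\<lambda>x. nodes (enc_bool (left x = right x)))"
    by (rule poly_bounded_mono[OF poly_bounded_const[of _ _ 3]]) (rule nodes_enc_bool_le)
  then have "ptime (\<lambda>x. enc_bool (left x = right x))"
    using computable_within_exp[of UNIV nodes "Eq (Hd (Var 0)) (Tl (Var 0))" "\<lambda>x. x"] by simp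
  from ptime_comp[OF this ptime_Pair[OF assms]] show ?thesis by (simp add: bptime_def)
qed

lemma ptime_if:
  assumes "bptime P" "ptime f" "ptime g"
  shows "ptime (\<lambda>x. if P x then f x else g x)"
  using computable_within_if[OF assms(1)[unfolded bptime_def]
      computable_within_subset[OF assms(2)] computable_within_subset[OF assms(3)] poly_bounded_self]
  by simp

lemma ptime_mk: "lptime L \<Longrightarrow> ptime (\<lambda>x. mk (L x))"
  by (simp add: lptime_def)

lemma ptime_enc_bool: "bptime P \<Longrightarrow> ptime (\<lambda>x. enc_bool (P x))"
  by (simp add: bptime_def)

lemma lptime_spine: "ptime f \<Longrightarrow> lptime (\<lambda>x. spine (f x))"
  by (simp add: lptime_def)

lemma lptime_const: "lptime (\<lambda>_. L)"
  by (simp add: lptime_def ptime_const)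

lemma lptime_Cons: "ptime f \<Longrightarrow> lptime L \<Longrightarrow> lptime (\<lambda>x. f x # L x)"
  by (simp add: lptime_def ptime_Pair)

lemma lptime_if: "bptime P \<Longrightarrow> lptime L \<Longrightarrow> lptime K \<Longrightarrow> lptime (\<lambda>x. if P x then L x else K x)"
  unfolding lptime_def if_distrib[of mk] by (rule ptime_if)

lemma bptime_const: "bptime (\<lambda>_. b)"
  by (simp add: bptime_def ptime_const)

lemma bptime_if: "bptime P \<Longrightarrow> bptime Q \<Longrightarrow> bptime R \<Longrightarrow> bptime (\<lambda>x. if P x then Q x else R x)"
  unfolding bptime_def[of "\<lambda>x. if P x then Q x else R x"] if_distrib[of enc_bool]
  by (intro ptime_if ptime_enc_bool)

lemma bptime_not: "bptime P \<Longrightarrow> bptime (\<lambda>x. \<not> P x)"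
proof -
  have "(\<lambda>x. \<not> P x) = (\<lambda>x. if P x then False else True)" by auto
  then show "bptime P \<Longrightarrow> bptime (\<lambda>x. \<not> P x)"
    by (simp only:) (intro bptime_if bptime_const)
qed

lemma bptime_conj: "bptime P \<Longrightarrow> bptime Q \<Longrightarrow> bptime (\<lambda>x. P x \<and> Q x)"
proof -
  have "(\<lambda>x. P x \<and> Q x) = (\<lambda>x. if P x then Q x else False)" by auto
  then show "bptime P \<Longrightarrow> bptime Q \<Longrightarrow> bptime (\<lambda>x. P x \<and> Q x)"
    by (simp only:) (intro bptime_if bptime_const)
qed

lemma bptime_Nil: "lptime L \<Longrightarrow> bptime (\<lambda>x. L x = [])"
  using bptime_eq[OF ptime_mk ptime_const[of Null], of L] by simp

lemma ptime_fold:
  assumes G: "ptime (\<lambda>z. G (left z) (left (right z)) (right (right z)))"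
    and L: "lptime L" and s: "ptime s" and S: "poly_bounded UNIV nodes S"
    and bound: "\<And>x i. i \<le> length (L x) \<Longrightarrow> nodes (foldl (\<lambda>s a. G a x s) (s x) (take i (L x))) \<le> S x"
  shows "ptime (\<lambda>x. foldl (\<lambda>s a. G a x s) (s x) (L x))"
  using computable_within_fold[OF G ptime_mk[OF L] ptime_id s poly_bounded_self S] bound by simp

text \<open>If a round enlarges the state by at most the current element plus a term independent of
  the state, the growth adds up to a polynomial. So it suffices to inspect a single round instead of
  all prefixes.\<close>

lemma ptime_fold_add:
  assumes G: "ptime (\<lambda>z. G (left z) (left (right z)) (right (right z)))"
    and L: "lptime L" and s: "ptime s" and b: "poly_bounded UNIV nodes b"
    and bound: "\<And>a x s. a \<in> set (L x) \<Longrightarrow> nodes (G a x s) \<le> nodes s + nodes a + b x"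
  shows "ptime (\<lambda>x. foldl (\<lambda>s a. G a x s) (s x) (L x))"
proof (rule ptime_fold[OF G L s])
  show "poly_bounded UNIV nodes (\<lambda>x. nodes (s x) + nodes (mk (L x)) * (1 + b x))"
    by (intro poly_bounded_intros ptime_nodes s ptime_mk L b)
next
  fix x i
  have *: "nodes (foldl (\<lambda>s a. G a x s) t K) \<le> nodes t + nodes (mk K) * (1 + b x)" if
      "set K \<subseteq> set (L x)" for t K
    using that
  proof (induction K arbitrary: t)
    case (Cons a K)
    then have "nodes (foldl (\<lambda>s a. G a x s) t (a # K)) \<le> nodes (G a x t) + nodes (mk K) *
        (1 + b x)" by simp
    also have "\<dots> \<le> nodes t + nodes a + b x + nodes (mk K) * (1 + b x)"
        using bound[of a x t] Cons.prems by simp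
    also have "\<dots> \<le> nodes t + nodes (mk (a # K)) * (1 + b x)" by (simp add: algebra_simps)
    finally show ?case .
  qed simp
  have "nodes (mk (take i (L x))) \<le> nodes (mk (L x))"
    by (metis append_take_drop_id nodes_mk map_append sum_list_append le_add1 add_le_cancel_left)
  then have "nodes (s x) + nodes (mk (take i (L x))) * (1 + b x) \<le> nodes (s x) + nodes (mk (L x))
      * (1 + b x)"
    by (intro add_left_mono mult_right_mono) auto
  with *[of "take i (L x)" "s x"] show "nodes (foldl (\<lambda>s a. G a x s) (s x) (take i (L x))) \<le> nodes
      (s x) + nodes (mk (L x)) * (1 + b x)"
    by (meson order_trans set_take_subset)
qed

lemma foldl_rev_map: "foldl (\<lambda>s a. Pair (F a) s) (mk K) L = mk (rev (map F L) @ K)"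
proof (induction L arbitrary: K)
  case (Cons a L)
  show ?case using Cons[of "F a # K"] by simp
qed simp

lemma lptime_rev: "lptime L \<Longrightarrow> lptime (\<lambda>x. rev (L x))"
proof -
  assume L: "lptime L"
  have "ptime (\<lambda>x. foldl (\<lambda>s a. Pair a s) Null (L x))"
    by (rule ptime_fold_add[OF _ L ptime_const poly_bounded_const[of _ _ 1], of "\<lambda>a x s. Pair a s"])
      (intro ptime_Pair ptime_left ptime_right ptime_id, simp)
  then show ?thesis using foldl_rev_map[of "\<lambda>a. a" "[]"] by (simp add: lptime_def)
qed

lemma lptime_map:
  assumes F: "ptime (\<lambda>z. F (left z) (right z))" and L: "lptime L"
  shows "lptime (\<lambda>x. map (\<lambda>a. F a x) (L x))"
proof -
  obtain C d where C: "\<And>z. nodes (F (left z) (right z)) \<le> C * Suc (nodes z) ^ d"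
    using ptime_nodes[OF F] unfolding poly_bounded_def by blast
  have G: "ptime (\<lambda>z. Pair (F (left z) (left (right z))) (right (right z)))"
    using ptime_comp[OF F, of "\<lambda>z. Pair (left z) (left (right z))"]
    by (simp add: ptime_Pair ptime_left ptime_right ptime_id)
  have "ptime (\<lambda>x. foldl (\<lambda>s a. Pair (F a x) s) Null (L x))"
  proof (rule ptime_fold_add[OF _ L ptime_const, of "\<lambda>a x s. Pair (F a x) s"])
    show "poly_bounded UNIV nodes (\<lambda>x. 1 + C * ((1 + nodes (mk (L x)) + nodes x) + 1) ^ d)"
      by (intro poly_bounded_intros ptime_nodes[OF ptime_mk[OF L]])
    fix a x s assume a: "a \<in> set (L x)"
    have "nodes (F a x) \<le> C * Suc (nodes (Pair a x)) ^ d" using C[of "Pair a x"] by simp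
    also have "\<dots> \<le> C * ((1 + nodes (mk (L x)) + nodes x) + 1) ^ d"
      using nodes_mk_mem[OF a] by (intro mult_left_mono power_mono) auto
    finally show "nodes (Pair (F a x) s) \<le> nodes s + nodes a +
        (1 + C * ((1 + nodes (mk (L x)) + nodes x) + 1) ^ d)"
      by simp
  qed (rule G)
  then have "lptime (\<lambda>x. rev (map (\<lambda>a. F a x) (L x)))"
    by (simp add: lptime_def foldl_rev_map[where K = "[]", simplified])
  from lptime_rev[OF this] show ?thesis by simp
qed

lemma lptime_append:
  assumes L: "lptime L" and K: "lptime K"
  shows "lptime (\<lambda>x. L x @ K x)"
proof -
  have "ptime (\<lambda>x. foldl (\<lambda>s a. Pair a s) (mk (K x)) (rev (L x)))"
    by (rule ptime_fold_add[OF _ lptime_rev[OF L] ptime_mk[OF K] poly_bounded_const[of _ _ 1], of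
        "\<lambda>a x s. Pair a s"])
      (intro ptime_Pair ptime_left ptime_right ptime_id, simp)
  then show ?thesis using foldl_rev_map[of "\<lambda>a. a"] by (simp add: lptime_def)
qed

lemma nodes_mk_append: "nodes (mk (L @ K)) + 1 = nodes (mk L) + nodes (mk K)"
  by (simp add: nodes_mk)

lemma lptime_concat_map:
  assumes F: "lptime (\<lambda>z. F (left z) (right z))" and L: "lptime L"
  shows "lptime (\<lambda>x. concat (map (\<lambda>a. F a x) (L x)))"
proof -
  have M: "lptime (\<lambda>x. rev (map (\<lambda>a. mk (F a x)) (L x)))"
    by (intro lptime_rev lptime_map ptime_mk F L)
  have eq: "foldl (\<lambda>s a. mk (spine a @ spine s)) (mk K) (rev M) = mk (concat (map spine M) @ K)" for K M
    by (induction M arbitrary: K rule: rev_induct) auto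
  have "ptime (\<lambda>x. foldl (\<lambda>s a. mk (spine a @ spine s)) Null (rev (map (\<lambda>a. mk (F a x)) (L x))))"
  proof (rule ptime_fold_add[OF _ M ptime_const poly_bounded_const[of _ _ 1], of
      "\<lambda>a x s. mk (spine a @ spine s)"])
    fix a x s
    show "nodes (mk (spine a @ spine s)) \<le> nodes s + nodes a + 1"
      using nodes_mk_append[of "spine a" "spine s"] by simp
  qed (intro ptime_mk lptime_append lptime_spine ptime_left ptime_right ptime_id)
  then show ?thesis using eq[of "[]"] by (simp add: lptime_def comp_def)
qed

lemma lptime_filter:
  assumes P: "bptime (\<lambda>z. P (left z) (right z))" and L: "lptime L"
  shows "lptime (\<lambda>x. filter (\<lambda>a. P a x) (L x))"
proof -
  have eq: "filter Q M = concat (map (\<lambda>a. if Q a then [a] else []) M)" for Q and M :: "tree list"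
    by (induction M) auto
  show ?thesis unfolding eq
    by (intro lptime_concat_map L lptime_if P lptime_const lptime_Cons ptime_left ptime_id)
qed

text \<open>\<open>K\<close> acts as a unary number. Dropping is the primitive behind comparison of
  lengths, table lookup and counting.\<close>

lemma lptime_drop:
  assumes K: "lptime K" and L: "lptime L"
  shows "lptime (\<lambda>x. drop (length (K x)) (L x))"
proof -
  have eq: "foldl (\<lambda>s a. right s) (mk M) N = mk (drop (length N) M)" for M N :: "tree list"
    by (induction N arbitrary: M) (auto simp: drop_Suc)
  have "nodes (right s) \<le> nodes s" for s by (cases s) auto
  then have "nodes (right s) \<le> nodes s + nodes a + 0" for s a by (meson le_add1 order_trans)
  then have "ptime (\<lambda>x. foldl (\<lambda>s a. right s) (mk (L x)) (K x))"
    by (intro ptime_fold_add[OF _ K ptime_mk[OF L] poly_bounded_const, of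
        "\<lambda>a x s. right s"] ptime_right ptime_id)
  then show ?thesis unfolding eq by (simp add: lptime_def)
qed

lemma bptime_length_le:
  assumes "lptime K" "lptime L"
  shows "bptime (\<lambda>x. length (K x) \<le> length (L x))"
  using bptime_Nil[OF lptime_drop[OF assms(2,1)]] by simp

lemma bptime_bex:
  assumes "bptime (\<lambda>z. P (left z) (right z))" "lptime L"
  shows "bptime (\<lambda>x. \<exists>a\<in>set (L x). P a x)"
  using bptime_not[OF bptime_Nil[OF lptime_filter[OF assms]]] by (simp add: filter_empty_conv)

lemma bptime_ball:
  assumes "bptime (\<lambda>z. P (left z) (right z))" "lptime L"
  shows "bptime (\<lambda>x. \<forall>a\<in>set (L x). P a x)"
  using bptime_not[OF bptime_bex[OF bptime_not[OF assms(1)] assms(2)]] by simp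

lemma bptime_mem:
  assumes "ptime f" "lptime L"
  shows "bptime (\<lambda>x. f x \<in> set (L x))"
proof -
  have "bptime (\<lambda>x. \<exists>a\<in>set (L x). a = f x)"
    using ptime_comp[OF assms(1) ptime_right[OF ptime_id]]
    by (intro bptime_bex bptime_eq assms ptime_left ptime_id)
  then show ?thesis by simp
qed

section \<open>Counters and binary numbers\<close>

definition count_with :: "(tree \<Rightarrow> tree) \<Rightarrow> tree list \<Rightarrow> tree list" where
  "count_with g L = map (\<lambda>i. Pair ((g ^^ i) Null) (L ! i)) [0..<length L]"

lemma length_count_with [simp]: "length (count_with g L) = length L"
  by (simp add: count_with_def)

lemma count_with_snoc: "count_with g (L @ [a]) = count_with g L @ [Pair ((g ^^ length L) Null) a]"
  by (simp add: count_with_def nth_append)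

text \<open>A fold carries the current counter and the reversed output. The assumption
  \<open>small\<close> keeps both polynomial, which iteration of a polynomial-time \<open>g\<close>
  alone would not ensure. The instances are unary and binary counting.\<close>

lemma lptime_count_with:
  assumes g: "ptime g" and small: "\<And>i. nodes ((g ^^ i) Null) \<le> C * Suc i" and L: "lptime L"
  shows "lptime (\<lambda>x. count_with g (L x))"
proof -
  define G where "G = (\<lambda>a (x :: tree) s. Pair (g (left s)) (Pair (Pair (left s) a) (right s)))"
  have fold: "foldl (\<lambda>s a. G a x s) (Pair Null Null) K = Pair ((g ^^ length K) Null)
      (mk (rev (count_with g K)))"
    for x K by (induction K rule: rev_induct) (simp_all add: G_def count_with_snoc, simp add:
        count_with_def)
  have "ptime (\<lambda>z. G (left z) (left (right z)) (right (right z)))"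
    unfolding G_def by (intro ptime_Pair ptime_left ptime_right ptime_id ptime_comp[OF g])
  then have "ptime (\<lambda>x. foldl (\<lambda>s a. G a x s) (Pair Null Null) (L x))"
  proof (rule ptime_fold[OF _ L ptime_const])
    show "poly_bounded UNIV nodes (\<lambda>x. 2 + C * (nodes (mk (L x)) + 1) + nodes (mk (L x)) *
        (2 + C * (nodes (mk (L x)) + 1) + nodes (mk (L x))))"
      by (intro poly_bounded_intros ptime_nodes[OF ptime_mk[OF L]])
    fix x i assume i: "i \<le> length (L x)"
    define K where "K = take i (L x)"
    define n where "n = nodes (mk (L x))"
    have K: "length K \<le> n" "length K = i" "\<And>a. a \<in> set K \<Longrightarrow> nodes a \<le> n"
      using i length_le_nodes_mk[of "L x"] nodes_mk_mem[of _ "L x"]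
          by (auto simp: K_def n_def dest: in_set_takeD)
    have e: "nodes ((g ^^ j) Null) \<le> C * (n + 1)" if "j \<le> length K" for j
      using small[of j] that K(1) by (metis Suc_eq_plus1 Suc_le_mono mult_le_mono2 order_trans)
    have "(\<Sum>a\<leftarrow>count_with g K. 1 + nodes a) = (\<Sum>i\<leftarrow>[0..<length K]. 1 +
        (1 + nodes ((g ^^ i) Null) + nodes (K ! i)))"
      by (simp add: count_with_def comp_def)
    also have "\<dots> \<le> (\<Sum>i\<leftarrow>[0..<length K]. 2 + C * (n + 1) + n)"
    proof (rule sum_list_mono)
      fix j assume "j \<in> set [0..<length K]"
      then show "1 + (1 + nodes ((g ^^ j) Null) + nodes (K ! j)) \<le> 2 + C * (n + 1) + n"
        using e[of j] K(3)[of "K ! j"] by simp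
    qed
    also have "\<dots> = length K * (2 + C * (n + 1) + n)" by (simp add: sum_list_triv)
    also have "\<dots> \<le> n * (2 + C * (n + 1) + n)" using K(1) by (rule mult_right_mono) simp
    finally have "nodes (mk (count_with g K)) \<le> 1 + n * (2 + C * (n + 1) + n)" by (simp add: nodes_mk)
    moreover have "nodes (mk (rev M)) = nodes (mk M)" for M
      by (simp add: nodes_mk rev_map[symmetric])
    ultimately show "nodes (foldl (\<lambda>s a. G a x s) (Pair Null Null) (take i (L x)))
        \<le> 2 + C * (nodes (mk (L x)) + 1) + nodes (mk (L x)) *
            (2 + C * (nodes (mk (L x)) + 1) + nodes (mk (L x)))"
      using e[of "length K"] unfolding K_def[symmetric] fold n_def[symmetric] by simp
  qed
  from ptime_right[OF this] have "lptime (\<lambda>x. rev (count_with g (L x)))"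
    unfolding fold by (simp add: lptime_def)
  from lptime_rev[OF this] show ?thesis by simp
qed

fun inc_bits :: "tree list \<Rightarrow> tree list" where
  "inc_bits [] = [enc_bool True]"
| "inc_bits (a # L) = (if a = Null then enc_bool True # L else Null # inc_bits L)"

lemma enc_nat_pos: "0 < n \<Longrightarrow> enc_nat n = Pair (enc_bool (odd n)) (enc_nat (n div 2))"
  by (cases n) auto

lemma inc_bits_enc_nat: "inc_bits (spine (enc_nat n)) = spine (enc_nat (Suc n))"
proof (induction n rule: less_induct)
  case (less n)
  show ?case
  proof (cases "n = 0")
    case False
    then show ?thesis
      using less[of "n div 2"] by (cases "even n") (auto simp: enc_nat_pos simp del: enc_nat.simps(2))
  qed simp
qed

definition inc :: "tree \<Rightarrow> tree" where
  "inc t = mk (inc_bits (spine t))"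

lemma inc_pow: "(inc ^^ i) Null = enc_nat i"
  by (induction i) (simp_all add: inc_def inc_bits_enc_nat del: enc_nat.simps(2))

lemma ptime_inc: "ptime inc"
proof -
  \<comment> \<open>The state pairs the carry, \<open>Null\<close> once it is absorbed, with the
    bits written so far in reverse order.\<close>
  define G where "G = (\<lambda>a (x :: tree) s. if left s = Null then Pair Null (Pair a (right s))
    else if a = Null then Pair Null (Pair (enc_bool True) (right s)) else Pair (enc_bool True)
        (Pair Null (right s)))"
  have copy: "foldl (\<lambda>s a. G a x s) (Pair Null (mk K)) L = Pair Null (mk (rev L @ K))" for x K L
  proof (induction L arbitrary: K)
    case (Cons a L)
    show ?case using Cons[of "a # K"] by (simp add: G_def)
  qed simp
  \<comment> \<open>A carry that survives the last bit becomes a new most significant bit.\<close>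
  have carry: "(let s = foldl (\<lambda>s a. G a x s) (Pair (enc_bool True) (mk K)) L in
      rev (spine (right s)) @ (if left s = Null then [] else [enc_bool True])) = rev K @ inc_bits
          L" for x K L
  proof (induction L arbitrary: K)
    case (Cons a L)
    show ?case
    proof (cases "a = Null")
      case True
      then show ?thesis using copy[of x "enc_bool True # K" L] by (simp add: G_def)
    next
      case False
      then show ?thesis using Cons[of "Null # K"] by (simp add: G_def)
    qed
  qed simp
  define f where "f = (\<lambda>x. foldl (\<lambda>s a. G a x s) (Pair (enc_bool True) Null) (spine x))"
  have f: "ptime f" unfolding f_def
  proof (rule ptime_fold_add[OF _ lptime_spine[OF ptime_id] ptime_const poly_bounded_const[of _ _ 7]])
    show "ptime (\<lambda>z. G (left z) (left (right z)) (right (right z)))" unfolding G_def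
      by (intro ptime_if ptime_Pair ptime_const ptime_left ptime_right ptime_id bptime_eq)
    have r: "nodes (right s) \<le> nodes s" for s by (cases s) auto
    show "nodes (G a x s) \<le> nodes s + nodes a + 7" for a x s
      using r[of s] by (simp add: G_def enc_bool_def)
  qed
  have "inc = (\<lambda>x. mk (rev (spine (right (f x))) @ (if left (f x) = Null then [] else [enc_bool True])))"
    using carry[where K = "[]"] by (simp add: f_def inc_def Let_def fun_eq_iff)
  then show ?thesis
    by (rule ssubst) (intro ptime_mk lptime_append lptime_rev lptime_spine ptime_right f lptime_if
        bptime_eq ptime_left
        ptime_const lptime_const)
qed

lemma nodes_enc_nat_le: "nodes (enc_nat n) \<le> 4 * Suc n"
proof (induction n rule: less_induct)
  case (less n)
  show ?case
  proof (cases "n = 0")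
    case False
    moreover from this have "n div 2 + 1 \<le> n" by linarith
    ultimately show ?thesis using less[of "n div 2"] nodes_enc_bool_le[of "odd n"]
      by (simp add: enc_nat_pos)
  qed simp
qed

definition number :: "tree list \<Rightarrow> tree list" where
  "number L = map (\<lambda>i. Pair (enc_nat i) (L ! i)) [0..<length L]"

lemma lptime_number: "lptime L \<Longrightarrow> lptime (\<lambda>x. number (L x))"
  using lptime_count_with[OF ptime_inc, of 4 L]
  by (simp add: inc_pow nodes_enc_nat_le count_with_def number_def del: enc_nat.simps mult_Suc_right)

text \<open>Prepending an entry makes the positions run up to \<open>length (L x)\<close> inclusive,
  so the index attached to the last entry is the length itself, in binary.\<close>

lemma ptime_count: "lptime L \<Longrightarrow> ptime (\<lambda>x. enc_nat (length (L x)))"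
proof -
  assume L: "lptime L"
  have "enc_nat (length (L x)) = left (left (mk (drop (length (L x)) (number (Null # L x)))))" for x
    by (simp add: number_def left_mk hd_map hd_drop_conv_nth drop_map del: upt_Suc)
  then show ?thesis
    by (simp only:) (intro ptime_left ptime_mk lptime_drop L lptime_number lptime_Cons ptime_const)
qed

lemma unary_pow: "(Pair Null ^^ i) Null = enc_unary i"
  by (induction i) auto

lemma nodes_enc_unary: "nodes (enc_unary i) = 1 + 2 * i"
  by (induction i) auto

lemma spine_enc_unary [simp]: "spine (enc_unary i) = replicate i Null"
  by (induction i) auto

lemma lptime_unary: "lptime L \<Longrightarrow> lptime (\<lambda>x. map enc_unary [0..<length (L x)])"
proof -
  assume L: "lptime L"
  have "lptime (\<lambda>x. count_with (Pair Null) (L x))"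
    by (rule lptime_count_with[OF _ _ L, of _ 2])
        (simp_all add: unary_pow nodes_enc_unary ptime_Pair ptime_const ptime_id)
  then have "lptime (\<lambda>x. map (\<lambda>a. left a) (count_with (Pair Null) (L x)))"
    by (intro lptime_map ptime_left ptime_id)
  then show ?thesis by (simp add: count_with_def unary_pow comp_def)
qed

lemma lptime_enc_nats: "lptime L \<Longrightarrow> lptime (\<lambda>x. map enc_nat [0..<length (L x)])"
proof -
  assume L: "lptime L"
  then have "lptime (\<lambda>x. map (\<lambda>a. left a) (number (L x)))"
    by (intro lptime_map lptime_number ptime_left ptime_id)
  then show ?thesis by (simp add: number_def comp_def)
qed

section \<open>From small covers to good labellings\<close>

text \<open>Here \<open>g e\<close> is the vertex of which \<open>e\<close> is a copy and
  \<open>c\<close> counts the labels at a copy; \<open>b\<close> selects a cheapest copy of each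
  vertex.\<close>

lemma ex_minimal_copy:
  fixes c :: "'e \<Rightarrow> nat"
  shows "\<exists>b. \<forall>e\<in>E. b (g e) \<in> E \<and> g (b (g e)) = g e \<and> c (b (g e)) \<le> c e"
proof -
  have "\<exists>e'. \<forall>e\<in>E. g e = v \<longrightarrow> e' \<in> E \<and> g e' = v \<and> c e' \<le> c e" for v
    using ex_has_least_nat[of "\<lambda>e. e \<in> E \<and> g e = v" _ c] by blast
  then obtain b where "\<forall>v. \<forall>e\<in>E. g e = v \<longrightarrow> b v \<in> E \<and> g (b v) = v \<and> c (b v) \<le> c e" by metis
  then show ?thesis by blast
qed

lemma ex_enumeration:
  assumes "\<And>v. finite (A v)"
  shows "\<exists>h. \<forall>v. A v = h v ` {..<card (A v)}"
proof -
  have "\<exists>h. A v = h ` {..<card (A v)}" for v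
    using ex_bij_betw_nat_finite[OF assms[of v]] by (auto simp: bij_betw_def lessThan_atLeast0)
  then show ?thesis by metis
qed

text \<open>\<open>CL\<close> and \<open>CR\<close> are the labels bought for left and right copies.
  Since \<open>cov\<close> holds for any two copies of the endpoints of \<open>e\<close>, it applies
  to the cheapest ones, whose labels depend on the vertices only. What remains is averaging twice,
  over edges and over pairs of positions.\<close>

lemma labelling_of_cover:
  fixes E :: "'e set" and la :: "'e \<Rightarrow> 'v" and rb :: "'e \<Rightarrow> 'w" and pr :: "'e \<Rightarrow> 'l \<Rightarrow> 'r"
  assumes fin: "finite E" "finite SL" "finite SR" and sub: "CL \<subseteq> E \<times> SL" "CR \<subseteq> E \<times> SR"
    and def: "l0 \<in> SL" "r0 \<in> SR" and w: "0 < w"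
    and cov: "\<And>e e' f. e \<in> E \<Longrightarrow> e' \<in> E \<Longrightarrow> f \<in> E \<Longrightarrow> la e' = la e \<Longrightarrow> rb f = rb e \<Longrightarrow>
      \<exists>\<sigma>. (e', \<sigma>) \<in> CL \<and> (f, pr e \<sigma>) \<in> CR"
    and small: "card CL + card CR \<le> 2 * card E * w"
  shows "\<exists>fl fr. range fl \<subseteq> SL \<and> range fr \<subseteq> SR \<and>
    card E \<le> 32 * w\<^sup>2 * card {e \<in> E. pr e (fl (la e)) = fr (rb e)}"
proof -
  define L where "L e = {\<sigma>. (e, \<sigma>) \<in> CL}" for e
  define R where "R e = {\<tau>. (e, \<tau>) \<in> CR}" for e
  have LS: "L e \<subseteq> SL" and RS: "R e \<subseteq> SR" for e using sub by (auto simp: L_def R_def)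
  have finL: "finite (L e)" and finR: "finite (R e)" for e
    using finite_subset[OF LS fin(2)] finite_subset[OF RS fin(3)] .
  have Sigma: "CL = Sigma E L" "CR = Sigma E R" using sub by (auto simp: L_def R_def)
  have cards: "card CL = (\<Sum>e\<in>E. card (L e))" "card CR = (\<Sum>e\<in>E. card (R e))"
    using card_SigmaI[OF fin(1), of L] card_SigmaI[OF fin(1), of R] finL finR
        by (metis Sigma(1), metis Sigma(2))
  obtain bl where bl: "\<And>e. e \<in> E \<Longrightarrow> bl (la e) \<in> E \<and> la (bl (la e)) = la e \<and> card (L (bl (la e))) \<le>
      card (L e)"
    using ex_minimal_copy[of E la "\<lambda>e. card (L e)"] by blast
  obtain br where br: "\<And>e. e \<in> E \<Longrightarrow> br (rb e) \<in> E \<and> rb (br (rb e)) = rb e \<and> card (R (br (rb e))) \<le>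
      card (R e)"
    using ex_minimal_copy[of E rb "\<lambda>e. card (R e)"] by blast
  obtain hl where hl: "\<And>v. L (bl v) = hl v ` {..<card (L (bl v))}"
    using ex_enumeration[of "\<lambda>v. L (bl v)"] finL by blast
  obtain hr where hr: "\<And>v. R (br v) = hr v ` {..<card (R (br v))}"
    using ex_enumeration[of "\<lambda>v. R (br v)"] finR by blast
  \<comment> \<open>The labelling takes the \<open>p\<close>-th label of each list; the defaults
    \<open>l0\<close> and \<open>r0\<close> fill in where a list is too short.\<close>
  define fl where "fl p v = (if p < card (L (bl v)) then hl v p else l0)" for p v
  define fr where "fr q v = (if q < card (R (br v)) then hr v q else r0)" for q v
  have fl: "fl p v \<in> SL" for p v
    using hl[of v] LS[of "bl v"] def by (auto simp: fl_def)
  have fr: "fr p v \<in> SR" for p v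
    using hr[of v] RS[of "br v"] def by (auto simp: fr_def)
  define sat where "sat p q = {e \<in> E. pr e (fl p (la e)) = fr q (rb e)}" for p q
  define l where "l e = card (L (bl (la e)))" for e
  define r where "r e = card (R (br (rb e)))" for e
  \<comment> \<open>Markov's inequality: cheapest copies have no more labels than the actual copies,
    whose lists have total length at most \<open>2 * card E * w\<close>, so at most half of the
    edges exceed \<open>4 * w\<close>.\<close>
  define good where "good = {e \<in> E. l e + r e \<le> 4 * w}"
  have "(\<Sum>e\<in>E. l e + r e) \<le> (\<Sum>e\<in>E. card (L e) + card (R e))"
    using bl br by (intro sum_mono add_mono) (auto simp: l_def r_def)
  also have "\<dots> \<le> 2 * card E * w" using small cards by (simp add: sum.distrib)
  finally have "(\<Sum>e\<in>E. l e + r e) \<le> 2 * card E * w" .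
  moreover have "(\<Sum>e\<in>E - good. 4 * w) \<le> (\<Sum>e\<in>E - good. l e + r e)"
    by (intro sum_mono) (auto simp: good_def)
  moreover have "\<dots> \<le> (\<Sum>e\<in>E. l e + r e)" using fin by (intro sum_mono2) auto
  ultimately have "(\<Sum>e\<in>E - good. 4 * w) \<le> 2 * card E * w" by linarith
  then have "card (E - good) * (4 * w) \<le> 2 * card E * w" by simp
  then have "(2 * card (E - good)) * (2 * w) \<le> card E * (2 * w)" by (simp add: ac_simps)
  then have "2 * card (E - good) \<le> card E" using w by simp
  moreover have "card (E - good) = card E - card good" "card good \<le> card E"
    using fin by (auto simp: good_def intro!: card_Diff_subset card_mono)
  ultimately have half: "card E \<le> 2 * card good" by linarith
  \<comment> \<open>On a good edge both lists have length at most \<open>4 * w\<close>, so the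
    relevant pairs of positions lie in a square of \<open>16 * w\<^sup>2\<close> points.\<close>
  define I where "I = {..<4 * w} \<times> {..<4 * w}"
  have "good \<subseteq> (\<Union>(p, q)\<in>I. sat p q)"
  proof
    fix e assume e: "e \<in> good"
    then have eE: "e \<in> E" by (simp add: good_def)
    obtain \<sigma> where \<sigma>: "\<sigma> \<in> L (bl (la e))" "pr e \<sigma> \<in> R (br (rb e))"
      using cov[OF eE, of "bl (la e)" "br (rb e)"] bl[OF eE] br[OF eE] by (auto simp: L_def R_def)
    obtain p where p: "p < l e" "hl (la e) p = \<sigma>" using \<sigma>(1) hl[of "la e"] unfolding l_def
        by (metis imageE lessThan_iff)
    obtain q where q: "q < r e" "hr (rb e) q = pr e \<sigma>" using \<sigma>(2) hr[of "rb e"] unfolding r_def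
        by (metis imageE lessThan_iff)
    have "(p, q) \<in> I" using p q e by (auto simp: I_def good_def)
    moreover have "e \<in> sat p q" using p q eE by (simp add: sat_def fl_def fr_def l_def r_def)
    ultimately show "e \<in> (\<Union>(p, q)\<in>I. sat p q)" by blast
  qed
  moreover have finI: "finite I" "card I = 16 * w\<^sup>2" by (auto simp: I_def power2_eq_square)
  moreover have fsat: "finite (sat p q)" for p q using fin by (simp add: sat_def)
  ultimately have "card good \<le> card (\<Union>(p, q)\<in>I. sat p q)"
    by (intro card_mono) auto
  also have "\<dots> \<le> (\<Sum>i\<in>I. card (case i of (p, q) \<Rightarrow> sat p q))"
    by (rule card_UN_le[OF finI(1)])
  finally have le: "card good \<le> (\<Sum>i\<in>I. card (case i of (p, q) \<Rightarrow> sat p q))" .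
  \<comment> \<open>Some pair of positions satisfies an average share of the good edges: 16 comes
    from the number of pairs, and another factor 2 from discarding the bad edges.\<close>
  have "\<exists>p q. card E \<le> 32 * w\<^sup>2 * card (sat p q)"
  proof (rule ccontr)
    assume "\<nexists>p q. card E \<le> 32 * w\<^sup>2 * card (sat p q)"
    then have less: "32 * w\<^sup>2 * card (sat p q) < card E" for p q by (meson not_le)
    have "32 * w\<^sup>2 * card good \<le> (\<Sum>i\<in>I. 32 * w\<^sup>2 * card (case i of (p, q) \<Rightarrow> sat p q))"
      using le by (simp add: sum_distrib_left[symmetric])
    also have "(0, 0) \<in> I" using w by (simp add: I_def)
    then have "(\<Sum>i\<in>I. 32 * w\<^sup>2 * card (case i of (p, q) \<Rightarrow> sat p q)) < (\<Sum>i\<in>I. card E)"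
      using less finI by (intro sum_strict_mono) auto
    also have "\<dots> \<le> 16 * w\<^sup>2 * (2 * card good)" using half finI(2) by simp
    finally show False by simp
  qed
  then obtain p q where "card E \<le> 32 * w\<^sup>2 * card (sat p q)" by blast
  then show ?thesis using fl fr unfolding sat_def by (intro exI[of _ "fl p"] exI[of _ "fr q"]) auto
qed

section \<open>The Set Cover instance of a projection game\<close>

lemma inj_enc_bool: "enc_bool a = enc_bool b \<longleftrightarrow> a = b"
  by (auto simp: enc_bool_def)

lemma enc_nat_eq_iff [simp]: "enc_nat m = enc_nat n \<longleftrightarrow> m = n"
proof (induction m arbitrary: n rule: less_induct)
  case (less m)
  show ?case
  proof (cases "m = 0 \<or> n = 0")
    case True
    then show ?thesis by (cases m; cases n) auto
  next
    case False
    then have "enc_nat m = enc_nat n \<longleftrightarrow> odd m = odd n \<and> m div 2 = n div 2"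
      using less[of "m div 2" "n div 2"] by (auto simp: enc_nat_pos inj_enc_bool)
    also have "\<dots> \<longleftrightarrow> m = n" by (metis div_mult_mod_eq parity_cases odd_iff_mod_2_eq_one
        even_iff_mod_2_eq_zero)
    finally show ?thesis .
  qed
qed

lemma enc_unary_eq_iff [simp]: "enc_unary m = enc_unary n \<longleftrightarrow> m = n"
  by (metis length_replicate spine_enc_unary)

lemma enc_list_eq_mk: "enc_list f xs = mk (map f xs)"
  by (induction xs) auto

lemma mk_eq_iff [simp]: "mk L = mk K \<longleftrightarrow> L = K"
  by (metis spine_mk)

lemma inj_enc_list: "inj f \<Longrightarrow> inj (enc_list f)"
  by (rule injI) (simp add: enc_list_eq_mk[of f] inj_map_eq_map)

lemma inj_enc_prod: "inj f \<Longrightarrow> inj g \<Longrightarrow> inj (enc_prod f g)"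
  by (auto intro!: injI simp: inj_eq)

definition enc_edge :: "nat \<times> nat \<times> nat list \<Rightarrow> tree" where
  "enc_edge = enc_prod enc_nat (enc_prod enc_nat (enc_list enc_nat))"

lemma inj_enc_edge: "inj enc_edge"
  unfolding enc_edge_def by (intro inj_enc_prod inj_enc_list) (auto intro: injI)

text \<open>Left labels are unary numbers, to be used as positions in the table of \<open>\<pi>\<^sub>e\<close>; right labels are
  the binary numbers stored in the tables. Edges are not indexed, but represented by their encodings.\<close>

definition proj :: "tree \<Rightarrow> tree \<Rightarrow> tree" where
  "proj e u = left (mk (drop (length (spine u)) (spine (right (right e)))))"

lemma proj_enc_edge: "i < length xs \<Longrightarrow> proj (enc_edge (a, b, xs)) (enc_unary i) = enc_nat (xs ! i)"
  using Cons_nth_drop_Suc[of i "map enc_nat xs", symmetric]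
  by (simp add: proj_def enc_edge_def enc_list_eq_mk[of enc_nat] del: enc_unary.simps enc_nat.simps)

definition elements :: "tree list \<Rightarrow> tree list \<Rightarrow> tree list" where
  "elements E Xs = concat (map (\<lambda>e. concat (map (\<lambda>e'. concat (map (\<lambda>f.
     if left e' = left e \<and> left (right f) = left (right e)
     then map (\<lambda>X. Pair e (Pair e' (Pair f X))) Xs else []) E)) E)) E)"

lemma set_elements: "set (elements E Xs) = {Pair e (Pair e' (Pair f X)) | e e' f X.
    e \<in> set E \<and> e' \<in> set E \<and> f \<in> set E \<and> X \<in> set Xs \<and> left e' = left e \<and> left (right f) = left
        (right e)}"
  by (auto simp: elements_def split: if_splits)

text \<open>An element consists of a base edge, a left copy, a right copy and a set. The label is
  bought by the left copy, but the constraint under test is that of the base edge, hence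
  \<open>proj (left q)\<close>.\<close>

definition in_left :: "tree \<Rightarrow> tree \<Rightarrow> tree \<Rightarrow> bool" where
  "in_left e u q \<longleftrightarrow> left (right q) = e \<and> proj (left q) u \<notin> set (spine (right (right (right q))))"

definition in_right :: "tree \<Rightarrow> tree \<Rightarrow> tree \<Rightarrow> bool" where
  "in_right f t q \<longleftrightarrow> left (right (right q)) = f \<and> t \<in> set (spine (right (right (right q))))"

fun in_set :: "bool \<times> tree \<times> tree \<Rightarrow> tree \<Rightarrow> bool" where
  "in_set (b, e, u) = (if b then in_left e u else in_right e u)"

text \<open>A sublist is stored as a tree whose spine lists it in reverse order, so that it can be
  part of an element; \<open>[Null]\<close> is the family containing just the empty set.\<close>

definition sublists :: "tree list \<Rightarrow> tree list" where
  "sublists L = foldl (\<lambda>s a. s @ map (Pair a) s) [Null] L"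

lemma sublists_snoc: "sublists (L @ [a]) = sublists L @ map (Pair a) (sublists L)"
  by (simp add: sublists_def)

lemma length_sublists: "length (sublists L) = 2 ^ length L"
proof (induction L rule: rev_induct)
  case Nil
  show ?case by (simp add: sublists_def)
next
  case (snoc a L)
  then show ?case by (simp add: sublists_snoc)
qed

lemma ex_sublist: "Z \<subseteq> set L \<Longrightarrow> \<exists>X\<in>set (sublists L). set (spine X) = Z"
proof (induction L arbitrary: Z rule: rev_induct)
  case Nil
  then show ?case by (simp add: sublists_def)
next
  case (snoc a L)
  then obtain X where X: "X \<in> set (sublists L)" "set (spine X) = Z - (if a \<in> set L then {} else {a})"
    using snoc.IH[of "Z - (if a \<in> set L then {} else {a})"] snoc.prems by (cases "a \<in> set L") fastforce+
  show ?case
  proof (cases "a \<in> Z \<and> a \<notin> set L")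
    case True
    then have "set (spine (Pair a X)) = Z" using X by auto
    moreover have "Pair a X \<in> set (sublists (L @ [a]))" using X by (simp add: sublists_snoc)
    ultimately show ?thesis by blast
  next
    case False
    then have "set (spine X) = Z" using X(2) by (auto split: if_splits)
    then show ?thesis using X(1) by (auto simp: sublists_snoc)
  qed
qed

definition game_edges :: "game \<Rightarrow> tree list" where
  "game_edges G = map enc_edge (edges G)"

definition left_labels :: "game \<Rightarrow> tree list" where
  "left_labels G = map enc_unary [0..<nalph G]"

definition right_labels :: "game \<Rightarrow> tree list" where
  "right_labels G = map enc_nat [0..<nalph G]"

definition game_elements :: "game \<Rightarrow> tree list" where
  "game_elements G = elements (game_edges G) (sublists (right_labels G))"

definition game_sets :: "game \<Rightarrow> (bool \<times> tree \<times> tree) list" where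
  "game_sets G = map (\<lambda>p. (True, p)) (List.product (game_edges G) (left_labels G)) @
     map (\<lambda>p. (False, p)) (List.product (game_edges G) (right_labels G))"

definition game_cover :: "game \<Rightarrow> set_cover_instance" where
  "game_cover G = \<lparr>universe_size = length (game_elements G),
     subsets = map (\<lambda>d. filter (\<lambda>i. in_set d (game_elements G ! i))
         [0..<length (game_elements G)]) (game_sets G)\<rparr>"

lemma universe_game_cover: "universe_size (game_cover G) = length (game_elements G)"
  by (simp add: game_cover_def)

lemma num_sets_game_cover: "num_sets (game_cover G) = 2 * length (edges G) * nalph G"
  by (simp add: game_cover_def game_sets_def game_edges_def left_labels_def right_labels_def)

text \<open>Members of the sets are positions in \<open>game_elements G\<close>. Membership depends
  only on the tree at a position, so covering can be discussed in terms of trees.\<close>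

lemma covers_game_cover:
  assumes "set s \<subseteq> {..<num_sets (game_cover G)}"
  shows "(\<Union>i\<in>set s. set (subsets (game_cover G) ! i)) = {..<universe_size (game_cover G)} \<longleftrightarrow>
    (\<forall>q\<in>set (game_elements G). \<exists>i\<in>set s. in_set (game_sets G ! i) q)"
proof -
  have s: "i < length (game_sets G)" if "i \<in> set s" for i
    using assms that by (auto simp: game_cover_def)
  have "(\<Union>i\<in>set s. set (subsets (game_cover G) ! i)) =
      {j. j < length (game_elements G) \<and> (\<exists>i\<in>set s. in_set (game_sets G ! i) (game_elements G ! j))}"
    using s by (auto simp: game_cover_def)
  moreover have "{j. j < length (game_elements G) \<and>
      (\<exists>i\<in>set s. in_set (game_sets G ! i) (game_elements G ! j))} =
      {..<length (game_elements G)} \<longleftrightarrow> (\<forall>q\<in>set (game_elements G). \<exists>i\<in>set s. in_set (game_sets G ! i) q)"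
    by (auto simp: all_set_conv_all_nth set_eq_iff)
  ultimately show ?thesis by (simp add: universe_game_cover)
qed

lemma projection_gameD:
  assumes "projection_game G" "(a, b, xs) \<in> set (edges G)"
  shows "a < nleft G" "b < nright G" "length xs = nalph G" "i < nalph G \<Longrightarrow> xs ! i < nalph G"
proof -
  show 1: "a < nleft G" "b < nright G" "length xs = nalph G" using assms
      unfolding projection_game_def by fastforce+
  have "set xs \<subseteq> {..<nalph G}" using assms unfolding projection_game_def by fastforce
  then show "i < nalph G \<Longrightarrow> xs ! i < nalph G" using 1(3) nth_mem[of i xs] by (metis lessThan_iff subsetD)
qed

lemma proj_in_right_labels:
  assumes "projection_game G" "e \<in> set (game_edges G)" "u \<in> set (left_labels G)"
  shows "proj e u \<in> set (right_labels G)"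
  using assms projection_gameD[OF assms(1)]
  by (fastforce simp: game_edges_def left_labels_def right_labels_def proj_enc_edge)

lemma card_game_edges:
  assumes "projection_game G"
  shows "card (set (game_edges G)) = length (edges G)"
proof -
  have "distinct (map (\<lambda>(a, b, xs). (a, b)) (edges G))" using assms by (simp add: projection_game_def)
  then have "distinct (edges G)" by (simp add: distinct_map)
  then have "distinct (game_edges G)" unfolding game_edges_def
    by (simp add: distinct_map inj_on_subset[OF inj_enc_edge])
  from distinct_card[OF this] show ?thesis by (metis game_edges_def length_map)
qed

lemma game_cover_sound:
  assumes G: "projection_game G" and s: "feasible set_cover (game_cover G) s"
    and small: "cost set_cover (game_cover G) s \<le> 2 * length (edges G) * w" and w: "0 < w"
  shows "\<exists>\<phi>. game_assignment G \<phi> \<and> length (edges G) \<le> 32 * w\<^sup>2 * card (satisfied_edges G \<phi>)"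
proof -
  define E where "E = set (game_edges G)"
  define D where "D = (\<lambda>i. game_sets G ! i) ` set s"
  define CL where "CL = {(e, u). (True, e, u) \<in> D}"
  define CR where "CR = {(e, u). (False, e, u) \<in> D}"
  have A: "0 < nalph G" using G by (simp add: projection_game_def)
  have s1: "set s \<subseteq> {..<num_sets (game_cover G)}"
    and s2: "\<forall>q\<in>set (game_elements G). \<exists>d\<in>D. in_set d q"
    using s covers_game_cover[of s G] by (auto simp: set_cover_def D_def)
  have "D \<subseteq> set (game_sets G)" using s1 by (auto simp: D_def game_cover_def)
  then have sub: "CL \<subseteq> E \<times> set (left_labels G)" "CR \<subseteq> E \<times> set (right_labels G)"
    by (auto simp: CL_def CR_def E_def game_sets_def)
  \<comment> \<open>The tags keep left and right sets apart, so the two cardinalities add up to at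
    most the number of chosen sets.\<close>
  have "(\<lambda>p. (True, p)) ` CL \<union> (\<lambda>p. (False, p)) ` CR \<subseteq> D" by (auto simp: CL_def CR_def)
  then have "card ((\<lambda>p. (True, p)) ` CL \<union> (\<lambda>p. (False, p)) ` CR) \<le> card D"
      by (intro card_mono) (auto simp: D_def)
  moreover have "finite CL" "finite CR"
    using sub finite_subset by (metis E_def List.finite_set finite_SigmaI)+
  ultimately have "card CL + card CR \<le> card D"
    by (subst (asm) card_Un_disjoint) (auto simp: card_image inj_on_def)
  also have "\<dots> \<le> card (set s)" by (auto simp: D_def intro: card_image_le)
  also have "\<dots> \<le> 2 * card E * w" using small by (simp add: set_cover_def E_def card_game_edges[OF G])
  finally have cards: "card CL + card CR \<le> 2 * card E * w" .
  have cov: "\<exists>\<sigma>. (e', \<sigma>) \<in> CL \<and> (f, proj e \<sigma>) \<in> CR"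
    if e: "e \<in> E" "e' \<in> E" "f \<in> E" "left e' = left e" "left (right f) = left (right e)" for e e' f
  proof -
    \<comment> \<open>The critical element takes for \<open>X\<close> the projections of all labels
      at \<open>e'\<close>. No label of \<open>e'\<close> covers it, so a label of \<open>f\<close>
      does; lying in \<open>X\<close>, that label is the projection of a label at
      \<open>e'\<close>.\<close>
    define Z where "Z = {proj e \<sigma> | \<sigma>. (e', \<sigma>) \<in> CL}"
    have "Z \<subseteq> set (right_labels G)"
      using sub proj_in_right_labels[OF G] e(1) by (fastforce simp: Z_def E_def)
    then obtain X where X: "X \<in> set (sublists (right_labels G))" "set (spine X) = Z"
        using ex_sublist by blast
    define q where "q = Pair e (Pair e' (Pair f X))"
    have "q \<in> set (game_elements G)"
      unfolding game_elements_def set_elements q_def using e X(1) by (auto simp: E_def)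
    then obtain b g u where d: "(b, g, u) \<in> D" "in_set (b, g, u) q" using s2 by (metis prod_cases3)
    show ?thesis
    proof (cases b)
      case True
      then have "(e', u) \<in> CL" "proj e u \<notin> Z" using d X by (auto simp: in_left_def q_def CL_def)
      then show ?thesis by (auto simp: Z_def)
    next
      case False
      then have "(f, u) \<in> CR" "u \<in> Z" using d X by (auto simp: in_right_def q_def CR_def)
      then show ?thesis by (auto simp: Z_def)
    qed
  qed
  have l0: "enc_unary 0 \<in> set (left_labels G)" "enc_nat 0 \<in> set (right_labels G)"
    using A by (auto simp: left_labels_def right_labels_def simp del: enc_unary.simps enc_nat.simps)
  have finE: "finite E" by (simp add: E_def)
  have "\<exists>fl fr. range fl \<subseteq> set (left_labels G) \<and> range fr \<subseteq> set (right_labels G) \<and>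
      card E \<le> 32 * w\<^sup>2 * card {e \<in> E. proj e (fl (left e)) = fr (left (right e))}"
    by (rule labelling_of_cover[where la = left and rb = "\<lambda>e. left (right e)" and pr = proj,
        OF finE List.finite_set List.finite_set sub l0 w cov cards])
  then obtain fl fr where f: "range fl \<subseteq> set (left_labels G)" "range fr \<subseteq> set (right_labels G)"
    "card E \<le> 32 * w\<^sup>2 * card {e \<in> E. proj e (fl (left e)) = fr (left (right e))}" by (elim exE conjE)
  have "\<exists>i<nalph G. fl v = enc_unary i" "\<exists>i<nalph G. fr v = enc_nat i" for v
    using subsetD[OF f(1), of "fl v"] subsetD[OF f(2), of "fr v"]
    by (auto simp: left_labels_def right_labels_def)
  then obtain \<alpha> \<beta> where \<alpha>: "\<And>v. \<alpha> v < nalph G \<and> fl v = enc_unary (\<alpha> v)" and \<beta>: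
      "\<And>v. \<beta> v < nalph G \<and> fr v = enc_nat (\<beta> v)"
    by metis
  \<comment> \<open>The labelling found is indexed by trees encoding vertices, whereas an assignment
    is indexed by the vertex numbers.\<close>
  define \<phi> where "\<phi> = case_sum (\<lambda>a. \<alpha> (enc_nat a)) (\<lambda>b. \<beta> (enc_nat b))"
  have "{e \<in> E. proj e (fl (left e)) = fr (left (right e))} \<subseteq> enc_edge ` satisfied_edges G \<phi>"
  proof
    fix e assume e: "e \<in> {e \<in> E. proj e (fl (left e)) = fr (left (right e))}"
    then obtain a b xs where x: "(a, b, xs) \<in> set (edges G)" "e = enc_edge (a, b, xs)"
      by (auto simp: E_def game_edges_def)
    have "proj e (fl (left e)) = enc_nat (xs ! \<alpha> (enc_nat a))"
    proof -
      have "left e = enc_nat a" by (simp add: x(2) enc_edge_def)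
      then show ?thesis
        using \<alpha>[of "enc_nat a"] projection_gameD(3)[OF G x(1)] proj_enc_edge[of "\<alpha> (enc_nat a)" xs a b]
        by (simp only: x(2))
    qed
    moreover have "fr (left (right e)) = enc_nat (\<beta> (enc_nat b))"
      using \<beta> by (simp add: x(2) enc_edge_def)
    ultimately have "xs ! \<alpha> (enc_nat a) = \<beta> (enc_nat b)" using e by simp
    then show "e \<in> enc_edge ` satisfied_edges G \<phi>"
      using x by (auto simp: satisfied_edges_def \<phi>_def)
  qed
  moreover have fin: "finite (satisfied_edges G \<phi>)"
    by (rule finite_subset[of _ "set (edges G)"]) (auto simp: satisfied_edges_def)
  ultimately have "card {e \<in> E. proj e (fl (left e)) = fr (left (right e))} \<le> card (satisfied_edges G \<phi>)"
    by (meson surj_card_le)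
  then have "length (edges G) \<le> 32 * w\<^sup>2 * card (satisfied_edges G \<phi>)"
    using f(3) card_game_edges[OF G] unfolding E_def by (metis (lifting) mult_le_mono2 order_trans)
  moreover have "game_assignment G \<phi>" using \<alpha> \<beta> by (auto simp: game_assignment_def \<phi>_def)
  ultimately show ?thesis by blast
qed

lemma ex_index: "d \<in> set L \<Longrightarrow> \<exists>i<length L. L ! i = d"
  by (simp add: in_set_conv_nth)

lemma game_cover_complete:
  assumes G: "projection_game G" and \<phi>: "game_assignment G \<phi>" "satisfied_edges G \<phi> = set (edges G)"
  shows "\<exists>s. feasible set_cover (game_cover G) s \<and> cost set_cover (game_cover G) s \<le> 2 * length
      (edges G)"
proof -
  \<comment> \<open>Each copy gets the label of its vertex under \<open>\<phi>\<close>, which makes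
    two sets per edge.\<close>
  define D where "D = map (\<lambda>(a, b, xs). (True, enc_edge (a, b, xs), enc_unary (\<phi> (Inl a)))) (edges G) @
    map (\<lambda>(a, b, xs). (False, enc_edge (a, b, xs), enc_nat (\<phi> (Inr b)))) (edges G)"
  have lab: "\<phi> (Inl a) < nalph G" "\<phi> (Inr b) < nalph G" "xs ! \<phi> (Inl a) = \<phi> (Inr b)" if
      "(a, b, xs) \<in> set (edges G)" for a b xs
  proof -
    show "\<phi> (Inl a) < nalph G" "\<phi> (Inr b) < nalph G"
      using \<phi>(1) projection_gameD[OF G that] by (auto simp: game_assignment_def)
    have "(a, b, xs) \<in> satisfied_edges G \<phi>" using that \<phi>(2) by simp
    then show "xs ! \<phi> (Inl a) = \<phi> (Inr b)" by (simp add: satisfied_edges_def)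
  qed
  have "set D \<subseteq> set (game_sets G)"
    using lab by (fastforce simp: D_def game_sets_def game_edges_def left_labels_def right_labels_def)
  then have "\<forall>d\<in>set D. \<exists>i<length (game_sets G). game_sets G ! i = d" by (meson ex_index subsetD)
  then obtain idx where idx: "\<And>d. d \<in> set D \<Longrightarrow> idx d < length (game_sets G) \<and> game_sets G ! (idx d)
      = d" by metis
  define s where "s = map idx D"
  have s: "set s \<subseteq> {..<num_sets (game_cover G)}" using idx by (auto simp: s_def game_cover_def)
  have "\<exists>d\<in>set D. in_set d q" if q0: "q \<in> set (game_elements G)" for q
  proof -
    obtain e e' f X where q: "q = Pair e (Pair e' (Pair f X))" "e \<in> set (game_edges G)"
        "e' \<in> set (game_edges G)"
      "f \<in> set (game_edges G)" "left e' = left e" "left (right f) = left (right e)"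
      using q0 unfolding game_elements_def set_elements by blast
    obtain a b xs where e: "e = enc_edge (a, b, xs)" "(a, b, xs) \<in> set (edges G)" using q(2)
        by (auto simp: game_edges_def)
    obtain b' xs' where e': "e' = enc_edge (a, b', xs')" "(a, b', xs') \<in> set (edges G)"
      using q(3,5) e by (auto simp: game_edges_def enc_edge_def)
    obtain a' ys where f: "f = enc_edge (a', b, ys)" "(a', b, ys) \<in> set (edges G)"
      using q(4,6) e by (auto simp: game_edges_def enc_edge_def)
    have p: "proj e (enc_unary (\<phi> (Inl a))) = enc_nat (\<phi> (Inr b))"
      using lab[OF e(2)] projection_gameD[OF G e(2)]
          by (simp add: e(1) proj_enc_edge del: enc_unary.simps enc_nat.simps)
    have "(True, e', enc_unary (\<phi> (Inl a))) \<in> set D" "(False, f, enc_nat (\<phi> (Inr b))) \<in> set D"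
      using e' f by (force simp: D_def)+
    \<comment> \<open>The label of \<open>f\<close> equals the projection of the label of
      \<open>e'\<close> along \<open>e\<close>. The set of \<open>f\<close> covers the element if
      \<open>X\<close> contains this label, the set of \<open>e'\<close> if it does not.\<close>
    moreover have "in_set (True, e', enc_unary (\<phi> (Inl a))) q \<or> in_set (False, f, enc_nat (\<phi> (Inr b))) q"
      using p by (simp add: q(1) in_left_def in_right_def)
    ultimately show ?thesis by blast
  qed
  then have "\<exists>d\<in>set D. in_set (game_sets G ! idx d) q" if "q \<in> set (game_elements G)" for q
    using that idx by metis
  then have "\<forall>q\<in>set (game_elements G). \<exists>i\<in>set s. in_set (game_sets G ! i) q"
    by (simp add: s_def)
  then have "feasible set_cover (game_cover G) s"
    using s covers_game_cover[OF s] by (simp add: set_cover_def)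
  moreover have "cost set_cover (game_cover G) s \<le> 2 * length (edges G)"
    using card_length[of s] by (simp add: set_cover_def s_def D_def)
  ultimately show ?thesis by blast
qed

text \<open>A general game provides no satisfying assignment, but a single element is covered by any
  left label together with its projection along the base edge. Label 0 exists because the alphabet
  is nonempty.\<close>

lemma game_cover_instance:
  assumes G: "projection_game G"
  shows "game_cover G \<in> instances set_cover"
proof -
  define s where "s = [0..<num_sets (game_cover G)]"
  have A: "0 < nalph G" using G by (simp add: projection_game_def)
  have "\<exists>d\<in>set (game_sets G). in_set d q" if q0: "q \<in> set (game_elements G)" for q
  proof -
    obtain e e' f X where q: "q = Pair e (Pair e' (Pair f X))" "e \<in> set (game_edges G)"
        "e' \<in> set (game_edges G)"
      "f \<in> set (game_edges G)"
      using q0 by (auto simp: game_elements_def set_elements)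
    define u where "u = enc_unary 0"
    have u: "u \<in> set (left_labels G)" using A by
        (simp add: u_def left_labels_def image_iff del: enc_unary.simps)
    have "(True, e', u) \<in> set (game_sets G)" "(False, f, proj e u) \<in> set (game_sets G)"
      using q u proj_in_right_labels[OF G q(2) u] by (auto simp: game_sets_def)
    moreover have "in_set (True, e', u) q \<or> in_set (False, f, proj e u) q"
      by (simp add: q(1) in_left_def in_right_def)
    ultimately show ?thesis by blast
  qed
  moreover have "set s = {..<length (game_sets G)}" by (auto simp: s_def game_cover_def)
  ultimately have "\<forall>q\<in>set (game_elements G). \<exists>i\<in>set s. in_set (game_sets G ! i) q"
    by (metis ex_index lessThan_iff)
  then have "(\<Union>i\<in>set s. set (subsets (game_cover G) ! i)) = {..<universe_size (game_cover G)}"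
    by (subst covers_game_cover) (auto simp: s_def)
  moreover have "(\<Union>S\<in>set (subsets (game_cover G)). set S) = (\<Union>i\<in>set s. set (subsets (game_cover G) ! i))"
    unfolding s_def by (force simp: in_set_conv_nth)
  ultimately show ?thesis by (simp add: set_cover_def) (auto simp: game_cover_def)
qed

lemma length_elements: "length (elements E Xs) \<le> length E ^ 3 * length Xs"
proof -
  have *: "length (concat (map g L)) \<le> length L * k" if "\<And>a. length (g a) \<le> k" for g ::
      "tree \<Rightarrow> tree list" and L k
  proof (induction L)
    case (Cons a L)
    then show ?case using add_mono[OF that[of a] Cons] by simp
  qed simp
  have "length (elements E Xs) \<le> length E * (length E * (length E * length Xs))"
    unfolding elements_def by (intro *) simp
  then show ?thesis by (simp add: power3_eq_cube ac_simps)
qed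

text \<open>Selecting positions by a property of the entries is turned into filtering the numbered
  list, for which there is a closure rule.\<close>

lemma enc_game_cover:
  "enc_inst set_cover (game_cover G) = Pair (enc_nat (length (game_elements G)))
    (mk (map (\<lambda>d. mk (map left (filter (\<lambda>r. in_set d (right r)) (number (game_elements G)))))
        (game_sets G)))"
proof -
  have "map enc_nat (filter (\<lambda>i. P (U ! i)) [0..<length U]) = map left
      (filter (\<lambda>r. P (right r)) (number U))"
    for P :: "tree \<Rightarrow> bool" and U
    by (simp add: number_def filter_map comp_def)
  then show ?thesis by (simp add: set_cover_def game_cover_def enc_list_eq_mk[of enc_nat]
      enc_list_eq_mk[of "enc_list enc_nat"] comp_def)
qed

section \<open>Computing the reduction\<close>

lemmas ptime_intros = ptime_left ptime_right ptime_Pair ptime_const ptime_id ptime_if ptime_mk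
  ptime_enc_bool ptime_count lptime_spine lptime_const lptime_Cons lptime_if lptime_rev lptime_map
  lptime_append lptime_concat_map lptime_filter lptime_drop lptime_number lptime_unary lptime_enc_nats
  bptime_eq bptime_not bptime_conj bptime_if bptime_const bptime_length_le bptime_bex bptime_ball
      bptime_mem

lemma lptime_comp: "lptime L \<Longrightarrow> ptime f \<Longrightarrow> lptime (\<lambda>x. L (f x))"
  unfolding lptime_def by (rule ptime_comp)

text \<open>Under a binder the context reappears as \<open>right\<close> of the argument, where the
  closure rules do not see through arbitrary functions \<open>A\<close> and \<open>B\<close>. A
  definition is therefore treated once with projections in their place, and composed
  afterwards.\<close>

lemma lptime_comp2:
  assumes "lptime (\<lambda>x. F (spine (left x)) (spine (right x)))" "lptime A" "lptime B"
  shows "lptime (\<lambda>x. F (A x) (B x))"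
  using lptime_comp[OF assms(1) ptime_Pair[OF ptime_mk ptime_mk], OF assms(2,3)] by simp

lemma ptime_proj: "ptime f \<Longrightarrow> ptime g \<Longrightarrow> ptime (\<lambda>x. proj (f x) (g x))"
  unfolding proj_def by (intro ptime_intros)

lemma bptime_in_left: "ptime f \<Longrightarrow> ptime g \<Longrightarrow> ptime h \<Longrightarrow> bptime (\<lambda>x. in_left (f x) (g x) (h x))"
  unfolding in_left_def by (intro ptime_intros ptime_proj)

lemma bptime_in_right: "ptime f \<Longrightarrow> ptime g \<Longrightarrow> ptime h \<Longrightarrow> bptime (\<lambda>x. in_right (f x) (g x) (h x))"
  unfolding in_right_def by (intro ptime_intros)

lemma lptime_elements: "lptime E \<Longrightarrow> lptime Xs \<Longrightarrow> lptime (\<lambda>x. elements (E x) (Xs x))"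
  by (rule lptime_comp2) (unfold elements_def, intro ptime_intros)

definition members :: "bool \<Rightarrow> tree \<Rightarrow> tree \<Rightarrow> tree list \<Rightarrow> tree" where
  "members b e u U = mk (map (\<lambda>r. left r) (filter (\<lambda>r. in_set (b, e, u) (right r)) (number U)))"

lemma ptime_members:
  assumes "ptime e" "ptime u" "lptime U"
  shows "ptime (\<lambda>x. members b (e x) (u x) (U x))"
proof -
  have "ptime (\<lambda>x. members b (left x) (left (right x)) (spine (right (right x))))"
    unfolding members_def in_set.simps if_distribR
    by (cases b; simp only: if_True if_False; intro ptime_intros bptime_in_left bptime_in_right)
  from ptime_comp[OF this ptime_Pair[OF assms(1) ptime_Pair[OF assms(2) ptime_mk[OF assms(3)]]]]
  show ?thesis by simp
qed

definition cover_tree :: "tree list \<Rightarrow> tree list \<Rightarrow> tree list \<Rightarrow> tree list \<Rightarrow> tree" where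
  "cover_tree E LL RL U = Pair (enc_nat (length U))
    (mk (concat (map (\<lambda>e. map (\<lambda>u. members True e u U) LL) E) @
         concat (map (\<lambda>e. map (\<lambda>u. members False e u U) RL) E)))"

lemma enc_game_cover_tree:
  "enc_inst set_cover (game_cover G) =
    cover_tree (game_edges G) (left_labels G) (right_labels G) (game_elements G)"
  unfolding enc_game_cover
  by (simp add: cover_tree_def game_sets_def members_def product_concat_map map_concat comp_def)

lemma ptime_cover_tree:
  "ptime (\<lambda>x. let E = spine (left x); LL = spine (left (right x)); RL = spine (left (right (right x)))
    in cover_tree E LL RL (elements E (spine (right (right (right x))))))"
  unfolding Let_def cover_tree_def by (intro ptime_intros ptime_members lptime_elements)

lemma nodes_sublists: "X \<in> set (sublists L) \<Longrightarrow> nodes X \<le> nodes (mk L)"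
proof (induction L arbitrary: X rule: rev_induct)
  case Nil
  then show ?case by (simp add: sublists_def)
next
  case (snoc a L)
  then show ?case
    using snoc.IH by (fastforce simp: sublists_snoc nodes_mk)
qed

text \<open>The one superpolynomial step of the reduction. It stays within the measure
  \<open>B\<close> because \<open>exp\<close> bounds \<open>2 ^ length (L x)\<close> polynomially in
  \<open>B x\<close>, and this in turn bounds the states of the loop.\<close>

lemma computable_within_sublists:
  assumes L: "computable_within D e (\<lambda>x. mk (L x)) B" and e: "poly_bounded D B (\<lambda>x. nodes (e x))"
    and exp: "poly_bounded D B (\<lambda>x. 2 ^ length (L x))"
  shows "computable_within D e (\<lambda>x. mk (sublists (L x))) B"
proof -
  define G where "G = (\<lambda>z. mk (spine (right (right z)) @ map (\<lambda>X. Pair (left z) X)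
      (spine (right (right z)))))"
  have fold: "foldl (\<lambda>s a. G (Pair a (Pair Null s))) (Pair Null Null) K = mk (sublists K)" for K
    by (induction K rule: rev_induct) (simp_all add: sublists_snoc G_def, simp add: sublists_def)
  have const: "computable_within D e (\<lambda>_. Null) B" using ptime_computable_within[OF ptime_const e] .
  have "computable_within D e (\<lambda>x. foldl (\<lambda>s a. G (Pair a (Pair Null s))) (Pair Null Null) (L x)) B"
  proof (rule computable_within_fold[OF _ L const _ e])
    show "ptime G" unfolding G_def by (intro ptime_intros)
    show "computable_within D e (\<lambda>_. Pair Null Null) B" using ptime_computable_within[OF ptime_const e] .
    show "poly_bounded D B (\<lambda>x. 1 + 2 ^ length (L x) * (1 + nodes (mk (L x))))"
      by (intro poly_bounded_intros exp computable_within_nodes[OF L e])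
  next
    fix x i assume i: "i \<le> length (L x)"
    define K where "K = take i (L x)"
    have "nodes (mk K) \<le> nodes (mk (L x))"
      using nodes_mk_append[of K "drop i (L x)"] by (simp add: K_def nodes_mk)
    then have "nodes (mk (sublists K)) \<le> 1 + (\<Sum>a\<leftarrow>sublists K. 1 + nodes (mk (L x)))"
      unfolding nodes_mk[of "sublists K"] using nodes_sublists
      by (intro add_left_mono sum_list_mono) (meson order_trans)
    also have "\<dots> = 1 + 2 ^ length K * (1 + nodes (mk (L x)))"
      by (simp add: sum_list_triv length_sublists)
    also have "\<dots> \<le> 1 + 2 ^ length (L x) * (1 + nodes (mk (L x)))"
      using i by (intro add_left_mono mult_right_mono power_increasing) (auto simp: K_def)
    finally show "nodes (foldl (\<lambda>s a. G (Pair a (Pair Null s))) (Pair Null Null) (take i (L x)))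
        \<le> 1 + 2 ^ length (L x) * (1 + nodes (mk (L x)))" unfolding fold K_def .
  qed
  then show ?thesis unfolding fold .
qed

lemma enc_game_eq: "enc_game G = Pair (enc_nat (nleft G))
    (Pair (enc_nat (nright G)) (Pair (enc_nat (nalph G)) (mk (game_edges G))))"
  by (simp add: enc_game_def game_edges_def enc_edge_def[symmetric] enc_list_eq_mk[of enc_edge])

lemma computable_within_game_cover:
  assumes R: "computable_within D e (\<lambda>I. enc_game (R I)) B" and e: "poly_bounded D B (\<lambda>I. nodes (e I))"
    and game: "\<And>I. I \<in> D \<Longrightarrow> projection_game (R I)" and exp: "poly_bounded D B (\<lambda>I. 2 ^ nalph (R I))"
  shows "computable_within D e (\<lambda>I. enc_inst set_cover (game_cover (R I))) B"
proof -
  define E where "E = (\<lambda>g. spine (right (right (right g))))"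
  \<comment> \<open>The alphabet size is stored in binary, but the label lists need it in unary. It
    is read off as the length of the table at the first edge, which exists because a game has at
    least one edge.\<close>
  define A where "A = (\<lambda>g. spine (right (right (left (mk (E g))))))"
  have E: "lptime E" and A: "lptime A" unfolding A_def E_def by (intro ptime_intros)+
  have E_eq: "E (enc_game G) = game_edges G" for G by (simp add: E_def enc_game_eq)
  have A_len: "length (A (enc_game (R I))) = nalph (R I)" if I: "I \<in> D" for I
  proof -
    obtain a b xs es where es: "edges (R I) = (a, b, xs) # es"
      using game[OF I] by (cases "edges (R I)") (auto simp: projection_game_def)
    then have "length xs = nalph (R I)" using projection_gameD(3)[OF game[OF I], of a b xs] by simp
    then show ?thesis
      by (simp add: A_def E_eq game_edges_def es enc_edge_def enc_list_eq_mk[of enc_nat])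
  qed
  have edges: "computable_within D e (\<lambda>I. mk (game_edges (R I))) B"
    using computable_within_ptime[OF R ptime_mk[OF E] e] by (simp add: E_eq)
  have left: "computable_within D e (\<lambda>I. mk (left_labels (R I))) B"
    by (rule computable_within_cong[OF computable_within_ptime[OF R
        ptime_mk[OF lptime_unary[OF A]] e]]) (simp add: A_len left_labels_def)
  have right: "computable_within D e (\<lambda>I. mk (right_labels (R I))) B"
    by (rule computable_within_cong[OF computable_within_ptime[OF R
        ptime_mk[OF lptime_enc_nats[OF A]] e]]) (simp add: A_len right_labels_def)
  have subs: "computable_within D e (\<lambda>I. mk (sublists (right_labels (R I)))) B"
    by (rule computable_within_sublists[OF right e]) (use exp in \<open>simp add: right_labels_def\<close>)
  show ?thesis
    using computable_within_ptime[OF computable_within_pair[OF edges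
        computable_within_pair[OF left computable_within_pair[OF right subs e] e] e] ptime_cover_tree e]
    by (simp add: enc_game_cover_tree game_elements_def Let_def)
qed

section \<open>Integer roots, with lists as unary numbers\<close>

fun list_power :: "nat \<Rightarrow> tree list \<Rightarrow> tree list" where
  "list_power 0 L = [Null]"
| "list_power (Suc n) L = concat (map (\<lambda>_. list_power n L) L)"

lemma length_list_power [simp]: "length (list_power n L) = length L ^ n"
  by (induction n) (simp_all add: length_concat comp_def sum_list_triv)

lemma lptime_list_power: "lptime L \<Longrightarrow> lptime (\<lambda>x. list_power n (L x))"
proof (induction n arbitrary: L)
  case (Suc n)
  then show ?case
    unfolding list_power.simps by (intro ptime_intros Suc.IH lptime_comp[OF Suc.prems])
qed (simp add: lptime_const)

definition list_root :: "nat \<Rightarrow> tree list \<Rightarrow> tree list" where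
  "list_root q L = filter (\<lambda>u. length (list_power q (spine u)) \<le> length L)
      (map enc_unary [0..<length (Null # L)])"

lemma lptime_list_root:
  assumes "lptime L"
  shows "lptime (\<lambda>x. list_root q (L x))"
proof -
  have "lptime (\<lambda>x. list_root q (spine x))"
    unfolding list_root_def by (intro ptime_intros lptime_list_power)
  from lptime_comp[OF this ptime_mk[OF assms]] show ?thesis by simp
qed

text \<open>For positive \<open>q\<close> this is the integer part of the \<open>q\<close>-th root
  plus one, because 0 is counted too. So it is positive and never below the real root.\<close>

definition nat_root :: "nat \<Rightarrow> nat \<Rightarrow> nat" where
  "nat_root q n = card {i. i \<le> n \<and> i ^ q \<le> n}"

lemma length_list_root: "length (list_root q L) = nat_root q (length L)"
proof -
  have "length (list_root q L) = length (filter (\<lambda>i. i ^ q \<le> length L) [0..<Suc (length L)])"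
    by (simp add: list_root_def filter_map comp_def del: upt_Suc)
  also have "\<dots> = card {i. i \<le> length L \<and> i ^ q \<le> length L}"
    by (simp add: distinct_length_filter Int_def conj_commute less_Suc_eq_le del: upt_Suc)
  finally show ?thesis by (simp add: nat_root_def)
qed

definition list_prod :: "tree list \<Rightarrow> tree list \<Rightarrow> tree list" where
  "list_prod A B = concat (map (\<lambda>_. B) A)"

lemma length_list_prod [simp]: "length (list_prod A B) = length A * length B"
  by (simp add: list_prod_def length_concat comp_def sum_list_triv)

lemma lptime_list_prod: "lptime A \<Longrightarrow> lptime B \<Longrightarrow> lptime (\<lambda>x. list_prod (A x) (B x))"
  by (rule lptime_comp2) (unfold list_prod_def, intro ptime_intros)

text \<open>The conjecture lets \<open>\<epsilon>\<close> vary with the size of the formula provided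
  that \<open>1 / \<epsilon>\<close>, rounded up, can be computed from that size in unary. The case
  \<open>k = 64\<close> is the choice made later.\<close>

lemma polytime_computable_scaled_root:
  "polytime_computable enc_unary enc_nat (\<lambda>n. k * (nat_root q n)\<^sup>2)"
proof -
  have "ptime (\<lambda>x. enc_nat (length (list_prod (replicate k Null)
      (list_prod (list_root q (spine x)) (list_root q (spine x))))))"
    by (intro ptime_intros lptime_list_prod lptime_list_root)
  then obtain p t where p: "\<And>x. runs p x (t x)
      (enc_nat (length (list_prod (replicate k Null)
          (list_prod (list_root q (spine x)) (list_root q (spine x))))))"
    "poly_bounded UNIV nodes t" unfolding computable_within_def by auto
  obtain C d where t: "\<And>x. t x \<le> C * Suc (nodes x) ^ d" using p(2) unfolding poly_bounded_def by blast
  have "runs p (enc_unary n) (t (enc_unary n)) (enc_nat (k * (nat_root q n)\<^sup>2)) \<and>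
      t (enc_unary n) \<le> (C * 2 ^ d) * nodes (enc_unary n) ^ d" for n
  proof
    show "runs p (enc_unary n) (t (enc_unary n)) (enc_nat (k * (nat_root q n)\<^sup>2))"
      using p(1)[of "enc_unary n"] by (simp add: length_list_root power2_eq_square)
    \<comment> \<open>The encoding has at least one node, so passing from \<open>Suc\<close> to a
      plain power costs a factor of at most \<open>2 ^ d\<close>.\<close>
    have "C * Suc (nodes (enc_unary n)) ^ d \<le> C * (2 * nodes (enc_unary n)) ^ d"
      by (intro mult_left_mono power_mono) (auto simp: nodes_enc_unary)
    then show "t (enc_unary n) \<le> (C * 2 ^ d) * nodes (enc_unary n) ^ d"
      using order_trans[OF t[of "enc_unary n"]] by (simp only: power_mult_distrib ac_simps)
  qed
  then show ?thesis unfolding polytime_computable_def by blast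
qed

section \<open>Checking a proposed cover\<close>

definition chosen_sets :: "tree \<Rightarrow> tree \<Rightarrow> tree list" where
  "chosen_sets x y = filter (\<lambda>r. left r \<in> set (spine y)) (number (spine (right x)))"

text \<open>An FPT approximation algorithm may output anything if the optimum exceeds \<open>k\<close>, so the output \<open>y\<close>
  is checked to be a cover.\<close>

definition small_cover :: "tree list \<Rightarrow> tree \<Rightarrow> tree \<Rightarrow> bool" where
  "small_cover K x y \<longleftrightarrow>
    (\<forall>S\<in>set (spine (right x)). \<forall>j\<in>set (spine S). \<exists>r\<in>set (chosen_sets x y). j \<in> set (spine (right r))) \<and>
    length (chosen_sets x y) \<le> length K"

lemma bptime_small_cover:
  assumes "lptime K" "ptime f" "ptime g"
  shows "bptime (\<lambda>x. small_cover (K x) (f x) (g x))"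
proof -
  have "bptime (\<lambda>x. small_cover (spine (left x)) (left (right x)) (right (right x)))"
    unfolding small_cover_def chosen_sets_def by (intro ptime_intros)
  from ptime_comp[OF this[unfolded bptime_def]
      ptime_Pair[OF ptime_mk[OF assms(1)] ptime_Pair[OF assms(2,3)]]]
  show ?thesis by (simp add: bptime_def)
qed

text \<open>The output \<open>y\<close> is an arbitrary tree. Keeping the valid indices among its
  entries discards junk and repetitions, so the length of \<open>s\<close> is its cost.\<close>

lemma small_cover_iff:
  fixes y :: tree
  assumes x: "x \<in> instances set_cover"
  defines "s \<equiv> filter (\<lambda>i. enc_nat i \<in> set (spine y)) [0..<num_sets x]"
  shows "small_cover K (enc_inst set_cover x) y \<longleftrightarrow> feasible set_cover x s \<and> cost set_cover x s \<le> length K"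
proof -
  define T where "T = map (enc_list enc_nat) (subsets x)"
  have T: "spine (right (enc_inst set_cover x)) = T"
    by (simp add: set_cover_def enc_list_eq_mk[of "enc_list enc_nat"] T_def)
  have chosen: "chosen_sets (enc_inst set_cover x) y = map (\<lambda>i. Pair (enc_nat i) (T ! i)) s"
    by (simp add: chosen_sets_def T number_def filter_map comp_def s_def T_def)
  have s: "set s \<subseteq> {..<num_sets x}" by (auto simp: s_def)
  have "subsets x ! i \<in> set (subsets x)" if "i \<in> set s" for i
    using s that by (auto intro: nth_mem)
  then have incl: "(\<Union>i\<in>set s. set (subsets x ! i)) \<subseteq> (\<Union>S\<in>set (subsets x). set S)"
    by blast
  have el: "set (spine (enc_list enc_nat S)) = enc_nat ` set S" for S
    by (simp add: enc_list_eq_mk[of enc_nat])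
  have mem: "enc_nat j \<in> enc_nat ` A \<longleftrightarrow> j \<in> A" for j A by auto
  have "(\<forall>S\<in>set T. \<forall>j\<in>set (spine S). \<exists>r\<in>set (map (\<lambda>i. Pair (enc_nat i) (T ! i)) s). j \<in> set
      (spine (right r))) \<longleftrightarrow>
      (\<forall>S\<in>set (subsets x). \<forall>j\<in>set S. \<exists>i\<in>set s. j \<in> set (subsets x ! i))"
    using s by (simp add: T_def el mem subset_iff cong: ball_cong)
  also have "\<dots> \<longleftrightarrow> (\<Union>S\<in>set (subsets x). set S) \<subseteq> (\<Union>i\<in>set s. set (subsets x ! i))" by blast
  also have "\<dots> \<longleftrightarrow> {..<universe_size x} \<subseteq> (\<Union>i\<in>set s. set (subsets x ! i))"
    using x by (simp add: set_cover_def)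
  also have "{..<universe_size x} \<subseteq> (\<Union>i\<in>set s. set (subsets x ! i)) \<longleftrightarrow>
      (\<Union>i\<in>set s. set (subsets x ! i)) = {..<universe_size x}"
    using x incl by (auto simp: set_cover_def)
  also have "\<dots> \<longleftrightarrow> feasible set_cover x s" using s by (simp add: set_cover_def)
  finally have "small_cover K (enc_inst set_cover x) y \<longleftrightarrow> feasible set_cover x s \<and> length s \<le> length K"
    unfolding small_cover_def T chosen by simp
  moreover have "distinct s" by (simp add: s_def)
  ultimately show ?thesis by (simp add: set_cover_def distinct_card)
qed

lemma small_cover_of_solution:
  assumes x: "x \<in> instances set_cover" and s: "feasible set_cover x s" "cost set_cover x s \<le> length K"
  shows "small_cover K (enc_inst set_cover x) (enc_sol set_cover s)"
proof -
  have "set (spine (enc_sol set_cover s)) = enc_nat ` set s"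
    by (simp add: set_cover_def enc_list_eq_mk[of enc_nat])
  then have "set (filter (\<lambda>i. enc_nat i \<in> set (spine (enc_sol set_cover s))) [0..<num_sets x]) = set s"
    using s(1) by (auto simp: set_cover_def)
  with s show ?thesis unfolding small_cover_iff[OF x] by (simp add: set_cover_def)
qed

section \<open>Sizes and time budgets\<close>

lemma nat_root_eq:
  assumes "0 < q"
  shows "nat_root q n = nat \<lfloor>real n powr (1 / real q)\<rfloor> + 1"
proof (cases "n = 0")
  case True
  then have "{i. i \<le> n \<and> i ^ q \<le> n} = {0}" using assms by auto
  then show ?thesis using True by (simp add: nat_root_def)
next
  case False
  define k where "k = nat \<lfloor>real n powr (1 / real q)\<rfloor>"
  have "i \<le> n \<and> i ^ q \<le> n \<longleftrightarrow> i \<le> k" for i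
  proof -
    have "i ^ q \<le> n \<longleftrightarrow> real i ^ q \<le> (real n powr (1 / real q)) ^ q"
      using assms False by (simp add: powr_realpow[symmetric] powr_powr flip: of_nat_power)
    also have "\<dots> \<longleftrightarrow> real i \<le> real n powr (1 / real q)"
      using assms by (intro power_mono_iff) auto
    also have "\<dots> \<longleftrightarrow> i \<le> k" by (simp add: k_def le_nat_iff le_floor_iff)
    finally have *: "i ^ q \<le> n \<longleftrightarrow> i \<le> k" .
    have "i \<le> i ^ q" using assms by (cases "i = 0") (auto intro: self_le_power)
    with * show ?thesis by linarith
  qed
  then have "{i. i \<le> n \<and> i ^ q \<le> n} = {..k}" by auto
  then show ?thesis by (simp add: nat_root_def k_def)
qed

lemma nat_root_ge: "0 < q \<Longrightarrow> real n powr (1 / real q) \<le> real (nat_root q n)"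
  by (simp add: nat_root_eq) linarith

lemma nat_root_le:
  assumes "0 < q" "0 < n"
  shows "real (nat_root q n) \<le> 2 * real n powr (1 / real q)"
proof -
  have "1 \<le> real n powr (1 / real q)" using assms by (intro ge_one_powr_ge_zero) auto
  then show ?thesis using assms by (simp add: nat_root_eq) linarith
qed

lemma nat_root_pos: "0 < q \<Longrightarrow> 0 < nat_root q n"
  by (simp add: nat_root_eq)

lemma nat_root_mono: "m \<le> n \<Longrightarrow> nat_root q m \<le> nat_root q n"
  unfolding nat_root_def by (intro card_mono) auto

section \<open>Size of a 3-CNF formula in terms of its clauses and variables\<close>

lemma nodes_literal:
  assumes "k < v"
  shows "nodes (enc_prod enc_bool enc_nat (b, k)) \<le> 4 + 4 * v"
  using nodes_enc_bool_le[of b] nodes_enc_nat_le[of k] assms by simp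

lemma sum_list_le_length: "(\<And>a. a \<in> set L \<Longrightarrow> g a \<le> (k :: nat)) \<Longrightarrow> sum_list (map g L) \<le> length L * k"
  using sum_list_mono[of L g "\<lambda>_. k"] by (simp add: sum_list_triv)

lemma nodes_enc_list: "nodes (enc_list f L) = 1 + (\<Sum>a\<leftarrow>L. 1 + nodes (f a))"
  by (induction L) auto

lemma length_le_cnf_size: "length I \<le> cnf_size I"
  unfolding cnf_size_def enc_cnf_def by (induction I) auto

text \<open>Variables are numbered without gaps, so for \<open>v\<close> variables a literal with
  its list cell takes at most \<open>5 + 4 * v\<close> nodes. Three of these, the end of the clause
  and the cell of the clause give \<open>17 + 12 * v\<close>.\<close>

lemma cnf_size_le:
  assumes I: "three_cnf I"
  shows "cnf_size I \<le> 1 + length I * (17 + 12 * card (cnf_vars I))"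
proof -
  define v where "v = card (cnf_vars I)"
  have C: "1 + nodes (enc_list (enc_prod enc_bool enc_nat) C) \<le> 17 + 12 * v" if C: "C \<in> set I" for C
  proof -
    have "k < v" if "(b, k) \<in> set C" for b k
    proof -
      have "k \<in> cnf_vars I" using that C by (force simp: cnf_vars_def)
      then show ?thesis using I by (auto simp: three_cnf_def v_def)
    qed
    then have "1 + nodes (enc_prod enc_bool enc_nat l) \<le> 5 + 4 * v" if "l \<in> set C" for l
      using nodes_literal[of "snd l" v "fst l"] that by (cases l) auto
    then have "(\<Sum>l\<leftarrow>C. 1 + nodes (enc_prod enc_bool enc_nat l)) \<le> length C * (5 + 4 * v)"
      by (rule sum_list_le_length)
    also have "\<dots> \<le> 3 * (5 + 4 * v)" using I C by (intro mult_right_mono) (auto simp: three_cnf_def)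
    finally show ?thesis by (simp add: nodes_enc_list)
  qed
  show ?thesis unfolding cnf_size_def enc_cnf_def nodes_enc_list[of _ I] v_def[symmetric]
    by (intro add_left_mono sum_list_le_length C)
qed

lemma card_cnf_vars_le:
  assumes I: "three_cnf I"
  shows "card (cnf_vars I) \<le> 3 * length I"
proof -
  have "card (cnf_vars I) \<le> (\<Sum>C\<in>set I. card (snd ` set C))"
    unfolding cnf_vars_def by (rule card_UN_le) simp
  also have "\<dots> \<le> (\<Sum>C\<in>set I. 3)"
  proof (rule sum_mono)
    fix C assume "C \<in> set I"
    then have "length C \<le> 3" using I by (simp add: three_cnf_def)
    then show "card (snd ` set C) \<le> 3" by (meson List.finite_set card_image_le card_length order_trans)
  qed
  also have "\<dots> \<le> 3 * length I" using card_length[of I] by simp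
  finally show ?thesis .
qed

lemma cnf_size_le_clauses:
  assumes "three_cnf I"
  shows "cnf_size I \<le> 54 * (length I + 1)\<^sup>2"
proof -
  have "cnf_size I \<le> 1 + length I * (17 + 12 * (3 * length I))"
    using cnf_size_le[OF assms] card_cnf_vars_le[OF assms]
    by (meson add_left_mono mult_le_mono2 order_trans)
  also have "\<dots> \<le> 54 * (length I + 1)\<^sup>2" by (simp add: power2_eq_square algebra_simps)
  finally show ?thesis .
qed

text \<open>Clauses are distinct as sets, so they are no more numerous than the lists of length at
  most 3 over \<open>2 * v\<close> literals. This is a sum of four terms, each at most
  \<open>8 * (v + 1) ^ 3\<close>.\<close>

lemma length_three_cnf:
  assumes I: "three_cnf I"
  shows "length I \<le> 32 * (card (cnf_vars I) + 1) ^ 3"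
proof -
  define v where "v = card (cnf_vars I)"
  define A where "A = (UNIV :: bool set) \<times> {..<v}"
  have A: "finite A" "card A = 2 * v" by (auto simp: A_def card_cartesian_product)
  have "length I = card (set (map set I))"
    using I distinct_card[of "map set I"] by (simp add: three_cnf_def)
  also have "\<dots> \<le> card (set ` {C. set C \<subseteq> A \<and> length C \<le> 3})"
  proof (rule card_mono)
    show "finite (set ` {C. set C \<subseteq> A \<and> length C \<le> 3})" using finite_lists_length_le[OF A(1)] by blast
    have "set C \<subseteq> A" if "C \<in> set I" for C
    proof
      fix l assume "l \<in> set C"
      then have "snd l \<in> cnf_vars I" using that by (auto simp: cnf_vars_def)
      then have "snd l < v" using I by (auto simp: three_cnf_def v_def)
      then show "l \<in> A" by (cases l) (simp add: A_def)
    qed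
    then show "set (map set I) \<subseteq> set ` {C. set C \<subseteq> A \<and> length C \<le> 3}"
      using I by (auto simp: three_cnf_def)
  qed
  also have "\<dots> \<le> card {C. set C \<subseteq> A \<and> length C \<le> 3}"
    by (rule card_image_le[OF finite_lists_length_le[OF A(1)]])
  also have "\<dots> = (\<Sum>i\<le>3. (2 * v) ^ i)" using card_lists_length_le[OF A(1)] A(2) by simp
  also have "\<dots> \<le> (\<Sum>i\<le>3::nat. (2 * (v + 1)) ^ 3)"
  proof (rule sum_mono)
    fix i :: nat assume "i \<in> {..3}"
    then have "(2 * (v + 1)) ^ i \<le> (2 * (v + 1)) ^ 3" by (intro power_increasing) auto
    moreover have "(2 * v) ^ i \<le> (2 * (v + 1)) ^ i" by (intro power_mono) auto
    ultimately show "(2 * v) ^ i \<le> (2 * (v + 1)) ^ 3" by linarith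
  qed
  also have "\<dots> = 32 * (v + 1) ^ 3" by (simp only: power_mult_distrib sum_constant) simp
  finally show ?thesis unfolding v_def .
qed

lemma cnf_size_le_vars:
  assumes "three_cnf I"
  shows "cnf_size I \<le> 600 * (card (cnf_vars I) + 1) ^ 4"
proof -
  define u where "u = card (cnf_vars I) + 1"
  have u: "card (cnf_vars I) \<le> u" "1 \<le> u" by (simp_all add: u_def)
  have "17 + 12 * card (cnf_vars I) \<le> 17 * u" by (simp add: u_def)
  then have "length I * (17 + 12 * card (cnf_vars I)) \<le> (32 * u ^ 3) * (17 * u)"
    using length_three_cnf[OF assms] by (intro mult_mono) (auto simp: u_def)
  then have "cnf_size I \<le> 1 + (32 * u ^ 3) * (17 * u)" using cnf_size_le[OF assms] by linarith
  also have "\<dots> = 1 + 544 * u ^ 4" by (simp add: power4_eq_xxxx power3_eq_cube)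
  also have "\<dots> \<le> 600 * u ^ 4" using one_le_power[OF u(2), of 4] by simp
  finally show ?thesis unfolding u_def .
qed

text \<open>This lets a root of the number of clauses stand in for a root of the size. Since
  \<open>54 * 15\<^sup>2 = 12150\<close>, size 20000 forces at least 15 clauses, and then
  \<open>216 \<le> 15\<^sup>2\<close> swallows the constant factor.\<close>

lemma cnf_size_le_clauses_power:
  assumes "three_cnf I" "20000 \<le> cnf_size I"
  shows "cnf_size I \<le> length I ^ 4"
proof -
  define l where "l = length I"
  have n: "cnf_size I \<le> 54 * (l + 1)\<^sup>2" using cnf_size_le_clauses[OF assms(1)] by (simp add: l_def)
  have l: "15 \<le> l"
  proof (rule ccontr)
    assume "\<not> 15 \<le> l"
    then have "(l + 1)\<^sup>2 \<le> 15\<^sup>2" by (intro power_mono) auto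
    with n assms(2) show False by simp
  qed
  have "54 * (l + 1)\<^sup>2 \<le> 54 * (2 * l)\<^sup>2" using l by (intro mult_left_mono power_mono) auto
  also have "\<dots> = 216 * l\<^sup>2" by (simp add: power2_eq_square)
  also have "\<dots> \<le> l\<^sup>2 * l\<^sup>2"
    using power_mono[OF l, of 2] by (intro mult_right_mono) auto
  also have "\<dots> = l ^ 4" by (simp flip: power_add)
  finally show ?thesis using n by (simp add: l_def)
qed

section \<open>Patching finitely many inputs\<close>

lemma finite_trees: "finite {t. nodes t \<le> n}"
proof (induction n)
  case 0
  have "nodes t \<noteq> 0" for t by (cases t) auto
  then have "{t. nodes t \<le> 0} = {}" by auto
  then show ?case by (simp only: finite.emptyI)
next
  case (Suc n)
  have "{t. nodes t \<le> Suc n} \<subseteq> insert Null ((\<lambda>(a, b). Pair a b) ` ({t. nodes t \<le> n} \<times> {t. nodes t \<le> n}))"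
  proof
    fix t assume "t \<in> {t. nodes t \<le> Suc n}"
    then show "t \<in> insert Null ((\<lambda>(a, b). Pair a b) ` ({t. nodes t \<le> n} \<times> {t. nodes t \<le> n}))"
      by (cases t) auto
  qed
  then show ?case using Suc finite_subset by fastforce
qed

lemma inj_enc_cnf: "inj enc_cnf"
  unfolding enc_cnf_def
  by (intro inj_enc_list inj_enc_prod) (auto intro!: injI simp: inj_enc_bool)

lemma finite_small_cnf: "finite {I. cnf_size I < N}"
proof (rule finite_imageD[of enc_cnf])
  have "enc_cnf ` {I. cnf_size I < N} \<subseteq> {t. nodes t \<le> N}" by (auto simp: cnf_size_def)
  then show "finite (enc_cnf ` {I. cnf_size I < N})" using finite_trees finite_subset by blast
qed (rule inj_on_subset[OF inj_enc_cnf], simp)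

lemma poly_bounded_insert: "poly_bounded D B T \<Longrightarrow> poly_bounded (insert x D) B T"
proof -
  assume "poly_bounded D B T"
  then obtain C d where *: "\<forall>y\<in>D. T y \<le> C * Suc (B y) ^ d" unfolding poly_bounded_def by blast
  show ?thesis
  proof (rule poly_boundedI)
    fix y assume y: "y \<in> insert x D"
    have "T y * 1 \<le> T y * Suc (B y) ^ d" by (intro mult_left_mono) auto
    then have "T y \<le> C * Suc (B y) ^ d \<or> T y \<le> T x * Suc (B y) ^ d" using y * by fastforce
    then show "T y \<le> (C + T x) * Suc (B y) ^ d" unfolding distrib_right by linarith
  qed
qed

text \<open>The answer for one more input is stored in the program and selected by an equality test
  on encodings, whence the injectivity.\<close>

lemma computable_within_insert:
  assumes f: "computable_within D e f B" and e: "poly_bounded D B (\<lambda>x. nodes (e x))" and inj: "inj e"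
  shows "computable_within (insert x D) e f B"
proof -
  have e': "poly_bounded (insert x D) B (\<lambda>x. nodes (e x))" by (rule poly_bounded_insert[OF e])
  have "ptime (\<lambda>z. enc_bool (z = e x))" by (intro ptime_intros)
  from ptime_computable_within[OF this e'] have b:
      "computable_within (insert x D) e (\<lambda>y. enc_bool (e y = e x)) B" .
  have "computable_within (insert x D) e (\<lambda>y. if enc_bool (e y = e x) \<noteq> Null then f x else f y) B"
  proof (rule computable_within_if[OF b _ _ e'])
    show "computable_within {y \<in> insert x D. enc_bool (e y = e x) \<noteq> Null} e (\<lambda>_. f x) B"
      by (rule computable_within_subset[OF ptime_computable_within[OF ptime_const e']]) auto
    show "computable_within {y \<in> insert x D. enc_bool (e y = e x) = Null} e f B"
      by (rule computable_within_subset[OF f]) auto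
  qed
  then show ?thesis by (rule computable_within_cong) (use inj in \<open>auto dest: injD\<close>)
qed

lemma computable_within_finite_Un:
  assumes "finite F" "computable_within D e f B" "poly_bounded D B (\<lambda>x. nodes (e x))" "inj e"
  shows "computable_within (F \<union> D) e f B \<and> poly_bounded (F \<union> D) B (\<lambda>x. nodes (e x))"
  using assms(1) by (induction F) (use assms(2-) in \<open>auto intro: computable_within_insert
      poly_bounded_insert\<close>)

definition root_vars :: "cnf \<Rightarrow> real" where
  "root_vars I = sqrt (real (card (cnf_vars I)) + 1)"

text \<open>The time scale of the argument: polynomial in \<open>budget I\<close> means
  \<open>2\<close> to the power \<open>O(sqrt v)\<close> for \<open>v\<close> variables, which is
  closed under polynomials and still \<open>2\<close> to the power \<open>o(v)\<close>.\<close>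

definition budget :: "cnf \<Rightarrow> nat" where
  "budget I = nat \<lceil>2 powr root_vars I\<rceil>"

lemma root_vars_ge: "1 \<le> root_vars I"
  by (simp add: root_vars_def)

lemma budget_ge: "2 powr root_vars I \<le> real (budget I)"
  by (simp add: budget_def)

lemma poly_bounded_budget_exp:
  assumes "\<And>I. I \<in> D \<Longrightarrow> real (T I) \<le> 2 powr (k * root_vars I)"
  shows "poly_bounded D budget T"
proof (rule poly_boundedI[where C = 1 and d = "nat \<lceil>k\<rceil>"])
  fix I assume "I \<in> D"
  then have "real (T I) \<le> 2 powr (k * root_vars I)" by (rule assms)
  also have "\<dots> \<le> 2 powr (real (nat \<lceil>k\<rceil>) * root_vars I)"
    using root_vars_ge[of I] by (intro powr_mono mult_right_mono) (auto simp: real_nat_ceiling_ge)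
  also have "\<dots> = (2 powr root_vars I) ^ nat \<lceil>k\<rceil>"
    by (simp add: powr_realpow[symmetric] powr_powr mult.commute)
  also have "\<dots> \<le> real (budget I) ^ nat \<lceil>k\<rceil>" by (intro power_mono budget_ge) simp
  also have "\<dots> \<le> real (Suc (budget I)) ^ nat \<lceil>k\<rceil>" by (intro power_mono) auto
  finally have "real (T I) \<le> real (Suc (budget I) ^ nat \<lceil>k\<rceil>)" by simp
  then show "T I \<le> 1 * Suc (budget I) ^ nat \<lceil>k\<rceil>" by (simp only: of_nat_le_iff mult_1)
qed

lemma poly_bounded_cnf_size: "poly_bounded {I. three_cnf I} budget cnf_size"
proof -
  have "poly_bounded {I. three_cnf I} budget (\<lambda>I. card (cnf_vars I) + 1)"
  proof (rule poly_bounded_budget_exp[where k = 2])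
    fix I
    define y where "y = root_vars I"
    have y: "0 \<le> y" using root_vars_ge[of I] by (simp add: y_def)
    have "real (card (cnf_vars I) + 1) = y ^ 2" by (simp add: y_def root_vars_def)
    also have "\<dots> \<le> (2 powr y) ^ 2"
    proof (rule power_mono[OF _ y])
      define k where "k = nat \<lfloor>y\<rfloor>"
      have "y \<le> real (Suc k)" using y unfolding k_def by simp linarith
      also have "Suc k \<le> 2 ^ k" by (induction k) auto
      then have "real (Suc k) \<le> 2 ^ k" by (metis of_nat_le_iff of_nat_numeral of_nat_power)
      also have "(2::real) ^ k = 2 powr real k" by (simp add: powr_realpow)
      also have "\<dots> \<le> 2 powr y" using y by (intro powr_mono) (auto simp: k_def)
      finally show "y \<le> 2 powr y" .
    qed
    also have "\<dots> = 2 powr (2 * root_vars I)" by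
        (simp add: y_def powr_realpow[symmetric] powr_powr mult.commute)
    finally show "real (card (cnf_vars I) + 1) \<le> 2 powr (2 * root_vars I)" .
  qed
  from poly_bounded_mult[OF poly_bounded_const[of _ _ 600] poly_bounded_power[OF this, of 4]]
  show ?thesis by (rule poly_bounded_mono) (use cnf_size_le_vars in simp)
qed

text \<open>Restricting to formulas of size at least \<open>N\<close> gives no advantage, since the
  finitely many smaller ones can be tabulated. This is what permits asymptotic estimates later
  on.\<close>

lemma ETH_no_budget_algorithm:
  assumes ETH
  shows "\<not> computable_within {I. three_cnf I \<and> N \<le> cnf_size I} enc_cnf
      (\<lambda>I. enc_bool (satisfiable I)) budget"
proof
  define D where "D = {I. three_cnf I \<and> N \<le> cnf_size I}"
  assume "computable_within {I. three_cnf I \<and> N \<le> cnf_size I} enc_cnf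
      (\<lambda>I. enc_bool (satisfiable I)) budget"
  then have "computable_within D enc_cnf (\<lambda>I. enc_bool (satisfiable I)) budget" by (simp add: D_def)
  moreover have "poly_bounded D budget (\<lambda>I. nodes (enc_cnf I))"
    using poly_bounded_subset[OF poly_bounded_cnf_size, of D] by (auto simp: D_def cnf_size_def[abs_def])
  ultimately have "computable_within ({I. cnf_size I < N} \<union> D) enc_cnf
      (\<lambda>I. enc_bool (satisfiable I)) budget"
    using computable_within_finite_Un[OF finite_small_cnf _ _ inj_enc_cnf] by blast
  then have "computable_within {I. three_cnf I} enc_cnf (\<lambda>I. enc_bool (satisfiable I)) budget"
    by (rule computable_within_subset) (auto simp: D_def)
  then obtain p t where p: "\<And>I. three_cnf I \<Longrightarrow> runs p (enc_cnf I) (t I) (enc_bool (satisfiable I))"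
    "poly_bounded {I. three_cnf I} budget t" unfolding computable_within_def by auto
  obtain C d where t: "\<And>I. three_cnf I \<Longrightarrow> t I \<le> C * Suc (budget I) ^ d" using p(2)
      unfolding poly_bounded_def by auto
  \<comment> \<open>For \<open>y = root_vars I\<close>, \<open>Suc (budget I)\<close> is at most
    \<open>2 powr (2 * y)\<close> because \<open>2 \<le> 2 powr y\<close>; hence the factor 2. The
    logarithm absorbs \<open>C\<close>, with 1 added in case \<open>C = 0\<close>.\<close>
  define f where "f = (\<lambda>v::nat. log 2 (real C + 1) + 2 * real d * sqrt (real v + 1))"
  have "real (t I) \<le> 2 powr f (card (cnf_vars I))" if I: "three_cnf I" for I
  proof -
    define y where "y = root_vars I"
    have "2 powr 1 \<le> 2 powr y" using root_vars_ge[of I] by (intro powr_mono) (auto simp: y_def)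
    then have 2: "2 \<le> 2 powr y" by simp
    have "real (Suc (budget I)) \<le> 2 powr y + 2" unfolding budget_def y_def by simp linarith
    also have "\<dots> \<le> 2 powr y * 2" using 2 by simp
    also have "\<dots> \<le> 2 powr y * 2 powr y" using 2 by (intro mult_left_mono) auto
    also have "\<dots> = 2 powr (2 * y)" by (simp flip: powr_add)
    finally have "real (Suc (budget I)) ^ d \<le> (2 powr (2 * y)) ^ d" by (intro power_mono) auto
    also have "\<dots> = 2 powr (2 * real d * y)" by (simp add: powr_realpow[symmetric] powr_powr ac_simps)
    finally have b: "real (Suc (budget I)) ^ d \<le> 2 powr (2 * real d * y)" .
    have "real (t I) \<le> real (C * Suc (budget I) ^ d)" using t[OF I] by (rule of_nat_mono)
    also have "\<dots> = real C * real (Suc (budget I)) ^ d" by (simp only: of_nat_mult of_nat_power)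
    also have "\<dots> \<le> (real C + 1) * 2 powr (2 * real d * y)" using b by (intro mult_mono) auto
    also have "\<dots> = 2 powr f (card (cnf_vars I))"
      by (simp add: f_def powr_add y_def root_vars_def)
    finally show ?thesis .
  qed
  moreover have "f \<in> o(\<lambda>n. real n)" unfolding f_def by real_asymp
  ultimately have "\<not> ETH" unfolding ETH_def using p(1) by blast
  with assms show False by simp
qed

section \<open>Hardness of Set Cover\<close>

lemma computable_within_of_polytime_computable:
  assumes "polytime_computable e1 e2 f" "poly_bounded D B (\<lambda>x. nodes (e1 x))"
  shows "computable_within D e1 (\<lambda>x. e2 (f x)) B"
proof -
  obtain p C d where p: "\<forall>x. \<exists>t. runs p (e1 x) t (e2 (f x)) \<and> t \<le> C * nodes (e1 x) ^ d"
    using assms(1) unfolding polytime_computable_def by blast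
  then obtain t where t: "\<And>x. runs p (e1 x) (t x) (e2 (f x)) \<and> t x \<le> C * nodes (e1 x) ^ d" by metis
  have "poly_bounded D B (\<lambda>x. C * nodes (e1 x) ^ d)" by (intro poly_bounded_intros assms(2))
  then have "poly_bounded D B t" by (rule poly_bounded_mono) (use t in blast)
  with t show ?thesis unfolding computable_within_def by blast
qed

lemma OPT_le: "feasible P x s \<Longrightarrow> OPT P x \<le> cost P x s"
  unfolding OPT_def by (rule Least_le) blast

lemma OPT_set_cover_le:
  assumes "x \<in> instances set_cover"
  shows "OPT set_cover x \<le> num_sets x"
proof -
  have "(\<Union>i<num_sets x. set (subsets x ! i)) = (\<Union>S\<in>set (subsets x). set S)"
    by (force simp: in_set_conv_nth)
  then have "feasible set_cover x [0..<num_sets x]"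
    using assms by (auto simp: set_cover_def atLeast0LessThan)
  from OPT_le[OF this] show ?thesis by (simp add: set_cover_def)
qed

text \<open>The size is at most quartic in the number of variables plus one, so its eighth root is
  of the order of a square root. The choices of \<open>q\<close> and of the exponent
  \<open>1 / 40\<close> go back to this \<open>1 / 8\<close>.\<close>

lemma cnf_size_root_le:
  assumes "three_cnf I"
  shows "real (cnf_size I) powr (1 / 8) \<le> 600 * root_vars I"
proof -
  define v where "v = real (card (cnf_vars I)) + 1"
  have v: "0 < v" by (simp add: v_def)
  have "real (cnf_size I) \<le> real (600 * (card (cnf_vars I) + 1) ^ 4)"
    unfolding of_nat_le_iff by (rule cnf_size_le_vars[OF assms])
  also have "\<dots> = 600 * v powr 4" using v by (simp add: v_def add.commute)
  finally have "real (cnf_size I) powr (1 / 8) \<le> (600 * v powr 4) powr (1 / 8)"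
    by (intro powr_mono2) auto
  also have "\<dots> = 600 powr (1 / 8) * v powr (1 / 2)" using v by (simp only: powr_mult powr_powr) simp
  also have "\<dots> \<le> 600 powr 1 * v powr (1 / 2)" by (intro mult_right_mono powr_mono) auto
  also have "\<dots> = 600 * root_vars I" using v by (simp add: root_vars_def v_def powr_half_sqrt)
  finally show ?thesis .
qed

text \<open>What the conjecture yields for one choice of \<open>\<epsilon>\<close>, with its
  asymptotic terms evaluated beyond a size \<open>N\<close>. The factor 64 in \<open>sound\<close>
  is twice the 32 lost when a cover is decoded, so that the two bounds clash. The alphabet has a
  sharper bound than the edges because it ends up in an exponent.\<close>

locale game_reduction =
  fixes q N :: nat and K :: real and R :: "cnf \<Rightarrow> game"
  assumes q: "0 < q" and K: "0 \<le> K" and computable: "polytime_computable enc_cnf enc_game R"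
    and game: "projection_game (R I)"
    and complete: "N \<le> cnf_size I \<Longrightarrow> satisfiable I \<Longrightarrow>
      \<exists>\<phi>. game_assignment (R I) \<phi> \<and> satisfied_edges (R I) \<phi> = set (edges (R I))"
    and sound: "N \<le> cnf_size I \<Longrightarrow> \<not> satisfiable I \<Longrightarrow> game_assignment (R I) \<phi> \<Longrightarrow>
      64 * (nat_root q (cnf_size I))\<^sup>2 * card (satisfied_edges (R I) \<phi>) \<le> length (edges (R I))"
    and few_edges: "N \<le> cnf_size I \<Longrightarrow> 2 * length (edges (R I)) \<le> cnf_size I ^ 4"
    and alph_le: "N \<le> cnf_size I \<Longrightarrow> nalph (R I) \<le> cnf_size I"
    and small_alph: "N \<le> cnf_size I \<Longrightarrow> real (nalph (R I)) \<le> K * real (cnf_size I) powr (1 / 8)"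

lemma PGC_game_reduction:
  assumes PGC
  shows "\<exists>q N K R. game_reduction q N K R"
proof -
  obtain c :: real and \<delta> K0 d where c: "0 < c" and \<delta>: "\<delta> \<longlonglongrightarrow> 0" and
    PGC: "\<And>\<epsilon> :: nat \<Rightarrow> real. (\<forall>n. \<epsilon> n > 0) \<and> polytime_computable enc_unary enc_nat (\<lambda>n. nat \<lceil>1 / \<epsilon> n\<rceil>) \<Longrightarrow>
      (\<exists>R :: cnf \<Rightarrow> game. polytime_computable enc_cnf enc_game R \<and>
        (\<forall>I. let n = cnf_size I; G = R I in
          projection_game G \<and>
          (satisfiable I \<and> real n powr c \<ge> 1 / \<epsilon> n \<longrightarrow>
            (\<exists>\<phi>. game_assignment G \<phi> \<and> satisfied_edges G \<phi> = set (edges G))) \<and>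
          (\<not> satisfiable I \<and> real n powr c \<ge> 1 / \<epsilon> n \<longrightarrow>
            (\<forall>\<phi>. game_assignment G \<phi> \<longrightarrow>
              real (card (satisfied_edges G \<phi>)) \<le> \<epsilon> n * real (length (edges G)))) \<and>
          real (game_size G) \<le> real n powr (1 + \<delta> n) * (K0 * (1 + 1 / \<epsilon> n) ^ d) \<and>
          real (nalph G) \<le> K0 * (1 + 1 / \<epsilon> n) ^ d))"
    using assms unfolding PGC_def by blast
  \<comment> \<open>With \<open>1 / \<epsilon>\<close> of order \<open>n powr (2 / q)\<close>, the
    first entry keeps it below \<open>n powr c\<close> for large \<open>n\<close>, and the second
    keeps its \<open>d\<close>-th power of order at most \<open>n powr (1 / 8)\<close>.\<close>
  define q where "q = max (Suc (nat \<lceil>2 / c\<rceil>)) (16 * d + 1)"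
  have q: "0 < q" "2 / real q < c" "2 * real d / real q \<le> 1 / 8"
  proof -
    have "16 * d \<le> q" by (simp add: q_def)
    then have "16 * real d \<le> real q" by (metis of_nat_le_iff of_nat_mult of_nat_numeral)
    moreover show "0 < q" by (simp add: q_def)
    ultimately show "2 * real d / real q \<le> 1 / 8" by (simp add: field_simps)
    have "2 / c < real q" unfolding q_def by linarith
    then show "2 / real q < c" using c \<open>0 < q\<close> by (simp add: field_simps)
  qed
  define h where "h n = 64 * (nat_root q n)\<^sup>2" for n
  define \<epsilon> where "\<epsilon> n = 1 / real (h n)" for n
  have hpos: "0 < h n" for n using nat_root_pos[OF q(1)] by (simp add: h_def)
  then have e: "\<epsilon> n > 0" "1 / \<epsilon> n = real (h n)" for n by (simp_all add: \<epsilon>_def)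
  obtain R where R: "polytime_computable enc_cnf enc_game R"
    "\<And>I. projection_game (R I)"
    "\<And>I. satisfiable I \<Longrightarrow> real (h (cnf_size I)) \<le> real (cnf_size I) powr c \<Longrightarrow>
      \<exists>\<phi>. game_assignment (R I) \<phi> \<and> satisfied_edges (R I) \<phi> = set (edges (R I))"
    "\<And>I \<phi>. \<not> satisfiable I \<Longrightarrow> real (h (cnf_size I)) \<le> real (cnf_size I) powr c \<Longrightarrow>
      game_assignment (R I) \<phi> \<Longrightarrow>
      real (card (satisfied_edges (R I) \<phi>)) \<le> \<epsilon> (cnf_size I) * real (length (edges (R I)))"
    "\<And>I. real (game_size (R I)) \<le> real (cnf_size I) powr (1 + \<delta> (cnf_size I)) *
        (K0 * (1 + real (h (cnf_size I))) ^ d)"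
    "\<And>I. real (nalph (R I)) \<le> K0 * (1 + real (h (cnf_size I))) ^ d"
    using PGC[of \<epsilon>] polytime_computable_scaled_root[of 64 q] e unfolding Let_def
    by (auto simp: h_def[symmetric])
  \<comment> \<open>\<open>257\<close> is \<open>256 + 1\<close>: \<open>h n\<close> is at most
    \<open>256 * n powr (2 / q)\<close>, and 1 is at most one more such power. The absolute value
    allows for a negative \<open>K0\<close>.\<close>
  define K where "K = \<bar>K0\<bar> * 257 ^ d"
  have K: "0 \<le> K" by (simp add: K_def)
  have h: "real (h n) \<le> 256 * real n powr (2 / real q)" if "0 < n" for n
  proof -
    have "real (h n) = 64 * (real (nat_root q n))\<^sup>2" by (simp add: h_def)
    also have "\<dots> \<le> 64 * (2 * real n powr (1 / real q))\<^sup>2"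
      by (intro mult_left_mono power_mono nat_root_le q that) auto
    also have "\<dots> = 256 * real n powr (2 / real q)"
      using that by (simp add: power_mult_distrib powr_realpow[symmetric] powr_powr)
    finally show ?thesis .
  qed
  have hd: "K0 * (1 + real (h n)) ^ d \<le> K * real n powr (1 / 8)" if n: "0 < n" for n
  proof -
    have "1 \<le> real n powr (2 / real q)" using n by (intro ge_one_powr_ge_zero) auto
    then have "1 + real (h n) \<le> 257 * real n powr (2 / real q)" using h[OF n] by linarith
    then have "(1 + real (h n)) ^ d \<le> (257 * real n powr (2 / real q)) ^ d" by (intro power_mono) auto
    also have "\<dots> = 257 ^ d * real n powr (2 * real d / real q)"
      using n by (simp add: power_mult_distrib powr_realpow[symmetric] powr_powr ac_simps)
    also have "\<dots> \<le> 257 ^ d * real n powr (1 / 8)"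
      using n q(3) by (intro mult_left_mono powr_mono) auto
    finally have "\<bar>K0\<bar> * (1 + real (h n)) ^ d \<le> \<bar>K0\<bar> * (257 ^ d * real n powr (1 / 8))"
      by (intro mult_left_mono) auto
    moreover have "K0 * (1 + real (h n)) ^ d \<le> \<bar>K0\<bar> * (1 + real (h n)) ^ d"
        by (intro mult_right_mono) auto
    ultimately show ?thesis unfolding K_def mult.assoc by linarith
  qed
  have "0 < c - 2 / real q" using q by simp
  \<comment> \<open>In turn, the four conditions give \<open>1 / \<epsilon> \<le> n powr c\<close>,
    bound the polynomial in \<open>1 / \<epsilon>\<close> by \<open>n\<close>, reduce the exponent
    \<open>1 + \<delta> n\<close> to 2, and absorb the factor 2 in front of the number of
    edges.\<close>
  then have "\<forall>\<^sub>F n in sequentially. 256 \<le> real n powr (c - 2 / real q)" by real_asymp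
  moreover have "\<forall>\<^sub>F n in sequentially. K \<le> real n powr (7 / 8)" by real_asymp
  moreover have "\<forall>\<^sub>F n in sequentially. \<delta> n < 1" using order_tendstoD(2)[OF \<delta>] by simp
  moreover have "\<forall>\<^sub>F n in sequentially. 2 \<le> n" by (rule eventually_ge_at_top)
  ultimately have "\<forall>\<^sub>F n in sequentially. 256 \<le> real n powr (c - 2 / real q) \<and> K \<le> real n powr
      (7 / 8) \<and> \<delta> n < 1 \<and> 2 \<le> n"
    by (intro eventually_conj)
  then obtain N where N: "\<And>n. N \<le> n \<Longrightarrow> 256 \<le> real n powr (c - 2 / real q) \<and> K \<le> real n powr (7 / 8)
      \<and> \<delta> n < 1 \<and> 2 \<le> n"
    unfolding eventually_sequentially by blast
  have hc: "real (h n) \<le> real n powr c" if "N \<le> n" for n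
  proof -
    have "real (h n) \<le> 256 * real n powr (2 / real q)" using N[OF that] by (intro h) auto
    also have "\<dots> \<le> real n powr (c - 2 / real q) * real n powr (2 / real q)"
      using N[OF that] by (intro mult_right_mono) auto
    also have "\<dots> = real n powr c" by (simp flip: powr_add)
    finally show ?thesis .
  qed
  have lin: "K0 * (1 + real (h n)) ^ d \<le> real n" if "N \<le> n" for n
  proof -
    have n: "0 < n" using N[OF that] by simp
    have "K0 * (1 + real (h n)) ^ d \<le> K * real n powr (1 / 8)" by (rule hd[OF n])
    also have "\<dots> \<le> real n powr (7 / 8) * real n powr (1 / 8)"
      using N[OF that] by (intro mult_right_mono) auto
    also have "\<dots> = real n" using n by (simp flip: powr_add)
    finally show ?thesis .
  qed
  have "game_reduction q N K R"
  proof (rule game_reduction.intro[OF q(1) K R(1,2)])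
    fix I assume I: "N \<le> cnf_size I"
    define n where "n = cnf_size I"
    have n: "N \<le> n" "2 \<le> n" "\<delta> n < 1" using I N[of n] by (auto simp: n_def)
    show "satisfiable I \<Longrightarrow> \<exists>\<phi>. game_assignment (R I) \<phi> \<and> satisfied_edges (R I) \<phi> = set (edges (R I))"
      using R(3) hc[OF I] by blast
    show "real (nalph (R I)) \<le> K * real (cnf_size I) powr (1 / 8)"
      using R(6)[of I] hd[of n] n unfolding n_def by linarith
    have "real (nalph (R I)) \<le> real n" using R(6)[of I] lin[OF n(1)] unfolding n_def by linarith
    then show "nalph (R I) \<le> cnf_size I" by (simp add: n_def)
    have "real (length (edges (R I))) \<le> real (game_size (R I))" by (simp add: game_size_def)
    also have "\<dots> \<le> real n powr (1 + \<delta> n) * (K0 * (1 + real (h n)) ^ d)"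
      using R(5)[of I] by (simp add: n_def)
    also have "\<dots> \<le> real n powr (1 + \<delta> n) * real n"
      by (intro mult_left_mono lin n) auto
    also have "\<dots> \<le> real n powr 2 * real n"
      using n by (intro mult_right_mono powr_mono) auto
    also have "\<dots> = real (n ^ 3)" using n by (simp add: power3_eq_cube power2_eq_square)
    finally have "length (edges (R I)) \<le> n ^ 3" by (simp only: of_nat_le_iff)
    then have "2 * length (edges (R I)) \<le> n * n ^ 3" using n by (intro mult_mono) auto
    then show "2 * length (edges (R I)) \<le> cnf_size I ^ 4"
      by (simp add: n_def power4_eq_xxxx power3_eq_cube)
    fix \<phi> assume "\<not> satisfiable I" "game_assignment (R I) \<phi>"
    then have "real (card (satisfied_edges (R I) \<phi>)) \<le> real (length (edges (R I))) / real (h n)"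
      using R(4)[of I \<phi>] hc[OF I] by (simp add: n_def \<epsilon>_def)
    then have "real (h n * card (satisfied_edges (R I) \<phi>)) \<le> real (length (edges (R I)))"
      using hpos[of n] by (simp add: field_simps)
    then show "64 * (nat_root q (cnf_size I))\<^sup>2 * card (satisfied_edges (R I) \<phi>) \<le> length (edges (R I))"
      unfolding of_nat_le_iff by (simp add: h_def n_def)
  qed
  then show ?thesis by blast
qed

section \<open>Deciding satisfiability of large formulas with a cover algorithm\<close>

context game_reduction
begin

definition large_cnfs :: "cnf set" where
  "large_cnfs = {I. three_cnf I \<and> max N 20000 \<le> cnf_size I}"

lemma large_cnfsD: "I \<in> large_cnfs \<Longrightarrow> three_cnf I" "I \<in> large_cnfs \<Longrightarrow> N \<le> cnf_size I"
    "I \<in> large_cnfs \<Longrightarrow> 20000 \<le> cnf_size I"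
  by (auto simp: large_cnfs_def)

abbreviation cover :: "cnf \<Rightarrow> set_cover_instance" where
  "cover I \<equiv> game_cover (R I)"

abbreviation num_edges :: "cnf \<Rightarrow> nat" where
  "num_edges I \<equiv> length (edges (R I))"

lemma poly_bounded_size: "poly_bounded large_cnfs budget cnf_size"
  by (rule poly_bounded_subset[OF poly_bounded_cnf_size]) (auto simp: large_cnfs_def)

lemma poly_bounded_nodes: "poly_bounded large_cnfs budget (\<lambda>I. nodes (enc_cnf I))"
  using poly_bounded_size by (simp add: cnf_size_def[abs_def])

lemma computable_within_game: "computable_within large_cnfs enc_cnf (\<lambda>I. enc_game (R I)) budget"
  by (rule computable_within_of_polytime_computable[OF computable poly_bounded_nodes])

text \<open>This makes the power set affordable: the alphabet is at most a multiple of the eighth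
  root of the formula size, hence of \<open>root_vars I\<close>.\<close>

lemma poly_bounded_alph: "poly_bounded large_cnfs budget (\<lambda>I. 2 ^ nalph (R I))"
proof (rule poly_bounded_budget_exp[where k = "K * 600"])
  fix I assume I: "I \<in> large_cnfs"
  have "real (nalph (R I)) \<le> K * real (cnf_size I) powr (1 / 8)"
      by (rule small_alph[OF large_cnfsD(2)[OF I]])
  also have "\<dots> \<le> K * (600 * root_vars I)" by (intro mult_left_mono cnf_size_root_le large_cnfsD I K)
  finally have "real (nalph (R I)) \<le> K * 600 * root_vars I" by simp
  then have "2 powr real (nalph (R I)) \<le> 2 powr (K * 600 * root_vars I)" by (intro powr_mono) auto
  then show "real (2 ^ nalph (R I)) \<le> 2 powr (K * 600 * root_vars I)" by (simp add: powr_realpow)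
qed

lemma computable_within_cover: "computable_within large_cnfs enc_cnf
    (\<lambda>I. enc_inst set_cover (cover I)) budget"
  by (rule computable_within_game_cover[OF computable_within_game poly_bounded_nodes game
      poly_bounded_alph])

lemma num_sets_le:
  assumes "I \<in> large_cnfs"
  shows "num_sets (cover I) \<le> cnf_size I ^ 5"
proof -
  have "num_sets (cover I) \<le> cnf_size I ^ 4 * cnf_size I"
    unfolding num_sets_game_cover by (intro mult_mono few_edges alph_le large_cnfsD assms) auto
  then show ?thesis by (simp add: eval_nat_numeral ac_simps)
qed

lemma poly_bounded_num_sets: "poly_bounded large_cnfs budget (\<lambda>I. num_sets (cover I))"
  by (rule poly_bounded_mono[OF poly_bounded_power[OF poly_bounded_size, of 5]]) (rule num_sets_le)

lemma poly_bounded_universe: "poly_bounded large_cnfs budget (\<lambda>I. universe_size (cover I))"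
proof (rule poly_bounded_mono)
  show "poly_bounded large_cnfs budget (\<lambda>I. (cnf_size I ^ 4) ^ 3 * 2 ^ nalph (R I))"
    by (intro poly_bounded_intros poly_bounded_size poly_bounded_alph)
  fix I assume I: "I \<in> large_cnfs"
  have "universe_size (cover I) \<le> num_edges I ^ 3 * 2 ^ nalph (R I)"
    using length_elements[of "game_edges (R I)" "sublists (right_labels (R I))"]
    by (simp add: universe_game_cover game_elements_def length_sublists right_labels_def game_edges_def)
  also have "\<dots> \<le> (cnf_size I ^ 4) ^ 3 * 2 ^ nalph (R I)"
    using few_edges[OF large_cnfsD(2)[OF I]] by (intro mult_right_mono power_mono) auto
  finally show "universe_size (cover I) \<le> (cnf_size I ^ 4) ^ 3 * 2 ^ nalph (R I)" .
qed

text \<open>The factor uses the number of clauses, which is available in unary as the spine of the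
  encoded formula. The root in \<open>sound\<close> is taken of \<open>cnf_size I\<close> and is at
  least as large.\<close>

definition threshold :: "cnf \<Rightarrow> nat" where
  "threshold I = 2 * num_edges I * nat_root q (length I)"

lemma cover_of_unsatisfiable:
  assumes I: "I \<in> large_cnfs" and unsat: "\<not> satisfiable I" and s: "feasible set_cover (cover I) s"
  shows "threshold I < cost set_cover (cover I) s"
proof (rule ccontr)
  define w where "w = nat_root q (length I)"
  assume "\<not> threshold I < cost set_cover (cover I) s"
  then have "cost set_cover (cover I) s \<le> 2 * num_edges I * w" by (simp add: threshold_def w_def)
  moreover have w: "0 < w" by (simp add: w_def nat_root_pos q)
  ultimately obtain \<phi> where \<phi>: "game_assignment (R I) \<phi>"
      "num_edges I \<le> 32 * w\<^sup>2 * card (satisfied_edges (R I) \<phi>)"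
    using game_cover_sound[OF game s] by blast
  have "w \<le> nat_root q (cnf_size I)" unfolding w_def by (intro nat_root_mono length_le_cnf_size)
  then have "64 * w\<^sup>2 * card (satisfied_edges (R I) \<phi>) \<le> 64 * (nat_root q (cnf_size I))\<^sup>2 * card
      (satisfied_edges (R I) \<phi>)"
    by (intro mult_right_mono mult_left_mono power_mono) auto
  also have "\<dots> \<le> num_edges I" by (rule sound[OF large_cnfsD(2)[OF I] unsat \<phi>(1)])
  \<comment> \<open>For \<open>x = w\<^sup>2 * card (satisfied_edges (R I) \<phi>)\<close>, having
    \<open>64 * x\<close> below and \<open>32 * x\<close> above the number of edges leaves only
    0.\<close>
  finally have "num_edges I = 0" using \<phi>(2) by linarith
  then show False using game[of I] by (simp add: projection_game_def)
qed

lemma OPT_of_satisfiable: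
  assumes I: "I \<in> large_cnfs" and "satisfiable I"
  shows "OPT set_cover (cover I) \<le> 2 * num_edges I"
proof -
  obtain \<phi> where "game_assignment (R I) \<phi>" "satisfied_edges (R I) \<phi> = set (edges (R I))"
    using complete[OF large_cnfsD(2)[OF I] assms(2)] by blast
  from game_cover_complete[OF game this] obtain s where
    "feasible set_cover (cover I) s" "cost set_cover (cover I) s \<le> 2 * num_edges I" by blast
  then show ?thesis using OPT_le[of set_cover "cover I" s] by linarith
qed

text \<open>\<open>k\<close> is at most the fourth power of the size, and the size at most the
  fourth power of the number of clauses. So \<open>k\<close> is at most a 16th power, and the
  exponent \<open>1 / (16 * real q)\<close> turns this into a \<open>q\<close>-th root.\<close>

lemma ratio_le_threshold:
  assumes I: "I \<in> large_cnfs" and k: "k \<le> 2 * num_edges I"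
  shows "real k * real k powr (1 / (16 * real q)) \<le> real (threshold I)"
proof -
  have "k \<le> cnf_size I ^ 4" using k few_edges[OF large_cnfsD(2)[OF I]] by linarith
  also have "\<dots> \<le> (length I ^ 4) ^ 4" by (intro power_mono cnf_size_le_clauses_power large_cnfsD I) simp
  finally have "k \<le> length I ^ 16" by (simp flip: power_mult)
  then have "real k \<le> real (length I) ^ 16" by (metis of_nat_le_iff of_nat_power)
  then have "real k powr (1 / (16 * real q)) \<le> (real (length I) ^ 16) powr (1 / (16 * real q))"
    using q by (intro powr_mono2) auto
  also have "\<dots> = real (length I) powr (1 / real q)"
  proof (cases "length I = 0")
    case False
    then have "real (length I) ^ 16 = real (length I) powr 16" by simp
    then show ?thesis by (simp only: powr_powr) simp
  qed simp
  also have "\<dots> \<le> real (nat_root q (length I))" by (rule nat_root_ge[OF q])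
  finally have "real k * real k powr (1 / (16 * real q)) \<le> real (2 * num_edges I) * real
      (nat_root q (length I))"
    using k by (intro mult_mono) auto
  then show ?thesis by (simp add: threshold_def)
qed

text \<open>The output is checked against the threshold. For an unsatisfiable formula no cover that
  small exists, so the check fails whatever \<open>y I\<close> is; therefore \<open>good\<close>
  speaks of satisfiable formulas only.\<close>

lemma computable_within_satisfiable:
  assumes inp: "computable_within large_cnfs enc_cnf inp budget" and y:
      "computable_within large_cnfs inp y budget"
    and good: "\<And>I. I \<in> large_cnfs \<Longrightarrow> satisfiable I \<Longrightarrow> \<exists>s. y I = enc_sol set_cover s \<and>
      feasible set_cover (cover I) s \<and> cost set_cover (cover I) s \<le> threshold I"
  shows "computable_within large_cnfs enc_cnf (\<lambda>I. enc_bool (satisfiable I)) budget"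
proof -
  define E where "E = (\<lambda>g. spine (right (right (right g))))"
  define L where "L I = list_prod (game_edges (R I) @ game_edges (R I))
      (list_root q (spine (enc_cnf I)))" for I
  have L: "length (L I) = threshold I" for I
    by (simp add: L_def game_edges_def threshold_def length_list_root enc_cnf_def
        enc_list_eq_mk[of "enc_list (enc_prod enc_bool enc_nat)"])
  have y': "computable_within large_cnfs enc_cnf y budget"
      by (rule computable_within_trans[OF inp y poly_bounded_nodes])
  have "bptime (\<lambda>z. small_cover
      (list_prod (spine (right (right (right (left z)))) @ spine (right (right (right (left z)))))
        (list_root q (spine (left (right z)))))
      (left (right (right z))) (right (right (right z))))"
    by (intro bptime_small_cover lptime_list_prod lptime_list_root ptime_intros)
  from computable_within_ptime[OF computable_within_pair[OF computable_within_game
      computable_within_pair[OF computable_within_id[OF poly_bounded_nodes]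
          computable_within_pair[OF computable_within_cover y' poly_bounded_nodes]
              poly_bounded_nodes] poly_bounded_nodes]
      this[unfolded bptime_def] poly_bounded_nodes]
  have "computable_within large_cnfs enc_cnf (\<lambda>I. enc_bool
      (small_cover (L I) (enc_inst set_cover (cover I)) (y I))) budget"
    by (simp add: enc_game_eq L_def)
  then show ?thesis
  proof (rule computable_within_cong)
    fix I assume I: "I \<in> large_cnfs"
    have "small_cover (L I) (enc_inst set_cover (cover I)) (y I) \<longleftrightarrow> satisfiable I"
    proof
      assume "satisfiable I"
      then obtain s where "y I = enc_sol set_cover s" "feasible set_cover (cover I) s"
          "cost set_cover (cover I) s \<le> threshold I"
        using good[OF I] by blast
      then show "small_cover (L I) (enc_inst set_cover (cover I)) (y I)"
        using small_cover_of_solution[OF game_cover_instance[OF game]] by (simp add: L)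
    next
      assume "small_cover (L I) (enc_inst set_cover (cover I)) (y I)"
      then obtain s where "feasible set_cover (cover I) s" "cost set_cover (cover I) s \<le> threshold I"
        using small_cover_iff[OF game_cover_instance[OF game]] by (auto simp: L)
      then show "satisfiable I" using cover_of_unsatisfiable[OF I] by force
    qed
    then show "enc_bool (small_cover (L I) (enc_inst set_cover (cover I)) (y I)) = enc_bool
        (satisfiable I)" by simp
  qed
qed

text \<open>The number of sets is at most the fifth power of the size and \<open>40 = 5 * 8\<close>,
  so the 40th root of a smaller parameter is at most the eighth root of the size.\<close>

lemma poly_bounded_exp_num_sets:
  assumes "\<And>I. I \<in> large_cnfs \<Longrightarrow> k I \<le> num_sets (cover I)"
  shows "poly_bounded large_cnfs budget (\<lambda>I. nat \<lfloor>2 powr (real (k I) powr (1 / 40))\<rfloor>)"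
proof (rule poly_bounded_budget_exp[where k = 600])
  fix I assume I: "I \<in> large_cnfs"
  have "real (k I) \<le> real (cnf_size I ^ 5)"
    using assms[OF I] num_sets_le[OF I] unfolding of_nat_le_iff by linarith
  then have "real (k I) powr (1 / 40) \<le> real (cnf_size I ^ 5) powr (1 / 40)"
    by (intro powr_mono2) auto
  also have "\<dots> = (real (cnf_size I) powr 5) powr (1 / 40)" using large_cnfsD(3)[OF I] by simp
  also have "\<dots> = real (cnf_size I) powr (1 / 8)" by (simp only: powr_powr) simp
  also have "\<dots> \<le> 600 * root_vars I" by (intro cnf_size_root_le large_cnfsD I)
  finally have "2 powr (real (k I) powr (1 / 40)) \<le> 2 powr (600 * root_vars I)" by (intro powr_mono) auto
  then show "real (nat \<lfloor>2 powr (real (k I) powr (1 / 40))\<rfloor>) \<le> 2 powr (600 * root_vars I)"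
    by (rule order_trans[OF of_nat_floor, rotated]) simp
qed

text \<open>The common core of both halves. They differ in the input \<open>inp\<close>, which may
  carry a parameter, and in the number \<open>k I\<close> that governs the running time.\<close>

lemma no_algorithm:
  assumes inp: "computable_within large_cnfs enc_cnf inp budget"
    and k: "\<And>I. I \<in> large_cnfs \<Longrightarrow> k I \<le> num_sets (cover I)"
    and alg: "\<And>I. I \<in> large_cnfs \<Longrightarrow> \<exists>t y. runs p (inp I) t y \<and>
       real t \<le> 2 powr (real (k I) powr (1 / 40)) *
           (C * real (1 + universe_size (cover I) + num_sets (cover I)) ^ d) \<and>
       (satisfiable I \<longrightarrow> (\<exists>s. y = enc_sol set_cover s \<and>
          feasible set_cover (cover I) s \<and> cost set_cover (cover I) s \<le> threshold I))"
  shows "\<not> ETH"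
proof -
  \<comment> \<open>The constant of the assumed algorithm is real, possibly negative, and so is its
    exponential factor real; rounding both up gives a bound in natural numbers.\<close>
  define c where "c = nat \<lceil>C\<rceil>"
  define S where "S I = 1 + universe_size (cover I) + num_sets (cover I)" for I
  define X where "X I = 2 powr (real (k I) powr (1 / 40))" for I
  define W where "W I = (nat \<lfloor>X I\<rfloor> + 1) * (c * S I ^ d)" for I
  have W: "X I * (C * real (S I) ^ d) \<le> real (W I)" for I
  proof -
    have "C * real (S I) ^ d \<le> real c * real (S I) ^ d"
      unfolding c_def by (intro mult_right_mono real_nat_ceiling_ge) auto
    then have "X I * (C * real (S I) ^ d) \<le> X I * (real c * real (S I) ^ d)"
      by (intro mult_left_mono) (auto simp: X_def)
    also have "\<dots> \<le> (real (nat \<lfloor>X I\<rfloor>) + 1) * (real c * real (S I) ^ d)"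
      by (intro mult_right_mono) (linarith, simp)
    finally show ?thesis by (simp add: W_def algebra_simps)
  qed
  have "\<forall>I\<in>large_cnfs. \<exists>t y. runs p (inp I) t y \<and> t \<le> W I \<and>
       (satisfiable I \<longrightarrow> (\<exists>s. y = enc_sol set_cover s \<and>
          feasible set_cover (cover I) s \<and> cost set_cover (cover I) s \<le> threshold I))"
  proof
    fix I assume "I \<in> large_cnfs"
    from alg[OF this] obtain t y where *: "runs p (inp I) t y" "real t \<le> X I * (C * real (S I) ^ d)"
      "satisfiable I \<longrightarrow> (\<exists>s. y = enc_sol set_cover s \<and>
          feasible set_cover (cover I) s \<and> cost set_cover (cover I) s \<le> threshold I)"
      unfolding X_def S_def by blast
    have "real t \<le> real (W I)" using *(2) W[of I] by linarith
    then have "t \<le> W I" by simp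
    with * show "\<exists>t y. runs p (inp I) t y \<and> t \<le> W I \<and>
       (satisfiable I \<longrightarrow> (\<exists>s. y = enc_sol set_cover s \<and>
          feasible set_cover (cover I) s \<and> cost set_cover (cover I) s \<le> threshold I))" by blast
  qed
  then obtain t y where ty: "\<And>I. I \<in> large_cnfs \<Longrightarrow> runs p (inp I) (t I) (y I) \<and> t I \<le> W I \<and>
       (satisfiable I \<longrightarrow> (\<exists>s. y I = enc_sol set_cover s \<and>
          feasible set_cover (cover I) s \<and> cost set_cover (cover I) s \<le> threshold I))" by metis
  have "poly_bounded large_cnfs budget W" unfolding W_def S_def X_def
    by (intro poly_bounded_intros poly_bounded_universe poly_bounded_num_sets
        poly_bounded_exp_num_sets k)
  then have "poly_bounded large_cnfs budget t" by (rule poly_bounded_mono) (use ty in blast)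
  then have "computable_within large_cnfs inp y budget" using ty unfolding computable_within_def by blast
  from computable_within_satisfiable[OF inp this] ty
  have "computable_within large_cnfs enc_cnf (\<lambda>I. enc_bool (satisfiable I)) budget" by blast
  then show ?thesis using ETH_no_budget_algorithm[of "max N 20000"] unfolding large_cnfs_def by blast
qed

text \<open>The running time depends on the optimum even for unsatisfiable formulas, where no small
  cover exists; there too the number of sets bounds it.\<close>

lemma no_fpt_optimum_approx:
  assumes ETH
  shows "\<not> fpt_optimum_approx_algorithm set_cover (\<lambda>opt. real opt powr (1 / (16 * real q)))
    (\<lambda>x. 2 powr (real (OPT set_cover x) powr (1 / 40)) *
      (C * real (1 + universe_size x + num_sets x) ^ d)) p"
proof
  assume alg: "fpt_optimum_approx_algorithm set_cover (\<lambda>opt. real opt powr (1 / (16 * real q)))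
    (\<lambda>x. 2 powr (real (OPT set_cover x) powr (1 / 40)) *
      (C * real (1 + universe_size x + num_sets x) ^ d)) p"
  have inst: "cover I \<in> instances set_cover" for I by (rule game_cover_instance[OF game])
  have "\<not> ETH"
  proof (rule no_algorithm[OF computable_within_cover])
    show "OPT set_cover (cover I) \<le> num_sets (cover I)" for I by (rule OPT_set_cover_le[OF inst])
    fix I assume I: "I \<in> large_cnfs"
    obtain t s where ts: "runs p (enc_inst set_cover (cover I)) t (enc_sol set_cover s)"
      "real t \<le> 2 powr (real (OPT set_cover (cover I)) powr (1 / 40)) *
        (C * real (1 + universe_size (cover I) + num_sets (cover I)) ^ d)"
      "feasible set_cover (cover I) s" "real (cost set_cover (cover I) s) \<le>
        real (OPT set_cover (cover I)) * real (OPT set_cover (cover I)) powr (1 / (16 * real q))"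
      using alg inst[of I] unfolding fpt_optimum_approx_algorithm_def by blast
    have "cost set_cover (cover I) s \<le> threshold I" if "satisfiable I"
      using order_trans[OF ts(4) ratio_le_threshold[OF I OPT_of_satisfiable[OF I that]]] by simp
    with ts show "\<exists>t y. runs p (enc_inst set_cover (cover I)) t y \<and>
        real t \<le> 2 powr (real (OPT set_cover (cover I)) powr (1 / 40)) *
          (C * real (1 + universe_size (cover I) + num_sets (cover I)) ^ d) \<and>
        (satisfiable I \<longrightarrow> (\<exists>s. y = enc_sol set_cover s \<and>
          feasible set_cover (cover I) s \<and> cost set_cover (cover I) s \<le> threshold I))" by blast
  qed
  with assms show False by simp
qed

text \<open>The parameter is \<open>2 * num_edges I\<close>, the size of the cover built from a
  satisfying assignment, and is computed along with the instance. If the formula is satisfiable, it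
  bounds the optimum and the guarantee applies.\<close>

lemma no_fpt_approx:
  assumes ETH
  shows "\<not> fpt_approx_algorithm set_cover (\<lambda>k. real k powr (1 / (16 * real q)))
    (\<lambda>x k. 2 powr (real k powr (1 / 40)) *
      (C * real (1 + universe_size x + num_sets x) ^ d)) p"
proof
  assume alg: "fpt_approx_algorithm set_cover (\<lambda>k. real k powr (1 / (16 * real q)))
    (\<lambda>x k. 2 powr (real k powr (1 / 40)) *
      (C * real (1 + universe_size x + num_sets x) ^ d)) p"
  have inst: "cover I \<in> instances set_cover" for I by (rule game_cover_instance[OF game])
  have "ptime (\<lambda>g. enc_nat (length (spine (right (right (right g))) @ spine (right (right (right g))))))"
    by (intro ptime_intros)
  from computable_within_ptime[OF computable_within_game this poly_bounded_nodes]
  have "computable_within large_cnfs enc_cnf (\<lambda>I. enc_nat (2 * num_edges I)) budget"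
    by (simp add: enc_game_eq game_edges_def mult_2)
  from computable_within_pair[OF computable_within_cover this poly_bounded_nodes]
  have inp: "computable_within large_cnfs enc_cnf
      (\<lambda>I. Pair (enc_inst set_cover (cover I)) (enc_nat (2 * num_edges I))) budget" .
  have "\<not> ETH"
  proof (rule no_algorithm[OF inp])
    show "2 * num_edges I \<le> num_sets (cover I)" for I
      using game[of I] by (simp add: num_sets_game_cover projection_game_def)
    fix I assume I: "I \<in> large_cnfs"
    obtain t y where ty: "runs p (Pair (enc_inst set_cover (cover I)) (enc_nat (2 * num_edges I))) t y"
      "real t \<le> 2 powr (real (2 * num_edges I) powr (1 / 40)) *
        (C * real (1 + universe_size (cover I) + num_sets (cover I)) ^ d)"
      "OPT set_cover (cover I) \<le> 2 * num_edges I \<longrightarrow>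
          (\<exists>s. y = enc_sol set_cover s \<and> feasible set_cover (cover I) s \<and>
        real (cost set_cover (cover I) s) \<le> real (2 * num_edges I) * real (2 * num_edges I) powr
            (1 / (16 * real q)))"
      using alg inst[of I] unfolding fpt_approx_algorithm_def by blast
    have "\<exists>s. y = enc_sol set_cover s \<and>
          feasible set_cover (cover I) s \<and> cost set_cover (cover I) s \<le> threshold I" if "satisfiable I"
    proof -
      obtain s where s: "y = enc_sol set_cover s" "feasible set_cover (cover I) s"
        "real (cost set_cover (cover I) s) \<le> real (2 * num_edges I) * real (2 * num_edges I) powr
            (1 / (16 * real q))"
        using ty(3) OPT_of_satisfiable[OF I \<open>satisfiable I\<close>] by blast
      have "cost set_cover (cover I) s \<le> threshold I"
        using order_trans[OF s(3) ratio_le_threshold[OF I order_refl]] by simp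
      with s show ?thesis by blast
    qed
    with ty(1,2) show "\<exists>t y. runs p (Pair (enc_inst set_cover (cover I))
        (enc_nat (2 * num_edges I))) t y \<and>
        real t \<le> 2 powr (real (2 * num_edges I) powr (1 / 40)) *
          (C * real (1 + universe_size (cover I) + num_sets (cover I)) ^ d) \<and>
        (satisfiable I \<longrightarrow> (\<exists>s. y = enc_sol set_cover s \<and>
          feasible set_cover (cover I) s \<and> cost set_cover (cover I) s \<le> threshold I))" by blast
  qed
  with assms show False by simp
qed

end

theorem theorem2:
  assumes "ETH" and "PGC"
  shows "(\<exists>F1 > (0 :: real). \<exists>F2 > (0 :: real).
      \<not> (\<exists>p (C :: real) (d :: nat). fpt_optimum_approx_algorithm set_cover
        (\<lambda>opt. real opt powr F1)
        (\<lambda>x. 2 powr (real (OPT set_cover x) powr F2) *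
             (C * real (1 + universe_size x + num_sets x) ^ d)) p)) \<and>
    (\<exists>F3 > (0 :: real). \<exists>F4 > (0 :: real).
      \<not> (\<exists>p (C :: real) (d :: nat). fpt_approx_algorithm set_cover
        (\<lambda>k. real k powr F3)
        (\<lambda>x k. 2 powr (real k powr F4) *
             (C * real (1 + universe_size x + num_sets x) ^ d)) p))"
proof -
  obtain q N K R where red: "game_reduction q N K R" using PGC_game_reduction[OF assms(2)] by blast
  then have q: "0 < 1 / (16 * real q)" using game_reduction.q by force
  show ?thesis
    using game_reduction.no_fpt_optimum_approx[OF red assms(1)] game_reduction.no_fpt_approx[OF red assms(1)] q
    by (intro conjI exI[of _ "1 / (16 * real q)"] exI[of _ "1 / 40 :: real"]) auto
qed

end
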